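(* Define $\mathcal F_5(x_1,x_2)=-5x_1^2+66x_1x_2+7x_2^2$; $\mathcal F_7(x_1,x_2,x_3)=-7x_1^2+5x_2^2+5x_3^2-20x_2x_3+52x_1x_2$; $\mathcal F_{11}(x_1,\dots,x_5)=-11x_1^2+x_2^2+13x_3^2+x_4^2+x_5^2+34x_3x_1+42x_2x_4-40x_2x_5+38x_3x_5-10x_4x_5$; $\mathcal F_{13}(x_1,\dots,x_6)=-13x_1^2+11x_2^2-x_3^2-x_4^2-x_5^2+11x_6^2+16x_2x_1+38x_1x_5+2x_2x_3-20x_2x_4+40x_2x_5-8x_2x_6+14x_4x_6$; $\mathcal F_{17}(x_1,\dots,x_8)=-17x_1^2+19x_2^2+7x_3^2-5x_4^2-5x_5^2-5x_6^2-5x_7^2+19x_8^2-12x_2x_3+54x_2x_5+12x_5x_6+30x_2x_7-42x_5x_7-60x_2x_8+12x_3x_8-54x_5x_8-12x_7x_8$; $\mathcal F_{19}(x_1,\dots,x_9)=-19x_1^2+41x_2^2+5x_3^2-7x_4^2-7x_5^2+5x_6^2+5x_7^2-7x_8^2-7x_9^2+16x_2x_5-36x_3x_5+8x_4x_5+32x_5x_6+12x_4x_7-16x_5x_7+28x_5x_8-12x_6x_8-4x_2x_9+68x_3x_9+16x_5x_9-28x_8x_9$. Then for each prime $p$ with $5\le p\le 19$ and every integer $a$ coprime to $p$, $$\frac{12}{\mathcal E_{a,p}}\,q\frac{d}{dq}\mathcal E_{a,p}=\mathcal F_p\left(\mathcal E_{a\cdot a_{1,p},p},\mathcal E_{a\cdot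 a_{2,p},p},\dots,\mathcal E_{a\cdot a_{(p-1)/2,p},p}\right)+pE_2(q^p),$$ where $E_2(q)=1-24\sum_{n\ge1}\frac{nq^n}{1-q^n}$.
   Context: $q=e^{2\pi i\tau}$. For an odd Dirichlet character $\chi$ mod $p$, $E_{1,\chi}(\tau)=1+\frac{2}{L(0,\chi)}\sum_{n\ge1}\chi(n)\frac{q^n}{1-q^n}$ ($L(0,\chi)$ the value at $0$ of the continued $L$-function). For $b$ coprime to $p$, $\mathcal E_{b,p}=\frac{2}{p-1}\sum_{\chi\text{ odd}}\chi(b)E_{1,\chi}$ (depends only on $b$ mod $p$; equivalently $(\gamma_{21}\tau+\gamma_{22})^{-1}\mathcal E_{1,p}(\gamma\tau)$ for $\gamma\in SL(2,\mathbb Z)$, $\gamma_{21}\equiv0$, $\gamma_{22}\equiv b\pmod p$). The constants are $(a_{k,5})=(1,2)$, $(a_{k,7})=(1,2,3)$, $(a_{k,11})=(1,2,3,5,7)$, $(a_{k,13})=(1,2,3,4,5,7)$, $(a_{k,17})=(1,2,3,5,7,8,11,13)$, $(a_{k,19})=(1,2,3,4,5,7,9,11,13)$. *)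

theory Defs
  imports "HOL-Complex_Analysis.Complex_Analysis" "HOL-Computational_Algebra.Primes"
begin

definition dirichlet_character :: "nat \<Rightarrow> (int \<Rightarrow> complex) \<Rightarrow> bool" where
  "dirichlet_character N \<psi> \<longleftrightarrow>
     \<psi> 1 = 1 \<and>
     (\<forall>m n. \<psi> (m * n) = \<psi> m * \<psi> n) \<and>
     (\<forall>m. \<psi> (m + int N) = \<psi> m) \<and>
     (\<forall>m. \<psi> m = 0 \<longleftrightarrow> \<not> coprime m (int N))"

definition odd_characters :: "nat \<Rightarrow> (int \<Rightarrow> complex) set" where
  "odd_characters N = {\<psi>. dirichlet_character N \<psi> \<and> \<psi> (-1) = -1}"

text \<open>The continued L-function of a nonprincipal character (in particular of an odd one): the
  entire function that agrees with the Dirichlet series where Re s > 1. It is unique by the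
  identity theorem. For a principal character there is no such function (pole at 1) and the
  value below is unspecified.\<close>

definition dirichlet_L :: "(int \<Rightarrow> complex) \<Rightarrow> complex \<Rightarrow> complex" where
  "dirichlet_L \<psi> = (THE f. f holomorphic_on UNIV \<and>
     (\<forall>s. Re s > 1 \<longrightarrow> (\<lambda>n. \<psi> (int (Suc n)) / of_nat (Suc n) powr s) sums f s))"

definition nome :: "complex \<Rightarrow> complex" where
  "nome \<tau> = exp (2 * of_real pi * \<i> * \<tau>)"

definition E1 :: "(int \<Rightarrow> complex) \<Rightarrow> complex \<Rightarrow> complex" where
  "E1 \<psi> \<tau> = 1 + 2 / dirichlet_L \<psi> 0 *
     (\<Sum>n. \<psi> (int (Suc n)) * nome \<tau> ^ Suc n / (1 - nome \<tau> ^ Suc n))"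

definition calE :: "int \<Rightarrow> nat \<Rightarrow> complex \<Rightarrow> complex" where
  "calE b p \<tau> = 2 / of_nat (p - 1) * (\<Sum>\<psi>\<in>odd_characters p. \<psi> b * E1 \<psi> \<tau>)"

definition E2 :: "complex \<Rightarrow> complex" where
  "E2 q = 1 - 24 * (\<Sum>n. of_nat (Suc n) * q ^ Suc n / (1 - q ^ Suc n))"

text \<open>The operator q d/dq on functions of the upper half-plane variable \<open>\<tau>\<close>, where
  q = nome \<open>\<tau>\<close>, so that dq = 2 pi i q d\<open>\<tau>\<close>; the lemma below confirms the normalisation.\<close>

definition q_ddq :: "(complex \<Rightarrow> complex) \<Rightarrow> complex \<Rightarrow> complex" where
  "q_ddq f \<tau> = deriv f \<tau> / (2 * of_real pi * \<i>)"

lemma q_ddq_nome: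
  assumes "f field_differentiable at (nome \<tau>)"
  shows "q_ddq (\<lambda>t. f (nome t)) \<tau> = nome \<tau> * deriv f (nome \<tau>)"
proof -
  have n: "(nome has_field_derivative 2 * of_real pi * \<i> * nome \<tau>) (at \<tau>)"
    unfolding nome_def by (auto intro!: derivative_eq_intros)
  have "(f has_field_derivative deriv f (nome \<tau>)) (at (nome \<tau>))"
    using assms by (simp add: field_differentiable_derivI)
  from DERIV_chain2[OF this n]
  have "deriv (\<lambda>t. f (nome t)) \<tau> = deriv f (nome \<tau>) * (2 * of_real pi * \<i> * nome \<tau>)"
    by (rule DERIV_imp_deriv)
  then show ?thesis
    by (simp add: q_ddq_def field_simps)
qed

text \<open>In the quadratic forms the variable \<open>x\<^sub>k\<close> is \<open>x k\<close>, with k = 1, ..., (p - 1)/2.\<close>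

definition calF_5 :: "(nat \<Rightarrow> complex) \<Rightarrow> complex" where
  "calF_5 x =
     - 5 * (x 1)^2 + 66 * x 1 * x 2 + 7 * (x 2)^2"

definition calF_7 :: "(nat \<Rightarrow> complex) \<Rightarrow> complex" where
  "calF_7 x =
     - 7 * (x 1)^2 + 5 * (x 2)^2 + 5 * (x 3)^2 - 20 * x 2 * x 3 + 52 * x 1 * x 2"

definition calF_11 :: "(nat \<Rightarrow> complex) \<Rightarrow> complex" where
  "calF_11 x =
     - 11 * (x 1)^2 + (x 2)^2 + 13 * (x 3)^2 + (x 4)^2 + (x 5)^2 + 34 * x 3 * x 1
     + 42 * x 2 * x 4 - 40 * x 2 * x 5 + 38 * x 3 * x 5 - 10 * x 4 * x 5"

definition calF_13 :: "(nat \<Rightarrow> complex) \<Rightarrow> complex" where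
  "calF_13 x =
     - 13 * (x 1)^2 + 11 * (x 2)^2 - (x 3)^2 - (x 4)^2 - (x 5)^2 + 11 * (x 6)^2
     + 16 * x 2 * x 1 + 38 * x 1 * x 5 + 2 * x 2 * x 3 - 20 * x 2 * x 4 + 40 * x 2 * x 5
     - 8 * x 2 * x 6 + 14 * x 4 * x 6"

definition calF_17 :: "(nat \<Rightarrow> complex) \<Rightarrow> complex" where
  "calF_17 x =
     - 17 * (x 1)^2 + 19 * (x 2)^2 + 7 * (x 3)^2 - 5 * (x 4)^2 - 5 * (x 5)^2 - 5 * (x 6)^2
     - 5 * (x 7)^2 + 19 * (x 8)^2 - 12 * x 2 * x 3 + 54 * x 2 * x 5 + 12 * x 5 * x 6
     + 30 * x 2 * x 7 - 42 * x 5 * x 7 - 60 * x 2 * x 8 + 12 * x 3 * x 8 - 54 * x 5 * x 8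
     - 12 * x 7 * x 8"

definition calF_19 :: "(nat \<Rightarrow> complex) \<Rightarrow> complex" where
  "calF_19 x =
     - 19 * (x 1)^2 + 41 * (x 2)^2 + 5 * (x 3)^2 - 7 * (x 4)^2 - 7 * (x 5)^2 + 5 * (x 6)^2
     + 5 * (x 7)^2 - 7 * (x 8)^2 - 7 * (x 9)^2 + 16 * x 2 * x 5 - 36 * x 3 * x 5
     + 8 * x 4 * x 5 + 32 * x 5 * x 6 + 12 * x 4 * x 7 - 16 * x 5 * x 7 + 28 * x 5 * x 8
     - 12 * x 6 * x 8 - 4 * x 2 * x 9 + 68 * x 3 * x 9 + 16 * x 5 * x 9 - 28 * x 8 * x 9"

text \<open>The fallback values for other p are never used.\<close>

definition calF :: "nat \<Rightarrow> (nat \<Rightarrow> complex) \<Rightarrow> complex" where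
  "calF p x =
     (if p = 5 then calF_5 x
      else if p = 7 then calF_7 x
      else if p = 11 then calF_11 x
      else if p = 13 then calF_13 x
      else if p = 17 then calF_17 x
      else if p = 19 then calF_19 x
      else 0)"

definition a_list :: "nat \<Rightarrow> int list" where
  "a_list p =
     (if p = 5 then [1, 2]
      else if p = 7 then [1, 2, 3]
      else if p = 11 then [1, 2, 3, 5, 7]
      else if p = 13 then [1, 2, 3, 4, 5, 7]
      else if p = 17 then [1, 2, 3, 5, 7, 8, 11, 13]
      else if p = 19 then [1, 2, 3, 4, 5, 7, 9, 11, 13]
      else [])"

definition a_const :: "nat \<Rightarrow> nat \<Rightarrow> int" where
  "a_const k p = a_list p ! (k - 1)"

end

theory Submission
  imports Defs "HOL-Number_Theory.Residue_Primitive_Roots"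
begin

text \<open>Let \<open>w\<^sub>k\<close> be the value of the Weierstrass zeta function of the lattice \<open>\<int> + p \<tau> \<int>\<close>, made periodic,
  at the torsion point \<open>k \<tau>\<close>. Then \<open>L(0, \<psi>) E\<^sub>1\<^sub>,\<^sub>\<psi> = \<Sum>\<^sub>k \<psi>(k) w\<^sub>k\<close>, and inverting the generalised Bernoulli
  numbers for the six primes shows that \<open>calE b p\<close> is a sum of only four values
  \<open>w\<^sub>k\<^sub>/\<^sub>b\<close>, with the four indices \<open>k\<close> adding up to \<open>p\<close>. By the heat equation
  \<open>q dw\<^sub>k/dq = p (\<wp>'\<^sub>k / 2 - w\<^sub>k \<wp>\<^sub>k + E\<^sub>2(q\<^sup>p) w\<^sub>k / 12)\<close>, and since a sum of four zeta values whose arguments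
  add up to zero is a product of sigma functions, the addition theorem
  \<open>(w\<^sub>i + w\<^sub>j + w\<^sub>k)\<^sup>2 = \<wp>\<^sub>i + \<wp>\<^sub>j + \<wp>\<^sub>k\<close> for \<open>i + j + k = 0\<close> and its derivative give the logarithmic derivative of
  \<open>calE b p\<close> as a quadratic expression in the \<open>w\<^sub>k\<close> plus a linear one in the \<open>\<wp>\<^sub>k\<close>. A linear combination of
  instances of the addition theorem turns it into the stated quadratic form. Finally, \<open>calE b p\<close>
  has no zeros because it is a nontrivial solution of a homogeneous linear differential equation.\<close>

section \<open>Dirichlet L-functions at 0\<close>

text \<open>Two obstacles shape the proof. \<open>dirichlet_L\<close> is a definite description, so
  an entire continuation has to be constructed before its value at 0 means anything. And since
  \<open>12 / 0 = 0\<close>, the claim would read differently at a zero of \<open>calE\<close>, so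
  nonvanishing must be proved; as it follows from the differential equation itself, that equation is
  established first in a form without division. The zeta function enters as a Laurent series on the
  annulus between \<open>Q\<close> and 1. Its addition theorem is a comparison of coefficients in
  products of such series and comes down to a partial fraction identity in \<open>Q powi a\<close>
  and \<open>Q powi b\<close>. The four indices are found at \<open>q = 0\<close>: there
  \<open>calE b p\<close> has constant term \<open>odd_delta p b\<close>, while the zeta value at
  \<open>k\<close> has the constant term \<open>1/2 - k/p\<close>. Hence a four-term formula forces
  an identity between sawtooth values, a finite check modulo \<open>p\<close>, and this same
  identity already determines all Lambert coefficients.\<close>

primrec powr_diff :: "nat \<Rightarrow> complex \<Rightarrow> complex \<Rightarrow> complex" where
  "powr_diff 0 s z = z powr (-s)"
| "powr_diff (Suc k) s z = powr_diff k s z - powr_diff k s (z + 1)"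

lemma holomorphic_powr_diff:
  assumes "Re z > 0"
  shows "(\<lambda>s. powr_diff k s z) holomorphic_on A"
  using assms
proof (induction k arbitrary: z)
  case 0
  then have "z \<noteq> 0" by auto
  then show ?case by (auto intro!: holomorphic_intros)
next
  case (Suc k)
  then show ?case by (auto intro!: holomorphic_intros)
qed

lemma has_field_derivative_powr_diff:
  assumes "Re z > 0"
  shows "(powr_diff k s has_field_derivative - s * powr_diff k (s + 1) z) (at z)"
  using assms
proof (induction k arbitrary: z)
  case 0
  then have z: "z \<notin> \<real>\<^sub>\<le>\<^sub>0"
    by (auto simp: complex_nonpos_Reals_iff)
  have "((\<lambda>z. z powr (-s)) has_field_derivative - s * z powr (- s - 1)) (at z)"
    using has_field_derivative_powr[OF z, of "-s"] by simp
  moreover have "powr_diff 0 s = (\<lambda>z. z powr (-s))" "- (s + 1) = - s - 1"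
    by auto
  ultimately show ?case
    by (simp only: powr_diff.simps)
next
  case (Suc k)
  have "((\<lambda>z. powr_diff k s (z + 1)) has_field_derivative - s * powr_diff k (s + 1) (z + 1)) (at z)"
    using DERIV_shift[of "powr_diff k s" _ z 1] Suc.IH[of "z + 1"] Suc.prems by simp
  from DERIV_diff[OF Suc.IH[OF Suc.prems] this] show ?case
    by (simp add: algebra_simps)
qed

text \<open>At \<open>s = 0\<close> every power is 1, so all differences vanish. This is why only
  the first mean survives in the value at 0 of the continued series.\<close>

lemma powr_diff_Suc_0:
  assumes "Re z > 0"
  shows "powr_diff (Suc k) 0 z = 0"
  using assms
proof (induction k arbitrary: z)
  case 0
  then have "z \<noteq> 0" "z + 1 \<noteq> 0" by (auto simp: complex_eq_iff)
  then show ?case by simp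
next
  case (Suc k)
  from Suc.IH[of z] Suc.IH[of "z + 1"] Suc.prems show ?case by simp
qed

text \<open>\<open>powr_diff k s\<close> is \<open>(-1)^k\<close> times the k-th forward difference
  of \<open>z powr (-s)\<close>, and each difference gains one power of decay. By the mean value
  inequality on the segment from \<open>x\<close> to \<open>x + 1\<close>, one difference costs a
  factor \<open>s\<close> and a shift of \<open>s\<close> to \<open>s + 1\<close>. The condition on
  \<open>Re s\<close> makes the bounding power decreasing, so its maximum on the segment is at
  \<open>x\<close>.\<close>

lemma norm_powr_diff_le:
  assumes "x > 0" "Re s + real k \<ge> 0"
  shows "norm (powr_diff k s (of_real x)) \<le> (\<Prod>i<k. norm (s + of_nat i)) * x powr (- Re s - real k)"
  using assms
proof (induction k arbitrary: s x)
  case 0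
  then show ?case by (simp add: norm_powr_real_powr)
next
  case (Suc k)
  let ?B = "norm s * ((\<Prod>i<k. norm (s + 1 + of_nat i)) * x powr (- Re (s + 1) - real k))"
  have "norm (powr_diff k s (of_real x) - powr_diff k s (of_real x + 1))
          \<le> ?B * norm (of_real x - (of_real x + 1 :: complex))"
  proof (rule field_differentiable_bound[where S = "closed_segment (of_real x) (of_real x + 1)"
        and f' = "\<lambda>z. - s * powr_diff k (s + 1) z"])
    fix z :: complex assume "z \<in> closed_segment (of_real x) (of_real x + 1)"
    then obtain y where y: "z = of_real y" "x \<le> y"
      using closed_segment_of_real[of x "x + 1", where 'a = complex]
      by (auto simp: closed_segment_eq_real_ivl)
    show "(powr_diff k s has_field_derivative - s * powr_diff k (s + 1) z)
            (at z within closed_segment (of_real x) (of_real x + 1))"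
      by (rule has_field_derivative_at_within, rule has_field_derivative_powr_diff) (use y Suc.prems in simp)
    have "norm (powr_diff k (s + 1) z)
            \<le> (\<Prod>i<k. norm (s + 1 + of_nat i)) * y powr (- Re (s + 1) - real k)"
      unfolding y(1) using Suc.prems y by (intro Suc.IH) auto
    also have "\<dots> \<le> (\<Prod>i<k. norm (s + 1 + of_nat i)) * x powr (- Re (s + 1) - real k)"
      using Suc.prems y by (intro mult_left_mono powr_mono2' prod_nonneg) auto
    finally show "norm (- s * powr_diff k (s + 1) z) \<le> ?B"
      by (simp add: norm_mult mult_left_mono)
  qed auto
  also have "norm (of_real x - (of_real x + 1 :: complex)) = 1" by simp
  also have "?B * 1 = (\<Prod>i<Suc k. norm (s + of_nat i)) * x powr (- Re s - real (Suc k))"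
  proof -
    have "- Re (s + 1) - real k = - Re s - real (Suc k)" by simp
    then show ?thesis
      unfolding prod.lessThan_Suc_shift by (simp only: of_nat_0 of_nat_Suc add_0_right mult_1 ac_simps o_def add_0)
  qed
  finally show ?case by simp
qed

lemma tendsto_powr_diff_0:
  assumes "Re s + real k > 0"
  shows "(\<lambda>n. powr_diff k s (of_nat (Suc n))) \<longlonglongrightarrow> 0"
proof (rule Lim_null_comparison)
  show "\<forall>\<^sub>F n in sequentially. norm (powr_diff k s (of_nat (Suc n)))
     \<le> (\<Prod>i<k. norm (s + of_nat i)) * real (Suc n) powr (- Re s - real k)"
    using norm_powr_diff_le[of "real (Suc _)" s k] assms by (intro always_eventually allI) (simp del: of_nat_Suc)
  have "(\<lambda>n. real (Suc n) powr (- Re s - real k)) \<longlonglongrightarrow> 0"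
    using assms
    by (intro tendsto_neg_powr filterlim_compose[OF filterlim_real_sequentially] filterlim_Suc) auto
  from tendsto_mult_right_zero[OF this]
  show "(\<lambda>n. (\<Prod>i<k. norm (s + of_nat i)) * real (Suc n) powr (- Re s - real k)) \<longlonglongrightarrow> 0" .
qed

definition powr_diff_series :: "(nat \<Rightarrow> complex) \<Rightarrow> nat \<Rightarrow> complex \<Rightarrow> complex" where
  "powr_diff_series c k s = (\<Sum>n. c n * powr_diff k s (of_nat (Suc n)))"

lemma powr_diff_series_holomorphic_sums:
  assumes c: "\<And>n. norm (c n) \<le> C"
  shows "powr_diff_series c k holomorphic_on {s. Re s > 1 - real k}"
    and "Re s > 1 - real k \<Longrightarrow> (\<lambda>n. c n * powr_diff k s (of_nat (Suc n))) sums powr_diff_series c k s"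
proof -
  let ?S = "{s. Re s > 1 - real k}"
  have C: "C \<ge> 0" using norm_ge_zero c by (rule order_trans)
  have "\<exists>g. \<forall>x\<in>?S. (\<lambda>n. c n * powr_diff k x (of_nat (Suc n))) sums g x \<and> g field_differentiable at x"
  proof (rule series_differentiable_comparison_complex[of ?S "\<lambda>n s. c n * powr_diff k s (of_nat (Suc n))"])
    show "open ?S" by (rule open_halfspace_Re_gt)
    fix n :: nat and x assume "x \<in> ?S"
    show "(\<lambda>s. c n * powr_diff k s (of_nat (Suc n))) field_differentiable at x"
      by (rule holomorphic_on_imp_differentiable_at[of _ UNIV])
         (intro holomorphic_intros holomorphic_powr_diff, auto)
  next
    fix x assume x: "x \<in> ?S"
    \<comment> \<open>Half the distance from \<open>x\<close> to the boundary line: on the ball of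
      radius \<open>d\<close> the exponent of decay \<open>Re y + k\<close> stays above
      \<open>1 + d\<close>, which gives a summable majorant.\<close>
    define d where "d = (Re x - 1 + real k) / 2"
    have d: "d > 0" using x by (simp add: d_def)
    let ?D = "C * (\<Prod>i<k. norm x + d + real i)"
    let ?h = "\<lambda>n. complex_of_real (?D * real (Suc n) powr (- (Re x - d) - real k))"
    have "summable (\<lambda>n. real n powr (- (Re x - d) - real k))"
      using d by (subst summable_real_powr_iff) (auto simp: d_def field_simps)
    then have sm: "summable ?h"
      by (subst (asm) summable_Suc_iff[symmetric])
         (intro summable_of_real summable_mult)
    have D: "?D \<ge> 0" using C d by (intro mult_nonneg_nonneg prod_nonneg) auto
    have bd: "norm (c n * powr_diff k y (of_nat (Suc n))) \<le> norm (?h n)" if y: "y \<in> ball x d" for n y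
    proof -
      have yx: "norm (y - x) < d" using y by (simp add: dist_norm norm_minus_commute)
      have "\<bar>Re y - Re x\<bar> < d" using abs_Re_le_cmod[of "y - x"] yx by simp
      then have re1: "Re y \<ge> Re x - d" by linarith
      moreover have "Re x - d + real k \<ge> 0" using x by (simp add: d_def field_simps)
      ultimately have re: "Re y \<ge> Re x - d" "Re y + real k \<ge> 0" by auto
      have "norm (powr_diff k y (of_nat (Suc n)))
          \<le> (\<Prod>i<k. norm (y + of_nat i)) * real (Suc n) powr (- Re y - real k)"
        using norm_powr_diff_le[of "real (Suc n)" y k] re by simp
      also have "\<dots> \<le> (\<Prod>i<k. norm x + d + real i) * real (Suc n) powr (- (Re x - d) - real k)"
      proof (intro mult_mono prod_mono conjI)
        fix i
        have "norm (y + of_nat i) \<le> norm y + real i" by (metis norm_triangle_ineq norm_of_nat)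
        also have "norm y \<le> norm x + d" using norm_triangle_sub[of y x] yx by simp
        finally show "norm (y + of_nat i) \<le> norm x + d + real i" by simp
        show "real (Suc n) powr (- Re y - real k) \<le> real (Suc n) powr (- (Re x - d) - real k)"
          using re by (intro powr_mono) auto
      qed (use d in \<open>auto intro!: prod_nonneg\<close>)
      finally have "norm (c n) * norm (powr_diff k y (of_nat (Suc n)))
          \<le> C * ((\<Prod>i<k. norm x + d + real i) * real (Suc n) powr (- (Re x - d) - real k))"
        using C by (intro mult_mono c) auto
      also have "\<dots> = norm (?h n)"
        unfolding norm_of_real
        using mult_nonneg_nonneg[OF D powr_ge_zero] by (subst abs_of_nonneg) (simp_all only: mult.assoc)
      finally show ?thesis by (simp add: norm_mult)
    qed
    show "\<exists>d h. 0 < d \<and> summable h \<and> range h \<subseteq> \<real>\<^sub>\<ge>\<^sub>0 \<and>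
        (\<forall>\<^sub>F n in sequentially. \<forall>y\<in>ball x d \<inter> ?S. cmod (c n * powr_diff k y (of_nat (Suc n))) \<le> cmod (h n))"
    proof (intro exI conjI)
      show "range ?h \<subseteq> \<real>\<^sub>\<ge>\<^sub>0"
        using mult_nonneg_nonneg[OF D powr_ge_zero]
        by (auto simp: nonneg_Reals_of_real_iff simp del: of_nat_Suc of_real_mult)
    qed (use d sm bd in auto)
  qed auto
  then obtain g where g: "\<And>x. x \<in> ?S \<Longrightarrow> (\<lambda>n. c n * powr_diff k x (of_nat (Suc n))) sums g x"
      "\<And>x. x \<in> ?S \<Longrightarrow> g field_differentiable at x" by blast
  have eq: "g x = powr_diff_series c k x" if "x \<in> ?S" for x
    using g(1)[OF that] by (simp add: powr_diff_series_def sums_iff)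
  have "g holomorphic_on ?S"
    using g(2) by (simp add: holomorphic_on_def field_differentiable_at_within)
  then show "powr_diff_series c k holomorphic_on ?S"
    using eq by (rule holomorphic_transform)
  show "(\<lambda>n. c n * powr_diff k s (of_nat (Suc n))) sums powr_diff_series c k s" if "Re s > 1 - real k"
    using g(1) eq that by auto
qed

lemma summation_by_parts_sums:
  fixes c f :: "nat \<Rightarrow> complex"
  assumes bound: "\<And>n. norm (\<Sum>i\<le>n. c i) \<le> B"
    and f: "f \<longlonglongrightarrow> 0"
    and sums: "(\<lambda>n. (\<Sum>i\<le>n. c i) * (f n - f (Suc n))) sums A"
  shows "(\<lambda>n. c n * f n) sums A"
proof -
  have eq: "(\<Sum>n\<le>m. c n * f n) = (\<Sum>n\<le>m. (\<Sum>i\<le>n. c i) * (f n - f (Suc n))) + (\<Sum>i\<le>m. c i) * f (Suc m)" for m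
    by (induction m) (auto simp: algebra_simps)
  have "(\<lambda>m. (\<Sum>i\<le>m. c i) * f (Suc m)) \<longlonglongrightarrow> 0"
  proof (rule Lim_null_comparison)
    show "\<forall>\<^sub>F m in sequentially. norm ((\<Sum>i\<le>m. c i) * f (Suc m)) \<le> B * norm (f (Suc m))"
      using bound by (auto simp: norm_mult intro!: always_eventually mult_right_mono)
    have "(\<lambda>m. f (Suc m)) \<longlonglongrightarrow> 0" using f by (rule LIMSEQ_Suc)
    from tendsto_mult_right_zero[OF tendsto_norm_zero[OF this]]
    show "(\<lambda>m. B * norm (f (Suc m))) \<longlonglongrightarrow> 0" .
  qed
  with sums show ?thesis
    unfolding sums_def_le eq using tendsto_add[of _ A _ _ 0] by simp
qed

section \<open>Continuation of Dirichlet series with periodic coefficients of sum zero\<close>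

locale periodic_sum_zero =
  fixes N :: nat and c :: "nat \<Rightarrow> complex"
  assumes N: "N > 0" and periodic: "c (n + N) = c n" and sum_zero: "(\<Sum>n<N. c n) = 0"
begin

lemma c_mod: "c (n mod N) = c n"
proof -
  have "c (m + k * N) = c m" for m k
  proof (induction k)
    case (Suc k)
    with periodic[of "m + k * N"] show ?case by (simp add: ac_simps)
  qed simp
  from this[of "n mod N" "n div N"] show ?thesis by simp
qed

lemma bounded: "norm (c n) \<le> (\<Sum>i<N. norm (c i))"
proof -
  have "norm (c (n mod N)) \<le> (\<Sum>i<N. norm (c i))"
    using N by (intro member_le_sum) auto
  then show ?thesis by (simp only: c_mod)
qed

definition psum :: "nat \<Rightarrow> complex" where
  "psum n = (\<Sum>i\<le>n. c i)"

lemma psum_periodic: "psum (n + N) = psum n"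
proof -
  have "psum (n + N) = (\<Sum>i<N. c i) + (\<Sum>i\<in>{N..n + N}. c i)"
    unfolding psum_def by (subst sum.union_disjoint[symmetric]) (auto intro!: sum.cong)
  also have "(\<Sum>i\<in>{N..n + N}. c i) = (\<Sum>i\<le>n. c (i + N))"
    by (rule sum.reindex_bij_witness[of _ "\<lambda>i. i + N" "\<lambda>i. i - N"]) auto
  finally show ?thesis by (simp add: sum_zero periodic psum_def)
qed

definition mean :: complex where
  "mean = (\<Sum>n<N. psum n) / of_nat N"

text \<open>The partial sums are again periodic because the sum over a period vanishes; subtracting
  their mean restores the hypothesis, so summation by parts can be iterated without end.\<close>

lemma next_periodic_sum_zero: "periodic_sum_zero N (\<lambda>n. psum n - mean)"
  using N by unfold_locales (auto simp: psum_periodic sum_subtractf mean_def)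

lemma psum_bounded: "\<exists>B. \<forall>n. norm (psum n) \<le> B"
proof -
  interpret nxt: periodic_sum_zero N "\<lambda>n. psum n - mean" by (rule next_periodic_sum_zero)
  have "norm (psum n) \<le> (\<Sum>i<N. norm (psum i - mean)) + norm mean" for n
    using nxt.bounded[of n] norm_triangle_ineq2[of "psum n" mean] by linarith
  then show ?thesis by blast
qed

text \<open>Summation by parts moves a difference from the coefficients to \<open>n powr -s\<close>; each such step
  enlarges the half-plane of convergence by one.\<close>

lemma powr_diff_series_step:
  assumes s: "Re s > 1 - real k"
  shows "powr_diff_series c k s = mean * powr_diff k s 1 + powr_diff_series (\<lambda>n. psum n - mean) (Suc k) s"
proof -
  interpret nxt: periodic_sum_zero N "\<lambda>n. psum n - mean" by (rule next_periodic_sum_zero)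
  define f where "f n = powr_diff k s (of_nat (Suc n))" for n
  have f: "f \<longlonglongrightarrow> 0" unfolding f_def by (rule tendsto_powr_diff_0) (use s in simp)
  have f1: "f n - f (Suc n) = powr_diff (Suc k) s (of_nat (Suc n))" for n
    by (simp add: f_def add.commute add.left_commute)
  \<comment> \<open>The partial sums split into their mean and a part of mean zero. The constant
    part telescopes to the boundary term at \<open>n = 0\<close>.\<close>
  have const: "(\<lambda>n. mean * (f n - f (Suc n))) sums (mean * (f 0 - 0))"
    by (intro sums_mult telescope_sums' f)
  have rest: "(\<lambda>n. (psum n - mean) * (f n - f (Suc n))) sums powr_diff_series (\<lambda>n. psum n - mean) (Suc k) s"
    unfolding f1 by (rule powr_diff_series_holomorphic_sums(2)[where c = "\<lambda>n. psum n - mean", OF nxt.bounded]) (use s in simp)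
  have "(\<lambda>n. psum n * (f n - f (Suc n))) sums
      (mean * f 0 + powr_diff_series (\<lambda>n. psum n - mean) (Suc k) s)"
    using sums_add[OF const rest] by (simp add: algebra_simps)
  then have "(\<lambda>n. c n * f n) sums (mean * f 0 + powr_diff_series (\<lambda>n. psum n - mean) (Suc k) s)"
    using psum_bounded f summation_by_parts_sums[of c _ f] unfolding psum_def by blast
  then show ?thesis
    by (simp add: powr_diff_series_def[of c] f_def sums_iff)
qed

end

text \<open>Each summation by parts gains a strip of width one. It replaces both \<open>c\<close>
  and \<open>k\<close>, so both are generalised in the induction.\<close>

lemma powr_diff_series_extends:
  assumes "periodic_sum_zero N c"
  shows "\<exists>g. g holomorphic_on {s. Re s > 1 - real k - real m} \<and>
             (\<forall>s. Re s > 1 - real k \<longrightarrow> g s = powr_diff_series c k s)"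
  using assms
proof (induction m arbitrary: c k)
  case 0
  then interpret periodic_sum_zero N c .
  show ?case
    using powr_diff_series_holomorphic_sums(1)[where c = c and k = k, OF bounded] by auto
next
  case (Suc m)
  then interpret periodic_sum_zero N c by simp
  from Suc.IH[OF next_periodic_sum_zero, where k = "Suc k"] obtain g where
    g: "g holomorphic_on {s. Re s > 1 - real (Suc k) - real m}"
       "\<And>s. Re s > 1 - real (Suc k) \<Longrightarrow> g s = powr_diff_series (\<lambda>n. psum n - mean) (Suc k) s"
    by blast
  show ?case
  proof (intro exI[of _ "\<lambda>s. mean * powr_diff k s 1 + g s"] conjI allI impI)
    show "(\<lambda>s. mean * powr_diff k s 1 + g s) holomorphic_on {s. Re s > 1 - real k - real (Suc m)}"
      using g(1) by (auto intro!: holomorphic_intros holomorphic_powr_diff simp: algebra_simps)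
  qed (use g(2) powr_diff_series_step in auto)
qed

text \<open>The extensions to the half-planes \<open>Re s > 1 - m\<close> agree on overlaps by the
  identity theorem and glue to an entire function.\<close>

lemma (in periodic_sum_zero) entire_extension:
  "\<exists>f. f holomorphic_on UNIV \<and> (\<forall>s. Re s > 1 \<longrightarrow> f s = powr_diff_series c 0 s) \<and> f 0 = mean"
proof -
  let ?S = "\<lambda>m. {s. Re s > 1 - real m}"
  have "\<forall>m. \<exists>g. g holomorphic_on ?S m \<and> (\<forall>s. Re s > 1 \<longrightarrow> g s = powr_diff_series c 0 s)"
    using powr_diff_series_extends[OF periodic_sum_zero_axioms, of 0] by simp
  then obtain g where g: "\<And>m. g m holomorphic_on ?S m"
      "\<And>m s. Re s > 1 \<Longrightarrow> g m s = powr_diff_series c 0 s"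
    by metis
  have unique: "h1 s = h2 s" if "h1 holomorphic_on ?S m" "h2 holomorphic_on ?S m"
      "\<And>s. Re s > 1 \<Longrightarrow> h1 s = h2 s" "s \<in> ?S m" for h1 h2 m s
  proof (rule analytic_continuation_open[of "{s. Re s > 1}" "?S m" h1 h2])
    have "2 \<in> {s. Re s > 1}" by simp
    then show "{s. Re s > 1} \<noteq> {}" by blast
    show "connected (?S m)" by (intro convex_connected convex_halfspace_Re_gt)
  qed (use that in \<open>auto intro: open_halfspace_Re_gt\<close>)
  \<comment> \<open>Any \<open>m\<close> with \<open>Re s > 1 - m\<close> gives the same value; this
    choice satisfies the inequality for every \<open>s\<close>.\<close>
  define f where "f s = g (nat \<lceil>\<bar>Re s\<bar>\<rceil> + 2) s" for s
  have f: "f s = g m s" if "Re s > 1 - real m" for s m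
  proof -
    define n where "n = nat \<lceil>\<bar>Re s\<bar>\<rceil> + 2"
    have n: "Re s > 1 - real n" unfolding n_def by linarith
    have "g n s = g m s"
    proof (rule unique[of "g n" "min n m" "g m" s])
      show "g n holomorphic_on ?S (min n m)" "g m holomorphic_on ?S (min n m)"
        by (rule holomorphic_on_subset[OF g(1)], simp add: Collect_mono_iff min_def)+
    qed (use g(2) n that in auto)
    then show ?thesis by (simp add: f_def n_def)
  qed
  have hol: "f holomorphic_on ?S m" for m
    by (rule holomorphic_transform[OF g(1)[of m]]) (rule f[symmetric], simp)
  have "f holomorphic_on UNIV"
  proof (subst holomorphic_on_open[OF open_UNIV], safe)
    fix s
    define m where "m = nat \<lceil>\<bar>Re s\<bar>\<rceil> + 2"
    have "s \<in> ?S m" unfolding m_def by (auto; linarith)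
    with hol[of m] show "\<exists>f'. (f has_field_derivative f') (at s)"
      using holomorphic_on_open[OF open_halfspace_Re_gt] by blast
  qed
  moreover have f1: "f s = powr_diff_series c 0 s" if "Re s > 1" for s
    using f[of 0 s] g(2)[of s 0] that by simp
  moreover have "f 0 = mean"
  proof -
    interpret nxt: periodic_sum_zero N "\<lambda>n. psum n - mean" by (rule next_periodic_sum_zero)
    interpret nn: periodic_sum_zero N "\<lambda>n. nxt.psum n - nxt.mean" by (rule nxt.next_periodic_sum_zero)
    \<comment> \<open>Two summations by parts are needed: after one the half-plane is
      \<open>Re s > 0\<close> and still misses 0, after two it is \<open>Re s > -1\<close>. At 0 all
      terms except the first contain a difference and vanish.\<close>
    define h where "h s = mean * powr_diff 0 s 1 + (nxt.mean * powr_diff 1 s 1 +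
        powr_diff_series (\<lambda>n. nxt.psum n - nxt.mean) 2 s)" for s
    have "h holomorphic_on ?S 2"
      unfolding h_def using powr_diff_series_holomorphic_sums(1)[where c = "\<lambda>n. nxt.psum n - nxt.mean" and k = 2, OF nn.bounded]
      by (intro holomorphic_intros holomorphic_powr_diff) (auto simp: numeral_2_eq_2)
    moreover have "h s = powr_diff_series c 0 s" if "Re s > 1" for s
      using powr_diff_series_step[of 0 s] nxt.powr_diff_series_step[of 1 s] that
      by (simp add: h_def numeral_2_eq_2)
    ultimately have "f 0 = h 0"
      using hol[of 2] f1 by (intro unique[of f 2 h 0]) auto
    also have "\<dots> = mean"
      using powr_diff_Suc_0[of 1 0] powr_diff_Suc_0[of "of_nat (Suc _)" 1]
      by (simp add: h_def powr_diff_series_def numeral_2_eq_2 del: powr_diff.simps(2) of_nat_Suc)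
    finally show ?thesis .
  qed
  ultimately show ?thesis by (intro exI[of _ f]) auto
qed

section \<open>The value at 0 for odd characters\<close>

lemma dirichlet_character_mod:
  assumes "dirichlet_character N \<psi>"
  shows "\<psi> (m mod int N) = \<psi> m"
proof -
  have per: "\<psi> (m + int N) = \<psi> m" for m
    using assms by (simp add: dirichlet_character_def)
  have nat: "\<psi> (m + int k * int N) = \<psi> m" for m k
  proof (induction k)
    case (Suc k)
    with per[of "m + int k * int N"] show ?case by (simp add: algebra_simps)
  qed simp
  have "\<psi> (m + k * int N) = \<psi> m" for m k
  proof (cases k)
    case (nonneg n)
    then show ?thesis using nat[of m n] by simp
  next
    case (neg n)
    then have "m + k * int N + int (Suc n) * int N = m" by (simp only: algebra_simps)
    then show ?thesis using nat[of "m + k * int N" "Suc n"] by metis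
  qed
  from this[of "m mod int N" "m div int N"] show ?thesis by (simp add: algebra_simps)
qed

lemma sum_odd_character:
  assumes "\<psi> \<in> odd_characters N"
  shows "(\<Sum>n<N. \<psi> (int (Suc n))) = 0"
proof -
  have chi: "dirichlet_character N \<psi>" "\<psi> (-1) = -1"
    using assms by (auto simp: odd_characters_def)
  have mod: "\<psi> (m mod int N) = \<psi> m" for m using chi(1) by (rule dirichlet_character_mod)
  have odd: "\<psi> (- m) = - \<psi> m" for m
    using chi by (metis dirichlet_character_def mult_minus1)
  have refl: "\<psi> (int N - m) = - \<psi> m" for m
    using mod[of "int N - m"] mod[of "- m"] odd by simp
  have "(\<Sum>n<N. \<psi> (int (Suc n))) = (\<Sum>n<N. \<psi> (int n))"
  proof (cases N)
    case (Suc k)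
    have "\<psi> (int N) = \<psi> 0" using mod[of "int N"] by simp
    then show ?thesis
      unfolding Suc by (subst (2) sum.lessThan_Suc_shift, subst sum.lessThan_Suc) simp
  qed simp
  also have "\<dots> = (\<Sum>n<N. \<psi> (int (N - Suc n)))" by (rule sum.nat_diff_reindex[symmetric])
  also have "\<dots> = - (\<Sum>n<N. \<psi> (int (Suc n)))"
    unfolding sum_negf[symmetric]
    by (intro sum.cong refl[THEN trans[rotated]]) (auto simp: of_nat_diff)
  finally show ?thesis by simp
qed

text \<open>The value at 0 is the mean of the partial sums of \<open>\<psi>\<close>, that is, the
  Cesaro value of the divergent series. Rewriting this mean yields minus the generalised first
  Bernoulli number.\<close>

lemma dirichlet_L_0:
  assumes \<psi>: "\<psi> \<in> odd_characters N" and N: "N > 0"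
  shows "dirichlet_L \<psi> 0 = (\<Sum>j\<in>{1..<N}. \<psi> (int j) * (1/2 - of_nat j / of_nat N))"
proof -
  have chi: "dirichlet_character N \<psi>"
    using \<psi> by (auto simp: odd_characters_def)
  define c where "c n = \<psi> (int (Suc n))" for n
  interpret periodic_sum_zero N c
  proof
    show "(\<Sum>n<N. c n) = 0" unfolding c_def using \<psi> by (rule sum_odd_character)
    have per: "\<psi> (int (Suc n) + int N) = \<psi> (int (Suc n))" for n
      using chi unfolding dirichlet_character_def by blast
    have "int (Suc (n + N)) = int (Suc n) + int N" for n by simp
    then show "c (n + N) = c n" for n by (simp only: c_def per)
  qed fact
  have series: "powr_diff_series c 0 s = S \<longleftrightarrow> (\<lambda>n. \<psi> (int (Suc n)) / of_nat (Suc n) powr s) sums S"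
    if "Re s > 1" for s S
  proof -
    have "(\<lambda>n. c n * powr_diff 0 s (of_nat (Suc n))) sums powr_diff_series c 0 s"
      by (rule powr_diff_series_holomorphic_sums(2)[where c = c, OF bounded]) (use that in simp)
    moreover have "(\<lambda>n. c n * powr_diff 0 s (of_nat (Suc n))) = (\<lambda>n. \<psi> (int (Suc n)) / of_nat (Suc n) powr s)"
      by (auto simp: c_def powr_minus field_simps)
    ultimately show ?thesis by (metis sums_unique2)
  qed
  from entire_extension obtain f where
    f: "f holomorphic_on UNIV" "\<And>s. Re s > 1 \<Longrightarrow> f s = powr_diff_series c 0 s" "f 0 = mean"
    by blast
  have "dirichlet_L \<psi> = f"
    unfolding dirichlet_L_def
  proof (rule the_equality)
    show "f holomorphic_on UNIV \<and>
        (\<forall>s. 1 < Re s \<longrightarrow> (\<lambda>n. \<psi> (int (Suc n)) / of_nat (Suc n) powr s) sums f s)"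
      using f series by metis
    fix g assume g: "g holomorphic_on UNIV \<and>
        (\<forall>s. 1 < Re s \<longrightarrow> (\<lambda>n. \<psi> (int (Suc n)) / of_nat (Suc n) powr s) sums g s)"
    show "g = f"
    proof
      fix s
      show "g s = f s"
      proof (rule analytic_continuation_open[of "{s. Re s > 1}" UNIV g f])
        have "2 \<in> {s. Re s > 1}" by simp
        then show "{s. Re s > 1} \<noteq> {}" by blast
        show "g z = f z" if "z \<in> {s. Re s > 1}" for z
          using that g f(2) series by force
      qed (use f g in \<open>auto intro: open_halfspace_Re_gt\<close>)
    qed
  qed
  then have "dirichlet_L \<psi> 0 = mean" using f(3) by simp
  also have "mean = (\<Sum>n<N. c n * (1/2 - of_nat (Suc n) / of_nat N))"
  proof -
    \<comment> \<open>\<open>c n\<close> occurs in the partial sums with indices \<open>n\<close> to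
      \<open>M - 1\<close>, hence \<open>M - n\<close> times.\<close>
    have "(\<Sum>n<M. psum n) = (\<Sum>n<M. c n * (of_nat M - of_nat n))" for M
    proof (induction M)
      case (Suc M)
      then have "(\<Sum>n<Suc M. psum n) = (\<Sum>n<M. c n * (of_nat M - of_nat n)) + (\<Sum>n<M. c n) + c M"
        by (simp add: psum_def lessThan_Suc_atMost[symmetric])
      also have "(\<Sum>n<M. c n * (of_nat M - of_nat n)) + (\<Sum>n<M. c n) =
          (\<Sum>n<M. c n * (of_nat (Suc M) - of_nat n))"
        by (simp add: sum.distrib[symmetric] algebra_simps)
      finally show ?case by simp
    qed simp
    then have "mean = (\<Sum>n<N. c n * (of_nat N - of_nat n)) / of_nat N"
      by (simp add: mean_def)
    also have "\<dots> = (\<Sum>n<N. c n * (of_nat N - of_nat n) / of_nat N)"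
      by (rule sum_divide_distrib)
    \<comment> \<open>The constant \<open>1/2 + 1/N\<close> can be split off because the
      coefficients sum to zero over a period; it centres the weights.\<close>
    also have "\<dots> = (\<Sum>n<N. c n * (1/2 - of_nat (Suc n) / of_nat N) + c n * (1/2 + 1 / of_nat N))"
      using N by (intro sum.cong) (auto simp: field_simps)
    also have "\<dots> = (\<Sum>n<N. c n * (1/2 - of_nat (Suc n) / of_nat N)) + (\<Sum>n<N. c n) * (1/2 + 1 / of_nat N)"
      by (simp add: sum.distrib sum_distrib_right)
    finally show ?thesis by (simp add: sum_zero)
  qed
  also have "\<dots> = (\<Sum>j\<in>{1..N}. \<psi> (int j) * (1/2 - of_nat j / of_nat N))"
    unfolding c_def
    by (rule sum.reindex_bij_witness[of _ "\<lambda>j. j - 1" Suc]) auto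
  also have "\<dots> = (\<Sum>j\<in>{1..<N}. \<psi> (int j) * (1/2 - of_nat j / of_nat N))"
  \<comment> \<open>The term \<open>j = N\<close> drops out because \<open>\<psi> N = 0\<close>,
    which fails for \<open>N = 1\<close>. That case is contradictory, since 1 and -1 are then
    congruent while an odd character separates them.\<close>
  proof (cases "N = 1")
    case True
    then have "\<psi> (-1) = \<psi> (1)"
      using dirichlet_character_mod[OF chi, of 1] dirichlet_character_mod[OF chi, of "-1"] by simp
    moreover have "\<psi> 1 = 1" "\<psi> (-1) = -1"
      using \<psi> by (auto simp: odd_characters_def dirichlet_character_def)
    ultimately show ?thesis by simp
  next
    case False
    have "\<psi> (int N) = 0"
      using chi False by (simp add: dirichlet_character_def)
    moreover have "{1..N} = insert N {1..<N}" using N by auto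
    ultimately show ?thesis by simp
  qed
  finally show ?thesis .
qed

section \<open>Addition theorem and heat equation\<close>

text \<open>For complex families unconditional and absolute summability agree, so the product family
  is absolutely summable and Fubini applies.\<close>

lemma has_sum_Times_complex:
  fixes f :: "'a \<Rightarrow> complex" and g :: "'b \<Rightarrow> complex"
  assumes f: "(f has_sum a) A" and g: "(g has_sum b) B"
  shows "((\<lambda>(x, y). f x * g y) has_sum (a * b)) (A \<times> B)"
proof (rule has_sum_SigmaI)
  show "((\<lambda>y. case (x, y) of (x, y) \<Rightarrow> f x * g y) has_sum f x * b) B" for x
    using has_sum_cmult_right[OF g] by simp
  show "((\<lambda>x. f x * b) has_sum (a * b)) A"
    by (rule has_sum_cmult_left[OF f])
  have fs: "(\<lambda>x. norm (f x)) summable_on A" and gs: "(\<lambda>x. norm (g x)) summable_on B"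
    using f g summable_on_iff_abs_summable_on_complex by (blast dest: has_sum_imp_summable)+
  have "(\<lambda>z. norm (case z of (x, y) \<Rightarrow> f x * g y)) summable_on A \<times> B"
    unfolding Infinite_Sum.abs_summable_on_Sigma_iff
    using fs gs by (auto simp: norm_mult infsum_cmult_right' abs_mult infsum_nonneg
        intro: summable_on_cmult_right summable_on_cmult_left)
  then show "(\<lambda>(x, y). f x * g y) summable_on A \<times> B"
    by (rule abs_summable_summable)
qed

lemma has_sum_diff:
  fixes f g :: "'a \<Rightarrow> 'b :: real_normed_vector"
  assumes "(f has_sum a) A" "(g has_sum b) A"
  shows "((\<lambda>x. f x - g x) has_sum (a - b)) A"
  using has_sum_add[OF assms(1), of "\<lambda>x. - g x" "- b"] assms(2) by (simp add: has_sum_uminus)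

lemma has_sum_int_split:
  fixes f :: "int \<Rightarrow> complex"
  assumes "((\<lambda>n. f (int n)) has_sum a) {1..}" and "((\<lambda>n. f (- int n)) has_sum b) {1..}"
  shows "(f has_sum (f 0 + a + b)) UNIV"
proof -
  have "(f has_sum a) (int ` {1..})" "(f has_sum b) ((\<lambda>n. - int n) ` {1..})"
    using assms by (subst has_sum_reindex; simp add: inj_on_def o_def)+
  moreover have "(f has_sum f 0) {0}" by (simp add: has_sum_finiteI)
  moreover have "int ` {1..} = {0<..}" "(\<lambda>n. - int n) ` {1..} = {..<0}"
  proof -
    have "x \<in> int ` {1..}" if "x > 0" for x
      using that by (intro image_eqI[of _ _ "nat x"]) auto
    then show "int ` {1..} = {0<..}" by auto
    have "x \<in> (\<lambda>n. - int n) ` {1..}" if "x < 0" for x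
      using that by (intro image_eqI[of _ _ "nat (- x)"]) auto
    then show "(\<lambda>n. - int n) ` {1..} = {..<0}" by auto
  qed
  ultimately have "(f has_sum f 0 + a + b) ({0} \<union> {0<..} \<union> {..<0})"
    by (intro has_sum_Un_disjoint) auto
  moreover have "{0} \<union> {0<..} \<union> {..<0} = (UNIV :: int set)" by auto
  ultimately show ?thesis by simp
qed

lemma norm_power_less_1:
  fixes z :: "'a :: real_normed_field"
  assumes "norm z < 1" "n \<in> {1..}"
  shows "norm (z ^ n) < 1"
  using assms by (auto simp: norm_power power_less_one_iff)

lemma has_sum_geometric_from_1:
  fixes z :: "'a :: {real_normed_field, banach}"
  assumes "norm z < 1"
  shows "((\<lambda>n. z ^ n) has_sum (z / (1 - z))) {1..}"
proof -
  have "((\<lambda>n. z ^ n) has_sum (1 / (1 - z))) UNIV"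
    using assms by (intro norm_summable_imp_has_sum geometric_sums) (simp_all add: norm_power summable_geometric)
  moreover have "((\<lambda>n. z ^ n) has_sum 1) {0}" by (simp add: has_sum_finiteI)
  ultimately have "((\<lambda>n. z ^ n) has_sum (1 / (1 - z) - 1)) (UNIV - {0})"
    by (rule has_sum_Diff) auto
  moreover have "UNIV - {0} = {1 :: nat..}" by auto
  moreover have "1 - z \<noteq> 0" using assms by auto
  then have "1 / (1 - z) - 1 = z / (1 - z)" by (simp add: field_simps)
  ultimately show ?thesis by simp
qed

text \<open>The weight \<open>n^j\<close> is the effect of applying \<open>y d/dy\<close> to the
  series \<open>j\<close> times, so differentiation merely raises \<open>j\<close>.\<close>

definition weighted_powser :: "(nat \<Rightarrow> complex) \<Rightarrow> nat \<Rightarrow> complex \<Rightarrow> complex" where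
  "weighted_powser c j y = (\<Sum>n. of_nat n ^ j * c n * y ^ n)"

lemma summable_power_times_geometric:
  fixes t :: real
  assumes "norm t < 1"
  shows "summable (\<lambda>n. real n ^ j * t ^ n)"
  using assms
proof (induction j arbitrary: t)
  case 0
  then show ?case by (simp add: summable_geometric)
next
  case (Suc j)
  have "summable (\<lambda>n. diffs (\<lambda>n. real n ^ j) n * t ^ n)"
    using Suc.prems Suc.IH by (rule termdiff_converges)
  then have "summable (\<lambda>n. diffs (\<lambda>n. real n ^ j) n * t ^ n * t)" by (rule summable_mult2)
  then have "summable (\<lambda>n. real (Suc n) ^ Suc j * t ^ Suc n)"
    by (simp add: diffs_def algebra_simps)
  then show ?case by (subst (asm) summable_Suc_iff)
qed

lemma summable_norm_weighted_powser:
  fixes y :: complex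
  assumes c: "\<And>n. norm (c n) \<le> C" and y: "norm y < 1"
  shows "summable (\<lambda>n. norm (of_nat n ^ j * c n * y ^ n))"
proof (rule summable_comparison_test')
  have "summable (\<lambda>n. real n ^ j * norm y ^ n)"
    using y by (intro summable_power_times_geometric) simp
  then have "summable (\<lambda>n. norm (real n ^ j * norm y ^ n))" by (simp add: norm_mult norm_power)
  then show "summable (\<lambda>n. C * norm (real n ^ j * norm y ^ n))" by (rule summable_mult)
  show "norm (norm (of_nat n ^ j * c n * y ^ n)) \<le> C * norm (real n ^ j * norm y ^ n)" for n
    using mult_right_mono[OF c[of n], of "real n ^ j * norm y ^ n"]
    by (simp add: norm_mult norm_power algebra_simps)
qed

lemma weighted_powser_sums:
  assumes "\<And>n. norm (c n) \<le> C" and "norm y < 1"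
  shows "(\<lambda>n. of_nat n ^ j * c n * y ^ n) sums weighted_powser c j y"
  using summable_norm_weighted_powser[OF assms, where j = j]
  unfolding weighted_powser_def by (intro summable_sums) (rule summable_norm_cancel)

lemma weighted_powser_has_sum:
  assumes "\<And>n. norm (c n) \<le> C" and "norm y < 1" and "c 0 = 0"
  shows "((\<lambda>n. of_nat n ^ j * c n * y ^ n) has_sum weighted_powser c j y) {1..}"
proof -
  have "((\<lambda>n. of_nat n ^ j * c n * y ^ n) has_sum weighted_powser c j y) UNIV"
    using assms by (intro norm_summable_imp_has_sum summable_norm_weighted_powser weighted_powser_sums)
  also have "((\<lambda>n. of_nat n ^ j * c n * y ^ n) has_sum weighted_powser c j y) UNIV \<longleftrightarrow> ?thesis"
    by (rule has_sum_cong_neutral) (use assms in \<open>auto simp: not_le\<close>)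
  finally show ?thesis .
qed

lemma has_field_derivative_weighted_powser:
  assumes c: "\<And>n. norm (c n) \<le> C" and y: "norm y < 1" "y \<noteq> 0"
  shows "(weighted_powser c j has_field_derivative weighted_powser c (Suc j) y / y) (at y)"
proof -
  let ?d = "\<lambda>n. of_nat n ^ j * c n"
  have s: "summable (\<lambda>n. ?d n * z ^ n)" if "norm z < 1" for z
    using weighted_powser_sums[OF c that] by (simp add: sums_iff)
  have "((\<lambda>z. \<Sum>n. ?d n * z ^ n) has_field_derivative (\<Sum>n. diffs ?d n * y ^ n)) (at y)"
    using s y(1) by (rule termdiffs_strong')
  moreover have "(\<Sum>n. diffs ?d n * y ^ n) = weighted_powser c (Suc j) y / y"
  proof -
    have "summable (\<lambda>n. diffs ?d n * y ^ n)"
      using y(1) s by (rule termdiff_converges)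
    from diffs_equiv[OF this] have "(\<lambda>n. of_nat n * ?d n * y ^ (n - Suc 0) * y) sums ((\<Sum>n. diffs ?d n * y ^ n) * y)"
      by (rule sums_mult2)
    moreover have "(\<lambda>n. of_nat n * ?d n * y ^ (n - Suc 0) * y) = (\<lambda>n. of_nat n ^ Suc j * c n * y ^ n)"
    proof
      fix n show "of_nat n * ?d n * y ^ (n - Suc 0) * y = of_nat n ^ Suc j * c n * y ^ n"
        by (cases n) auto
    qed
    ultimately have "(\<Sum>n. diffs ?d n * y ^ n) * y = weighted_powser c (Suc j) y"
      using weighted_powser_sums[OF c y(1), of "Suc j"] by (simp add: sums_unique2)
    then show ?thesis using y(2) by (simp add: field_simps)
  qed
  ultimately show ?thesis by (simp add: weighted_powser_def[abs_def])
qed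

section \<open>Laurent series for the zeta function and its derivatives\<close>

locale lambert =
  fixes Q :: complex
  assumes Q_nz: "Q \<noteq> 0" and norm_Q: "norm Q < 1"
begin

text \<open>Both coefficient sequences vanish at \<open>n = 0\<close>, by division by zero.\<close>

definition lam :: "nat \<Rightarrow> complex" where "lam n = 1 / (1 - Q ^ n)"
definition kap :: "nat \<Rightarrow> complex" where "kap n = 1 / (1 - Q ^ n)\<^sup>2"

lemma lam_0 [simp]: "lam 0 = 0" and kap_0 [simp]: "kap 0 = 0"
  by (simp_all add: lam_def kap_def)

lemma norm_Q_power_less: "n > 0 \<Longrightarrow> norm (Q ^ n) < 1"
  using norm_Q by (simp add: norm_power power_less_one_iff)

lemma Q_power_neq_1: "n > 0 \<Longrightarrow> Q ^ n \<noteq> 1"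
  using norm_Q_power_less[of n] by force

lemma norm_lam: "norm (lam n) \<le> 1 / (1 - norm Q)"
proof (cases "n = 0")
  case False
  have "norm Q ^ n \<le> norm Q ^ 1" using False norm_Q by (intro power_decreasing) auto
  then have "1 - norm Q \<le> norm (1 - Q ^ n)"
    using norm_triangle_ineq2[of 1 "Q ^ n"] by (simp add: norm_power)
  then show ?thesis using norm_Q by (simp add: lam_def norm_divide frac_le)
qed (use norm_Q in auto)

lemma kap_eq: "kap n = (lam n)\<^sup>2"
  by (simp add: kap_def lam_def power_divide)

lemma norm_kap: "norm (kap n) \<le> (1 / (1 - norm Q))\<^sup>2"
  unfolding kap_eq norm_power by (intro power_mono norm_lam) auto

abbreviation Lam where "Lam \<equiv> weighted_powser lam"
abbreviation Kap where "Kap \<equiv> weighted_powser kap"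

text \<open>Here the expansions in powers of \<open>x\<close> and of \<open>Q / x\<close> both
  converge. For \<open>Q = q ^ p\<close> the annulus contains \<open>q ^ k\<close> for
  \<open>0 < k < p\<close>, and \<open>x\<close> to \<open>Q / x\<close> exchanges \<open>k\<close>
  and \<open>p - k\<close>.\<close>

definition annulus :: "complex set" where
  "annulus = {x. norm Q < norm x \<and> norm x < 1}"

lemma annulusD:
  assumes "x \<in> annulus"
  shows "x \<noteq> 0" "norm x < 1" "norm (Q / x) < 1" "norm (Q * x) < 1"
proof -
  show nz: "x \<noteq> 0" and x: "norm x < 1" using assms by (auto simp: annulus_def)
  show "norm (Q / x) < 1" using assms nz by (simp add: annulus_def norm_divide)
  show "norm (Q * x) < 1" using mult_strict_mono[of "norm Q" 1 "norm x" 1] norm_Q x by (simp add: norm_mult)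
qed

lemma open_annulus: "open annulus"
  unfolding annulus_def by (intro open_Collect_conj open_Collect_less continuous_intros)

text \<open>\<open>-\<rho>\<close> is the logarithmic derivative \<open>x d/dx\<close> of the theta function
  \<open>(x^(-1/2) - x^(1/2)) \<Prod>(1 - Q\<^sup>n x) (1 - Q\<^sup>n / x)\<close>, that is, up to rescaling and
  a linear term, the Weierstrass zeta function; \<open>\<rho>\<^sub>1\<close>, \<open>\<rho>\<^sub>2\<close> are its derivatives with respect to \<open>x d/dx\<close>.\<close>

definition \<rho> :: "complex \<Rightarrow> complex" where "\<rho> x = 1/2 + Lam 0 x - Lam 0 (Q / x)"
definition \<rho>1 :: "complex \<Rightarrow> complex" where "\<rho>1 x = Lam 1 x + Lam 1 (Q / x)"
definition \<rho>2 :: "complex \<Rightarrow> complex" where "\<rho>2 x = Lam 2 x - Lam 2 (Q / x)"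
text \<open>The Laurent series with coefficients \<open>Q^n / (1 - Q^n)^2\<close> for nonzero
  \<open>n\<close>. Its derivative \<open>\<kappa>1\<close> under \<open>x d/dx\<close> equals
  \<open>Q d/dQ\<close> of \<open>\<rho>\<close> at fixed \<open>x\<close>. Unlike
  \<open>\<rho>\<close>, it is regular at \<open>x = 1\<close>.\<close>

definition \<kappa> :: "complex \<Rightarrow> complex" where "\<kappa> x = Kap 0 (Q * x) + Kap 0 (Q / x)"
definition \<kappa>1 :: "complex \<Rightarrow> complex" where "\<kappa>1 x = Kap 1 (Q * x) - Kap 1 (Q / x)"

lemma \<rho>_inverse: "x \<noteq> 0 \<Longrightarrow> \<rho> (Q / x) = 1 - \<rho> x"
  and \<rho>1_inverse: "x \<noteq> 0 \<Longrightarrow> \<rho>1 (Q / x) = \<rho>1 x"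
  and \<rho>2_inverse: "x \<noteq> 0 \<Longrightarrow> \<rho>2 (Q / x) = - \<rho>2 x"
  using Q_nz by (simp_all add: \<rho>_def \<rho>1_def \<rho>2_def)

lemmas has_field_derivative_Lam = has_field_derivative_weighted_powser[where c = lam, OF norm_lam]
lemmas has_field_derivative_Kap = has_field_derivative_weighted_powser[where c = kap, OF norm_kap]

lemma has_field_derivative_Q_divide: "x \<noteq> 0 \<Longrightarrow> ((\<lambda>x. Q / x) has_field_derivative - (Q / x) / x) (at x)"
  by (auto intro!: derivative_eq_intros simp: field_simps power2_eq_square)

lemma has_field_derivative_Lam_Q_divide:
  assumes "x \<in> annulus"
  shows "((\<lambda>x. Lam j (Q / x)) has_field_derivative - Lam (Suc j) (Q / x) / x) (at x)"
  using DERIV_chain2[OF has_field_derivative_Lam has_field_derivative_Q_divide, of x j] annulusD[OF assms] Q_nz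
  by (simp add: field_simps)

lemma has_field_derivative_\<rho>: "x \<in> annulus \<Longrightarrow> (\<rho> has_field_derivative \<rho>1 x / x) (at x)"
  and has_field_derivative_\<rho>1: "x \<in> annulus \<Longrightarrow> (\<rho>1 has_field_derivative \<rho>2 x / x) (at x)"
  and has_field_derivative_\<kappa>: "x \<in> annulus \<Longrightarrow> (\<kappa> has_field_derivative \<kappa>1 x / x) (at x)"
proof -
  assume x: "x \<in> annulus"
  note D = annulusD[OF x]
  show "(\<rho> has_field_derivative \<rho>1 x / x) (at x)"
    unfolding \<rho>_def[abs_def] \<rho>1_def
    by (rule derivative_eq_intros has_field_derivative_Lam has_field_derivative_Lam_Q_divide refl D x)+
       (simp add: add_divide_distrib)
  show "(\<rho>1 has_field_derivative \<rho>2 x / x) (at x)"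
    unfolding \<rho>1_def[abs_def] \<rho>2_def
    by (rule derivative_eq_intros has_field_derivative_Lam has_field_derivative_Lam_Q_divide refl D x)+
       (simp add: diff_divide_distrib numeral_2_eq_2)
  have "((\<lambda>x. Kap 0 (Q * x)) has_field_derivative (Kap (Suc 0) (Q * x) / (Q * x)) * Q) (at x)"
    by (rule DERIV_chain2[OF has_field_derivative_Kap]) (use D Q_nz in \<open>auto intro!: derivative_eq_intros\<close>)
  moreover have "((\<lambda>x. Kap 0 (Q / x)) has_field_derivative (Kap (Suc 0) (Q / x) / (Q / x)) * (- (Q / x) / x)) (at x)"
    by (rule DERIV_chain2[OF has_field_derivative_Kap has_field_derivative_Q_divide]) (use D Q_nz in auto)
  ultimately have "(\<kappa> has_field_derivative (Kap (Suc 0) (Q * x) / (Q * x)) * Q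
      + (Kap (Suc 0) (Q / x) / (Q / x)) * (- (Q / x) / x)) (at x)"
    unfolding \<kappa>_def[abs_def] by (rule DERIV_add)
  also have "(Kap (Suc 0) (Q * x) / (Q * x)) * Q + (Kap (Suc 0) (Q / x) / (Q / x)) * (- (Q / x) / x) = \<kappa>1 x / x"
    using D(1) Q_nz by (simp add: \<kappa>1_def diff_divide_distrib)
  finally show "(\<kappa> has_field_derivative \<kappa>1 x / x) (at x)" .
qed

text \<open>The Laurent coefficients of \<open>\<rho>\<close>. The value \<open>1/2\<close> at 0 is
  the one for which \<open>lc (- n) = 1 - lc n\<close> holds for every \<open>n\<close>.\<close>

definition lc :: "int \<Rightarrow> complex" where
  "lc n = (if n = 0 then 1/2 else 1 / (1 - Q powi n))"
definition kc :: "int \<Rightarrow> complex" where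
  "kc n = (if n = 0 then 0 else Q powi n / (1 - Q powi n)\<^sup>2)"

lemma Q_powi_neq_1: "n \<noteq> 0 \<Longrightarrow> Q powi n \<noteq> 1"
proof (cases "n > 0")
  case True
  then show ?thesis using Q_power_neq_1[of "nat n"] by (simp add: power_int_def)
next
  case False
  moreover assume "n \<noteq> 0"
  ultimately show ?thesis using Q_power_neq_1[of "nat (- n)"] by (simp add: power_int_def power_inverse)
qed

lemma has_sum_\<rho>:
  assumes "x \<in> annulus"
  shows "((\<lambda>n. lc n * x powi n) has_sum \<rho> x) UNIV"
proof -
  note D = annulusD[OF assms]
  let ?f = "\<lambda>n. lc n * x powi n"
  have "((\<lambda>n. of_nat n ^ 0 * lam n * x ^ n) has_sum Lam 0 x) {1..}"
    by (rule weighted_powser_has_sum[where c = lam, OF norm_lam]) (use D in auto)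
  then have 1: "((\<lambda>n. ?f (int n)) has_sum Lam 0 x) {1..}"
    by (rule has_sum_cong[THEN iffD1, rotated]) (auto simp: lc_def lam_def)
  have "((\<lambda>n. of_nat n ^ 0 * lam n * (Q / x) ^ n) has_sum Lam 0 (Q / x)) {1..}"
    by (rule weighted_powser_has_sum[where c = lam, OF norm_lam]) (use D in auto)
  then have "((\<lambda>n. - (of_nat n ^ 0 * lam n * (Q / x) ^ n)) has_sum - Lam 0 (Q / x)) {1..}"
    by (simp add: has_sum_uminus)
  then have 2: "((\<lambda>n. ?f (- int n)) has_sum - Lam 0 (Q / x)) {1..}"
  proof (rule has_sum_cong[THEN iffD1, rotated])
    fix n :: nat assume "n \<in> {1..}"
    then have "n > 0" by simp
    with Q_power_neq_1[of n] show "- (of_nat n ^ 0 * lam n * (Q / x) ^ n) = ?f (- int n)"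
      using Q_nz D(1) by (simp add: lc_def lam_def power_int_minus field_simps)
  qed
  from has_sum_int_split[OF 1 2] show ?thesis by (simp add: \<rho>_def lc_def)
qed

lemma has_sum_\<kappa>:
  assumes "norm (Q * x) < 1" "norm (Q / x) < 1" "x \<noteq> 0"
  shows "((\<lambda>n. kc n * x powi n) has_sum \<kappa> x) UNIV"
proof -
  let ?f = "\<lambda>n. kc n * x powi n"
  have "((\<lambda>n. of_nat n ^ 0 * kap n * (Q * x) ^ n) has_sum Kap 0 (Q * x)) {1..}"
    by (rule weighted_powser_has_sum[where c = kap, OF norm_kap]) (use assms in auto)
  then have 1: "((\<lambda>n. ?f (int n)) has_sum Kap 0 (Q * x)) {1..}"
    by (rule has_sum_cong[THEN iffD1, rotated]) (auto simp: kc_def kap_def power_mult_distrib)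
  have "((\<lambda>n. of_nat n ^ 0 * kap n * (Q / x) ^ n) has_sum Kap 0 (Q / x)) {1..}"
    by (rule weighted_powser_has_sum[where c = kap, OF norm_kap]) (use assms in auto)
  then have 2: "((\<lambda>n. ?f (- int n)) has_sum Kap 0 (Q / x)) {1..}"
  proof (rule has_sum_cong[THEN iffD1, rotated])
    fix n :: nat assume "n \<in> {1..}"
    then have "n > 0" by simp
    with Q_power_neq_1[of n] have "Q ^ n \<noteq> 0" "1 - Q ^ n \<noteq> 0" "Q ^ n - 1 \<noteq> 0" using Q_nz by auto
    moreover have "inverse (Q ^ n) / (1 - inverse (Q ^ n))\<^sup>2 = Q ^ n / (1 - Q ^ n)\<^sup>2"
    proof -
      have "(1 - inverse (Q ^ n)) = - (1 - Q ^ n) / Q ^ n" using calculation by (simp add: field_simps)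
      then show ?thesis using calculation by (simp add: power_divide power2_eq_square field_simps)
    qed
    ultimately show "of_nat n ^ 0 * kap n * (Q / x) ^ n = ?f (- int n)"
      using \<open>n > 0\<close> by (simp add: kc_def kap_def power_int_minus power_divide divide_inverse power_mult_distrib power_inverse)
  qed
  from has_sum_int_split[OF 1 2] show ?thesis by (simp add: \<kappa>_def kc_def)
qed

text \<open>This is the coefficient of \<open>x^a y^b\<close> in \<open>\<rho>_product\<close>. Off
  the lines \<open>a = 0\<close>, \<open>b = 0\<close>, \<open>a = b\<close> it is a partial
  fraction identity in \<open>Q powi a\<close> and \<open>Q powi b\<close>. On these lines one
  factor is replaced by the conventional \<open>1/2\<close>, and the defect is
  \<open>lc n * lc n - lc n = kc n\<close>; at the origin, where all three meet, it is
  \<open>-1/4\<close>.\<close>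

lemma coefficient_identity:
  "lc a * lc b - lc b * lc (a - b) - lc a * lc (b - a) =
     (if a = 0 then kc b else 0) + (if b = 0 then kc a else 0) + (if a = b then kc a else 0)
     - (if a = 0 \<and> b = 0 then 1/4 else 0)"
proof -
  define u v where "u = Q powi a" and "v = Q powi b"
  have nz: "u \<noteq> 0" "v \<noteq> 0" using Q_nz by (auto simp: u_def v_def)
  have sq: "(1 / (1 - t))\<^sup>2 - 1 / (1 - t) = t / (1 - t)\<^sup>2" if "t \<noteq> 1" for t :: complex
    using that by (simp add: power2_eq_square divide_simps)
  have neg: "lc (- n) = 1 - lc n" for n
  proof (cases "n = 0")
    case False
    then have "Q powi n \<noteq> 1" "Q powi n \<noteq> 0" using Q_powi_neq_1 Q_nz by auto
    then show ?thesis using False by (simp add: lc_def power_int_minus field_simps)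
  qed (simp add: lc_def)
  have sq': "lc n * lc n - lc n = kc n" if "n \<noteq> 0" for n
    using sq[OF Q_powi_neq_1[OF that]] that by (simp add: lc_def kc_def power2_eq_square)
  consider "a = 0" | "a \<noteq> 0" "b = 0" | "a \<noteq> 0" "a = b" | "a \<noteq> 0" "b \<noteq> 0" "a \<noteq> b" by blast
  then show ?thesis
  proof cases
    case 1
    show ?thesis
    proof (cases "b = 0")
      case False
      then show ?thesis using 1 sq'[of b] by (simp add: neg lc_def[of 0]) (simp add: algebra_simps)
    qed (simp add: 1 lc_def kc_def)
  next
    case 2
    then show ?thesis using sq'[of a] by (simp add: neg lc_def[of 0]) (simp add: algebra_simps)
  next
    case 3
    then show ?thesis using sq'[of a] by (simp add: lc_def[of 0])
  next
    case 4
    have uv: "u \<noteq> 1" "v \<noteq> 1" "u / v \<noteq> 1" "v / u \<noteq> 1"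
      using Q_powi_neq_1[of a] Q_powi_neq_1[of b] Q_powi_neq_1[of "a - b"] Q_powi_neq_1[of "b - a"] 4 Q_nz
      by (auto simp: u_def v_def power_int_diff)
    then have "u \<noteq> v" using nz by auto
    have "1 / (1 - u) * (1 / (1 - v)) - 1 / (1 - v) * (1 / (1 - u / v)) - 1 / (1 - u) * (1 / (1 - v / u)) = 0"
    proof -
      have e: "1 - u / v = (v - u) / v" "1 - v / u = (u - v) / u" using nz by (auto simp: field_simps)
      have d: "v - u \<noteq> 0" "u - v \<noteq> 0" "1 - u \<noteq> 0" "1 - v \<noteq> 0" using uv \<open>u \<noteq> v\<close> by auto
      show ?thesis using d nz unfolding e by (simp add: divide_simps) (simp add: algebra_simps)
    qed
    then show ?thesis using 4 Q_nz by (simp add: lc_def u_def v_def power_int_diff)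
  qed
qed

end

section \<open>The product formula for \<open>\<rho>\<close> and its degenerate case\<close>

lemma tendsto_unique_ev:
  fixes f g :: "'a \<Rightarrow> 'b :: t2_space"
  assumes "F \<noteq> bot" "(f \<longlongrightarrow> a) F" "(g \<longlongrightarrow> b) F" "eventually (\<lambda>x. f x = g x) F"
  shows "a = b"
proof -
  have "(f \<longlongrightarrow> b) F" using assms(3) by (subst tendsto_cong[OF assms(4)])
  with assms(1,2) show ?thesis by (rule tendsto_unique)
qed

context lambert
begin

text \<open>Each of the three products is a double series over pairs of integers; collected by the
  monomial \<open>x^a y^b\<close> they are compared by \<open>coefficient_identity\<close>. For
  instance \<open>(x y)^n x^k\<close> is the monomial with \<open>a = n + k\<close> and
  \<open>b = n\<close>.\<close>

lemma \<rho>_product: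
  assumes x: "x \<in> annulus" and y: "y \<in> annulus" and xy: "x * y \<in> annulus"
  shows "\<rho> x * \<rho> y - \<rho> (x * y) * (\<rho> x + \<rho> y) = \<kappa> x + \<kappa> y + \<kappa> (x * y) - 1/4"
proof -
  have nz: "x \<noteq> 0" "y \<noteq> 0" using x y annulusD by auto
  define m where "m = (\<lambda>(a, b). x powi a * y powi b)"
  have 1: "((\<lambda>(a, b). lc a * lc b * m (a, b)) has_sum \<rho> x * \<rho> y) UNIV"
    using has_sum_Times_complex[OF has_sum_\<rho>[OF x] has_sum_\<rho>[OF y]]
    by (simp add: m_def algebra_simps case_prod_unfold)
  have 2: "((\<lambda>(a, b). lc b * lc (a - b) * m (a, b)) has_sum \<rho> (x * y) * \<rho> x) UNIV"
  proof -
    have "((\<lambda>(n, k). (lc n * (x * y) powi n) * (lc k * x powi k)) has_sum \<rho> (x * y) * \<rho> x) UNIV"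
      using has_sum_Times_complex[OF has_sum_\<rho>[OF xy] has_sum_\<rho>[OF x]] by simp
    also have "?this \<longleftrightarrow> ?thesis"
      by (rule has_sum_reindex_bij_witness[of _ "\<lambda>(a, b). (b, a - b)" "\<lambda>(n, k). (n + k, n)"])
         (use nz in \<open>auto simp: m_def power_int_mult_distrib power_int_add algebra_simps\<close>)
    finally show ?thesis .
  qed
  have 3: "((\<lambda>(a, b). lc a * lc (b - a) * m (a, b)) has_sum \<rho> (x * y) * \<rho> y) UNIV"
  proof -
    have "((\<lambda>(n, k). (lc n * (x * y) powi n) * (lc k * y powi k)) has_sum \<rho> (x * y) * \<rho> y) UNIV"
      using has_sum_Times_complex[OF has_sum_\<rho>[OF xy] has_sum_\<rho>[OF y]] by simp
    also have "?this \<longleftrightarrow> ?thesis"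
      by (rule has_sum_reindex_bij_witness[of _ "\<lambda>(a, b). (a, b - a)" "\<lambda>(n, k). (n, n + k)"])
         (use nz in \<open>auto simp: m_def power_int_mult_distrib power_int_add algebra_simps\<close>)
    finally show ?thesis .
  qed
  have kap: "((\<lambda>n. kc n * z powi n) has_sum \<kappa> z) UNIV" if "z \<in> annulus" for z
    using annulusD[OF that] by (intro has_sum_\<kappa>)
  \<comment> \<open>The correction terms live on lines through the origin of the index lattice;
    summing over such a line, parametrised by an injection \<open>f\<close>, gives a one-variable
    series \<open>\<kappa>\<close>.\<close>
  have line: "((\<lambda>(a, b). (if P a b then g a b else 0) * m (a, b)) has_sum s) UNIV"
    if "((\<lambda>n. kc n * z powi n) has_sum s) UNIV" "inj f" "\<And>a b. P a b \<longleftrightarrow> (a, b) \<in> range f"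
      "\<And>n. g (fst (f n)) (snd (f n)) * m (f n) = kc n * z powi n" for P g z s and f :: "int \<Rightarrow> int \<times> int"
  proof -
    note P = that(3)
    have "((\<lambda>p. g (fst p) (snd p) * m p) has_sum s) (range f)"
      using that(1,2,4) by (subst has_sum_reindex) (simp_all add: o_def)
    also have "?this \<longleftrightarrow> ?thesis"
    proof (rule has_sum_cong_neutral)
      show "g (fst p) (snd p) * m p = (case p of (a, b) \<Rightarrow> (if P a b then g a b else 0) * m (a, b))"
        if "p \<in> range f \<inter> UNIV" for p
        using that P by (cases p) auto
    qed (use P in auto)
    finally show ?thesis .
  qed
  have 4: "((\<lambda>(a, b). (if a = 0 then kc b else 0) * m (a, b)) has_sum \<kappa> y) UNIV"
    using line[OF kap[OF y], of "\<lambda>n. (0, n)" "\<lambda>a b. a = 0" "\<lambda>a b. kc b"]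
    by (simp add: m_def inj_on_def image_iff)
  have 5: "((\<lambda>(a, b). (if b = 0 then kc a else 0) * m (a, b)) has_sum \<kappa> x) UNIV"
    using line[OF kap[OF x], of "\<lambda>n. (n, 0)" "\<lambda>a b. b = 0" "\<lambda>a b. kc a"]
    by (simp add: m_def inj_on_def image_iff)
  have 6: "((\<lambda>(a, b). (if a = b then kc a else 0) * m (a, b)) has_sum \<kappa> (x * y)) UNIV"
    by (rule line[where f = "\<lambda>n. (n, n)" and g = "\<lambda>a b. kc a", OF kap[OF xy]])
       (auto simp: m_def inj_on_def power_int_mult_distrib)
  have 7: "((\<lambda>(a, b). (if a = 0 \<and> b = 0 then 1/4 else 0) * m (a, b)) has_sum 1/4) UNIV"
  proof -
    have "((\<lambda>_. 1/4) has_sum (1/4 :: complex)) {(0 :: int, 0 :: int)}" by (simp add: has_sum_finiteI)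
    also have "?this \<longleftrightarrow> ?thesis"
      by (rule has_sum_cong_neutral) (auto simp: m_def split: if_splits)
    finally show ?thesis .
  qed
  have "((\<lambda>(a, b). lc a * lc b * m (a, b) - lc b * lc (a - b) * m (a, b) - lc a * lc (b - a) * m (a, b))
      has_sum \<rho> x * \<rho> y - \<rho> (x * y) * \<rho> x - \<rho> (x * y) * \<rho> y) UNIV"
    using has_sum_diff[OF has_sum_diff[OF 1 2] 3] by (simp add: case_prod_unfold)
  moreover have "((\<lambda>(a, b). (if a = 0 then kc b else 0) * m (a, b) + (if b = 0 then kc a else 0) * m (a, b)
        + (if a = b then kc a else 0) * m (a, b) - (if a = 0 \<and> b = 0 then 1/4 else 0) * m (a, b))
      has_sum \<kappa> y + \<kappa> x + \<kappa> (x * y) - 1/4) UNIV"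
    using has_sum_diff[OF has_sum_add[OF has_sum_add[OF 4 5] 6] 7] by (simp add: case_prod_unfold)
  moreover have "lc a * lc b * t - lc b * lc (a - b) * t - lc a * lc (b - a) * t =
      (if a = 0 then kc b else 0) * t + (if b = 0 then kc a else 0) * t + (if a = b then kc a else 0) * t
      - (if a = 0 \<and> b = 0 then 1/4 else 0) * t" for a b t
    unfolding left_diff_distrib[symmetric] distrib_right[symmetric] coefficient_identity ..
  ultimately have "\<rho> x * \<rho> y - \<rho> (x * y) * \<rho> x - \<rho> (x * y) * \<rho> y = \<kappa> y + \<kappa> x + \<kappa> (x * y) - 1/4"
    using has_sum_unique by fastforce
  then show ?thesis by (simp add: algebra_simps)
qed

text \<open>From \<open>1 / (1 - Q^n) = 1 + Q^n / (1 - Q^n)\<close>. It isolates the pole at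
  \<open>y = 1\<close>, the remainder being regular there.\<close>

lemma Lam_0_eq:
  assumes "norm y < 1"
  shows "Lam 0 y = y / (1 - y) + Lam 0 (Q * y)"
proof -
  have Qy: "norm (Q * y) < 1"
    using assms norm_Q mult_strict_mono[of "norm Q" 1 "norm y" 1] by (simp add: norm_mult)
  have "(\<lambda>n. y ^ Suc n) sums (y * (1 / (1 - y)))"
    using sums_mult[OF geometric_sums[OF assms], of y] by simp
  moreover have "(\<lambda>n. of_nat (Suc n) ^ 0 * lam (Suc n) * (Q * y) ^ Suc n) sums Lam 0 (Q * y)"
    using weighted_powser_sums[where c = lam, OF norm_lam Qy, of 0] by (subst sums_Suc_iff) simp
  ultimately have "(\<lambda>n. y ^ Suc n + of_nat (Suc n) ^ 0 * lam (Suc n) * (Q * y) ^ Suc n)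
      sums (y * (1 / (1 - y)) + Lam 0 (Q * y))" by (rule sums_add)
  moreover have "y ^ Suc n + of_nat (Suc n) ^ 0 * lam (Suc n) * (Q * y) ^ Suc n
      = of_nat (Suc n) ^ 0 * lam (Suc n) * y ^ Suc n" for n
    using Q_power_neq_1[of "Suc n"]
    unfolding lam_def power_mult_distrib by (simp add: divide_simps del: power_Suc) (simp add: algebra_simps)
  ultimately have "(\<lambda>n. of_nat (Suc n) ^ 0 * lam (Suc n) * y ^ Suc n) sums (y * (1 / (1 - y)) + Lam 0 (Q * y))"
    by simp
  moreover have "(\<lambda>n. of_nat (Suc n) ^ 0 * lam (Suc n) * y ^ Suc n) sums Lam 0 y"
    using weighted_powser_sums[where c = lam, OF norm_lam assms, of 0] by (subst sums_Suc_iff) simp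
  ultimately show ?thesis by (simp add: sums_unique2)
qed

text \<open>The degenerate case \<open>y \<rightarrow> 1\<close> of \<open>\<rho>_product\<close>, with \<open>x y = u\<close> fixed: \<open>\<rho>\<close> has a simple pole at 1.\<close>

lemma \<rho>_square:
  assumes u: "u \<in> annulus"
  shows "(\<rho> u)\<^sup>2 = \<rho>1 u - 2 * \<kappa> u + 1/4 - \<kappa> 1"
proof -
  let ?F = "at_left (1 :: real)"
  have nz: "u \<noteq> 0" using annulusD[OF u] by simp
  have ev: "eventually (\<lambda>t. of_real t \<in> annulus \<and> u / of_real t \<in> annulus \<and> t \<noteq> 0) ?F"
  proof -
    have "eventually (\<lambda>t. t > max (norm Q) (norm u)) ?F"
      using norm_Q u by (intro eventually_at_left_real[THEN eventually_mono]) (auto simp: annulus_def)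
    moreover have "eventually (\<lambda>t. t < 1) ?F" by (auto simp: eventually_at_filter)
    ultimately show ?thesis
    proof eventually_elim
      case (elim t)
      have "norm Q * t \<le> norm Q * 1"
        using elim by (intro mult_left_mono) auto
      then have h: "norm Q * t < norm u" using u by (simp add: annulus_def)
      have t: "t > 0" using elim norm_ge_zero[of Q] by linarith
      have "norm Q < norm u / t" unfolding pos_less_divide_eq[OF t] using h by simp
      moreover have "norm u / t < 1" unfolding pos_divide_less_eq[OF t] using elim by simp
      moreover have "norm (of_real t :: complex) = t" using t by simp
      ultimately show ?case
        using elim t by (auto simp: annulus_def norm_divide simp del: norm_of_real)
    qed
  qed
  have t1: "((\<lambda>t. of_real t) \<longlongrightarrow> (1 :: complex)) ?F"
    using tendsto_of_real[OF tendsto_ident_at, of 1 "{..<1}", where 'a = complex] by simp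
  have cont: "isCont (Lam 0) Q" "isCont \<kappa> u" "isCont \<rho> u"
    using has_field_derivative_Lam[of Q 0] norm_Q Q_nz has_field_derivative_\<rho>[OF u] has_field_derivative_\<kappa>[OF u]
    by (auto intro: DERIV_isCont)
  have K: "isCont (Kap 0) Q"
    using has_field_derivative_Kap[of Q 0] norm_Q Q_nz by (auto intro: DERIV_isCont)
  have lim1: "((\<lambda>t. (1 - of_real t) * \<rho> (of_real t)) \<longlongrightarrow> 1) ?F"
  proof -
    have "((\<lambda>t. (1 - of_real t) * (1/2 + Lam 0 (Q * of_real t) - Lam 0 (Q / of_real t)) + of_real t)
        \<longlongrightarrow> (1 - 1) * (1/2 + Lam 0 Q - Lam 0 Q) + 1) ?F"
      by (intro tendsto_intros t1 isCont_tendsto_compose[OF cont(1)] tendsto_eq_intros) (auto intro!: tendsto_eq_intros t1)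
    moreover have "eventually (\<lambda>t. (1 - of_real t) * (1/2 + Lam 0 (Q * of_real t) - Lam 0 (Q / of_real t)) + of_real t
        = (1 - of_real t) * \<rho> (of_real t)) ?F"
      using ev
    proof eventually_elim
      case (elim t)
      then have t: "norm (of_real t :: complex) < 1" and "t \<noteq> 1" by (auto simp: annulus_def)
      then have "(1 - of_real t :: complex) \<noteq> 0" by simp
      then show ?case unfolding \<rho>_def Lam_0_eq[OF t] by (simp add: field_simps)
    qed
    ultimately show ?thesis by (simp add: tendsto_cong)
  qed
  have lim2: "((\<lambda>t. (\<rho> (u / of_real t) - \<rho> u) / (1 - of_real t)) \<longlongrightarrow> \<rho>1 u) ?F"
  proof -
    have "((\<lambda>z. \<rho> (u / z)) has_field_derivative (\<rho>1 u / u) * (- u)) (at 1)"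
    proof (rule DERIV_chain2[of \<rho> _ "\<lambda>z. u / z"])
      show "(\<rho> has_field_derivative \<rho>1 u / u) (at (u / 1))" using has_field_derivative_\<rho>[OF u] by simp
      show "((\<lambda>z. u / z) has_field_derivative - u) (at 1)" by (auto intro!: derivative_eq_intros)
    qed
    then have "((\<lambda>z. (\<rho> (u / z) - \<rho> u) / (z - 1)) \<longlongrightarrow> - \<rho>1 u) (at 1)"
      using nz by (simp add: has_field_derivative_iff)
    moreover have "filterlim (\<lambda>t. of_real t :: complex) (at 1) ?F"
      using t1 by (auto simp: filterlim_at eventually_at_filter)
    ultimately have "((\<lambda>t. (\<rho> (u / of_real t) - \<rho> u) / (of_real t - 1)) \<longlongrightarrow> - \<rho>1 u) ?F"
      by (rule filterlim_compose)
    from tendsto_minus[OF this] show ?thesis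
      by (simp add: minus_divide_right)
  qed
  have uu: "((\<lambda>t. u / of_real t) \<longlongrightarrow> u) ?F"
    by (auto intro!: tendsto_eq_intros t1)
  \<comment> \<open>The two terms of \<open>\<rho>_product\<close> containing
    \<open>\<rho> t\<close> combine to \<open>\<rho> t * (\<rho> (u / t) - \<rho> u)\<close>. The
    simple pole of the first factor cancels the zero of the second and leaves the derivative
    \<open>\<rho>1 u\<close>.\<close>
  have "((\<lambda>t. ((1 - of_real t) * \<rho> (of_real t)) * ((\<rho> (u / of_real t) - \<rho> u) / (1 - of_real t)) - \<rho> u * \<rho> (u / of_real t))
      \<longlongrightarrow> 1 * \<rho>1 u - \<rho> u * \<rho> u) ?F"
    by (intro tendsto_intros lim1 lim2 isCont_tendsto_compose[OF cont(3)] uu)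
  moreover have "((\<lambda>t. \<kappa> (u / of_real t) + \<kappa> (of_real t) + \<kappa> u - 1/4) \<longlongrightarrow> \<kappa> u + \<kappa> 1 + \<kappa> u - 1/4) ?F"
  proof -
    have "((\<lambda>t. \<kappa> (of_real t)) \<longlongrightarrow> \<kappa> 1) ?F"
      unfolding \<kappa>_def
      by (intro tendsto_add isCont_tendsto_compose[of "Q * 1" "Kap 0"] isCont_tendsto_compose[of "Q / 1" "Kap 0"])
         (use K in \<open>auto intro!: tendsto_eq_intros t1\<close>)
    then show ?thesis by (intro tendsto_intros isCont_tendsto_compose[OF cont(2)] uu)
  qed
  moreover have "eventually (\<lambda>t. ((1 - of_real t) * \<rho> (of_real t)) * ((\<rho> (u / of_real t) - \<rho> u) / (1 - of_real t)) - \<rho> u * \<rho> (u / of_real t)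
      = \<kappa> (u / of_real t) + \<kappa> (of_real t) + \<kappa> u - 1/4) ?F"
    using ev
  proof eventually_elim
    case (elim t)
    then have t: "t \<noteq> 1" "t \<noteq> 0" by (auto simp: annulus_def)
    then have "(1 - of_real t :: complex) \<noteq> 0" by simp
    then have eq: "((1 - of_real t) * \<rho> (of_real t)) * ((\<rho> (u / of_real t) - \<rho> u) / (1 - of_real t))
        = \<rho> (of_real t) * (\<rho> (u / of_real t) - \<rho> u)" by simp
    have "\<rho> (u / of_real t) * \<rho> (of_real t) - \<rho> u * (\<rho> (u / of_real t) + \<rho> (of_real t))
        = \<kappa> (u / of_real t) + \<kappa> (of_real t) + \<kappa> u - 1/4"
      using \<rho>_product[of "u / of_real t" "of_real t"] elim u t by simp
    then show ?case unfolding eq by (simp add: algebra_simps)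
  qed
  ultimately have "1 * \<rho>1 u - \<rho> u * \<rho> u = \<kappa> u + \<kappa> 1 + \<kappa> u - 1/4"
    by (rule tendsto_unique_ev[OF trivial_limit_at_left_real])
  then show ?thesis by (simp add: power2_eq_square algebra_simps)
qed

end

section \<open>The constant \<open>\<kappa> 1\<close>, the addition theorem and the heat
  equation\<close>

lemma derivative_unique_ev:
  assumes "(f has_field_derivative a) (at x)" "(g has_field_derivative b) (at x)"
    and "eventually (\<lambda>z. f z = g z) (nhds x)"
  shows "a = b"
proof -
  have "(f has_field_derivative b) (at x)"
    using assms(2) by (subst DERIV_cong_ev[OF refl assms(3) refl])
  with assms(1) show ?thesis by (rule DERIV_unique)
qed

context lambert
begin

text \<open>Both sides are the double series of \<open>m Q^(n m)\<close>, summed over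
  \<open>m\<close> first or over \<open>n\<close> first. This identifies the constant
  \<open>\<kappa> 1\<close> of \<open>\<rho>_square\<close> with the series in
  \<open>E2\<close>.\<close>

lemma Kap_0_Q: "Kap 0 Q = Lam 1 Q"
proof -
  have deriv: "((\<lambda>m. of_nat m * z ^ m) has_sum (z / (1 - z)\<^sup>2)) {1..}"
    if "norm z < 1" for z :: "'a :: {real_normed_field, banach}"
  proof -
    have "summable (\<lambda>m. norm (of_nat m * z ^ m))"
      using summable_power_times_geometric[of "norm z" 1] that by (simp add: norm_mult norm_power)
    moreover have "(\<lambda>m. of_nat m * z ^ m) sums (z / (1 - z)\<^sup>2)"
      using sums_mult[OF geometric_deriv_sums[OF that], of z]
      by (subst sums_Suc_iff[symmetric, where f = "\<lambda>m. of_nat m * z ^ m", simplified]) (simp add: algebra_simps)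
    ultimately have "((\<lambda>m. of_nat m * z ^ m) has_sum (z / (1 - z)\<^sup>2)) UNIV"
      by (rule norm_summable_imp_has_sum)
    also have "?this \<longleftrightarrow> ?thesis"
      by (rule has_sum_cong_neutral) (auto simp: not_le)
    finally show ?thesis .
  qed
  have geom: "((\<lambda>n. of_nat m * (Q ^ n) ^ m) has_sum (of_nat m * (Q ^ m / (1 - Q ^ m)))) {1..}"
    if "m \<in> {1..}" for m
    using has_sum_cmult_right[OF has_sum_geometric_from_1[OF norm_power_less_1[OF norm_Q that]], of "of_nat m"]
    by (simp add: power_mult[symmetric] mult.commute)
  have K: "((\<lambda>n. Q ^ n / (1 - Q ^ n)\<^sup>2) has_sum Kap 0 Q) {1..}"
    using weighted_powser_has_sum[where c = kap, OF norm_kap norm_Q, of 0] by (simp add: kap_def)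
  have L: "((\<lambda>m. of_nat m * (Q ^ m / (1 - Q ^ m))) has_sum Lam 1 Q) {1..}"
    using weighted_powser_has_sum[where c = lam, OF norm_lam norm_Q, of 1] by (simp add: lam_def)
  have "(\<lambda>(n, m). real m * (norm Q ^ n) ^ m) summable_on {1..} \<times> {1..}"
  proof (rule summable_on_SigmaI)
    have norm_Q': "norm (norm Q) < 1" using norm_Q by simp
    show "((\<lambda>m. case (n, m) of (n, m) \<Rightarrow> real m * (norm Q ^ n) ^ m) has_sum (norm Q ^ n / (1 - norm Q ^ n)\<^sup>2)) {1..}"
      if "n \<in> {1..}" for n
      using deriv[OF norm_power_less_1[OF norm_Q' that]] by simp
    \<comment> \<open>The row sums of the absolute values are the terms of \<open>Kap 0\<close> for
      the real parameter \<open>norm Q\<close>, whose summability is already available from the same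
      locale.\<close>
    interpret N: lambert "of_real (norm Q)" using Q_nz norm_Q by unfold_locales auto
    have "((\<lambda>n. of_real (norm Q) ^ n / (1 - of_real (norm Q) ^ n)\<^sup>2) has_sum
        N.Kap 0 (of_real (norm Q))) {1..}"
      using weighted_powser_has_sum[where c = N.kap and j = 0, OF N.norm_kap N.norm_Q]
      by (simp add: N.kap_def)
    then have "((\<lambda>n. Re (of_real (norm Q) ^ n / (1 - of_real (norm Q) ^ n)\<^sup>2)) has_sum
        Re (N.Kap 0 (of_real (norm Q)))) {1..}"
      by (rule has_sum_Re)
    moreover have "of_real (norm Q) ^ n / (1 - of_real (norm Q) ^ n)\<^sup>2
        = complex_of_real (norm Q ^ n / (1 - norm Q ^ n)\<^sup>2)" for n
      by simp
    ultimately show "(\<lambda>n. norm Q ^ n / (1 - norm Q ^ n)\<^sup>2) summable_on {1..}"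
      by (simp only: Re_complex_of_real) (rule has_sum_imp_summable)
  qed auto
  then have "(\<lambda>z. norm (case z of (n, m) \<Rightarrow> of_nat m * (Q ^ n) ^ m)) summable_on {1..} \<times> {1..}"
    by (simp add: case_prod_unfold norm_mult norm_power)
  then have "(\<lambda>(n, m). of_nat m * (Q ^ n) ^ m) summable_on {1..} \<times> {1..}"
    by (rule abs_summable_summable)
  then obtain S where S: "((\<lambda>(n, m). of_nat m * (Q ^ n) ^ m) has_sum S) ({1..} \<times> {1..})"
    by (auto simp: summable_on_def)
  have "((\<lambda>n. Q ^ n / (1 - Q ^ n)\<^sup>2) has_sum S) {1..}"
    by (rule has_sum_SigmaD[OF S]) (use deriv[OF norm_power_less_1[OF norm_Q]] in simp)
  moreover have "((\<lambda>m. of_nat m * (Q ^ m / (1 - Q ^ m))) has_sum S) {1..}"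
    by (rule has_sum_SigmaD[OF S[THEN has_sum_swap[THEN iffD1]]]) (use geom in simp)
  ultimately show ?thesis using K L has_sum_unique by blast
qed

lemma E2_eq: "E2 Q = 1 - 12 * \<kappa> 1"
proof -
  have "(\<lambda>n. of_nat (Suc n) ^ 1 * lam (Suc n) * Q ^ Suc n) sums Lam 1 Q"
    using weighted_powser_sums[where c = lam, OF norm_lam norm_Q, of 1] by (subst sums_Suc_iff) simp
  then have "(\<lambda>n. of_nat (Suc n) * Q ^ Suc n / (1 - Q ^ Suc n)) sums Lam 1 Q"
    by (simp add: lam_def)
  then show ?thesis by (simp add: E2_def \<kappa>_def Kap_0_Q sums_iff)
qed

text \<open>The \<open>\<kappa>\<close> terms at the three arguments cancel between
  \<open>\<rho>_product\<close> and three instances of \<open>\<rho>_square\<close>. The constant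
  left over is \<open>3 * (1/4 - \<kappa> 1) - 1/2\<close>, which is
  \<open>E2 Q / 4\<close>.\<close>

lemma \<rho>_add_square:
  assumes "x \<in> annulus" "y \<in> annulus" "x * y \<in> annulus"
  shows "(\<rho> x + \<rho> y - \<rho> (x * y))\<^sup>2 = \<rho>1 x + \<rho>1 y + \<rho>1 (x * y) + E2 Q / 4"
proof -
  have "(\<rho> x + \<rho> y - \<rho> (x * y))\<^sup>2 = (\<rho> x)\<^sup>2 + (\<rho> y)\<^sup>2 + (\<rho> (x * y))\<^sup>2
      + 2 * (\<rho> x * \<rho> y - \<rho> (x * y) * (\<rho> x + \<rho> y))"
    by (simp add: power2_eq_square algebra_simps)
  also have "\<dots> = \<rho>1 x + \<rho>1 y + \<rho>1 (x * y) + E2 Q / 4"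
    unfolding \<rho>_product[OF assms] \<rho>_square[OF assms(1)] \<rho>_square[OF assms(2)] \<rho>_square[OF assms(3)] E2_eq
    by (simp add: field_simps)
  finally show ?thesis .
qed

text \<open>Apply \<open>x d/dx\<close>, with \<open>y\<close> fixed, to both sides of
  \<open>\<rho>_add_square\<close>, which holds in a neighbourhood of \<open>x\<close>.\<close>

lemma \<rho>_add_derivative:
  assumes x: "x \<in> annulus" and y: "y \<in> annulus" and xy: "x * y \<in> annulus"
  shows "2 * (\<rho> x + \<rho> y - \<rho> (x * y)) * (\<rho>1 x - \<rho>1 (x * y)) = \<rho>2 x + \<rho>2 (x * y)"
proof -
  have nz: "x \<noteq> 0" "y \<noteq> 0" using x y annulusD by auto
  have mult: "((\<lambda>x. f (x * y)) has_field_derivative f' (x * y) / x) (at x)"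
    if "(f has_field_derivative f' (x * y) / (x * y)) (at (x * y))" for f f' :: "complex \<Rightarrow> complex"
  proof -
    have "((\<lambda>x. x * y) has_field_derivative y) (at x)" by (auto intro!: derivative_eq_intros)
    from DERIV_chain2[of f "f' (x * y) / (x * y)" "\<lambda>x. x * y" x, OF that this] show ?thesis
      using nz by simp
  qed
  let ?L = "\<lambda>x. (\<rho> x + \<rho> y - \<rho> (x * y))\<^sup>2" and ?R = "\<lambda>x. \<rho>1 x + \<rho>1 y + \<rho>1 (x * y) + E2 Q / 4"
  have "(?L has_field_derivative 2 * (\<rho> x + \<rho> y - \<rho> (x * y)) * (\<rho>1 x - \<rho>1 (x * y)) / x) (at x)"
    by (rule derivative_eq_intros has_field_derivative_\<rho>[OF x] mult[of \<rho> \<rho>1, OF has_field_derivative_\<rho>[OF xy]] refl)+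
       (simp add: diff_divide_distrib add_divide_distrib algebra_simps)
  moreover have "(?R has_field_derivative (\<rho>2 x + \<rho>2 (x * y)) / x) (at x)"
    by (rule derivative_eq_intros has_field_derivative_\<rho>1[OF x] mult[of \<rho>1 \<rho>2, OF has_field_derivative_\<rho>1[OF xy]] refl)+
       (simp add: add_divide_distrib)
  moreover have "eventually (\<lambda>z. ?L z = ?R z) (nhds x)"
  proof -
    have "open (annulus \<inter> (\<lambda>z. z * y) -` annulus)"
      by (intro open_Int open_annulus open_vimage continuous_intros)
    then have "eventually (\<lambda>z. z \<in> annulus \<inter> (\<lambda>z. z * y) -` annulus) (nhds x)"
      using x xy by (intro eventually_nhds_in_open) auto
    then show ?thesis by eventually_elim (use \<rho>_add_square[OF _ y] in auto)
  qed
  ultimately have "2 * (\<rho> x + \<rho> y - \<rho> (x * y)) * (\<rho>1 x - \<rho>1 (x * y)) / x = (\<rho>2 x + \<rho>2 (x * y)) / x"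
    by (rule derivative_unique_ev)
  then show ?thesis using nz by simp
qed

text \<open>Apply \<open>x d/dx\<close> to \<open>\<rho>_square\<close>. Since
  \<open>\<kappa>1\<close> is \<open>Q d/dQ\<close> of \<open>\<rho>\<close>, this is the heat
  equation of the theta function in logarithmic form.\<close>

lemma \<rho>_heat:
  assumes x: "x \<in> annulus"
  shows "\<kappa>1 x = \<rho>2 x / 2 - \<rho> x * \<rho>1 x"
proof -
  have nz: "x \<noteq> 0" using x annulusD by auto
  have "((\<lambda>x. (\<rho> x)\<^sup>2) has_field_derivative 2 * \<rho> x * \<rho>1 x / x) (at x)"
    by (rule derivative_eq_intros has_field_derivative_\<rho>[OF x] refl)+ (simp add: algebra_simps)
  moreover have "((\<lambda>x. \<rho>1 x - 2 * \<kappa> x + 1/4 - \<kappa> 1) has_field_derivative (\<rho>2 x - 2 * \<kappa>1 x) / x) (at x)"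
    by (rule derivative_eq_intros has_field_derivative_\<rho>1[OF x] has_field_derivative_\<kappa>[OF x] refl)+
       (simp add: diff_divide_distrib)
  moreover have "eventually (\<lambda>z. (\<rho> z)\<^sup>2 = \<rho>1 z - 2 * \<kappa> z + 1/4 - \<kappa> 1) (nhds x)"
    using eventually_nhds_in_open[OF open_annulus x] by eventually_elim (rule \<rho>_square)
  ultimately have "2 * \<rho> x * \<rho>1 x / x = (\<rho>2 x - 2 * \<kappa>1 x) / x"
    by (rule derivative_unique_ev)
  then show ?thesis using nz by (simp add: field_simps)
qed

end

section \<open>Relations between torsion values\<close>

text \<open>The addition theorem for the zeta function, restricted to the \<open>p\<close>-torsion points: \<open>W\<close>, \<open>P\<close>,
  \<open>R\<close> are the values of \<open>\<zeta>\<close> (made periodic), \<open>\<wp>\<close> and \<open>\<wp>'\<close>.\<close>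

locale torsion_values =
  fixes p :: int and W P R :: "int \<Rightarrow> complex"
  assumes W_mod: "W (i mod p) = W i" and P_mod: "P (i mod p) = P i" and R_mod: "R (i mod p) = R i"
    and W_minus: "W (- i) = - W i" and P_minus: "P (- i) = P i" and R_minus: "R (- i) = - R i"
    and W_add: "\<lbrakk>\<not> p dvd i; \<not> p dvd j; \<not> p dvd i + j\<rbrakk> \<Longrightarrow>
      (W i + W j - W (i + j))\<^sup>2 = P i + P j + P (i + j)"
    and R_add: "\<lbrakk>\<not> p dvd i; \<not> p dvd j; \<not> p dvd i + j\<rbrakk> \<Longrightarrow>
      2 * (W i + W j - W (i + j)) * (P i - P (i + j)) = R i + R (i + j)"
begin

lemma W_cong: "i mod p = j mod p \<Longrightarrow> W i = W j"
  and P_cong: "i mod p = j mod p \<Longrightarrow> P i = P j"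
  and R_cong: "i mod p = j mod p \<Longrightarrow> R i = R j"
  by (metis W_mod, metis P_mod, metis R_mod)

text \<open>Multiplication by a unit permutes the nonzero torsion points. It reduces an arbitrary
  \<open>a\<close> in the theorem to \<open>a = 1\<close>.\<close>

lemma multiply:
  assumes "coprime c p"
  shows "torsion_values p (\<lambda>i. W (c * i)) (\<lambda>i. P (c * i)) (\<lambda>i. R (c * i))"
proof
  have dvd: "p dvd c * i \<longleftrightarrow> p dvd i" for i
    using assms by (simp add: coprime_dvd_mult_right_iff coprime_commute)
  fix i j
  show "W (c * (i mod p)) = W (c * i)" "P (c * (i mod p)) = P (c * i)" "R (c * (i mod p)) = R (c * i)"
    by (auto intro!: W_cong P_cong R_cong simp: mod_mult_right_eq)
  show "W (c * (- i)) = - W (c * i)" "P (c * (- i)) = P (c * i)" "R (c * (- i)) = - R (c * i)"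
    by (simp_all add: W_minus P_minus R_minus)
  assume nd: "\<not> p dvd i" "\<not> p dvd j" "\<not> p dvd i + j"
  show "(W (c * i) + W (c * j) - W (c * (i + j)))\<^sup>2 = P (c * i) + P (c * j) + P (c * (i + j))"
    using W_add[of "c * i" "c * j"] nd dvd[of "i + j"] by (simp add: dvd algebra_simps)
  show "2 * (W (c * i) + W (c * j) - W (c * (i + j))) * (P (c * i) - P (c * (i + j))) = R (c * i) + R (c * (i + j))"
    using R_add[of "c * i" "c * j"] nd dvd[of "i + j"] by (simp add: dvd algebra_simps)
qed

text \<open>By the heat equation the derivative of log sigma is, up to a factor and a term in
  \<open>E2\<close>, the expression \<open>W^2 - P\<close>. It is counted positively at the three
  pair sums (sigma factors in the numerator) and negatively at the four points themselves
  (denominator).\<close>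

definition log_deriv :: "int \<Rightarrow> int \<Rightarrow> int \<Rightarrow> int \<Rightarrow> complex" where
  "log_deriv a b c d =
     P a + P b + P c + P d - P (a + b) - P (a + c) - P (a + d)
     - (W a)\<^sup>2 - (W b)\<^sup>2 - (W c)\<^sup>2 - (W d)\<^sup>2
     + (W (a + b))\<^sup>2 + (W (a + c))\<^sup>2 + (W (a + d))\<^sup>2"

text \<open>This is the logarithmic form of
  \<open>\<zeta>(x) + \<zeta>(y) + \<zeta>(z) + \<zeta>(t) = \<sigma>(x + y) \<sigma>(x + z) \<sigma>(x + t) / (\<sigma>(x) \<sigma>(y) \<sigma>(z) \<sigma>(t))\<close> for \<open>x + y + z + t = 0\<close>.\<close>

lemma log_deriv_eq:
  assumes sum: "p dvd a + b + c + d"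
    and nd: "\<not> p dvd a" "\<not> p dvd b" "\<not> p dvd c" "\<not> p dvd d"
      "\<not> p dvd a + b" "\<not> p dvd a + c" "\<not> p dvd a + d"
  shows "(\<Sum>k\<leftarrow>[a, b, c, d]. R k / 2 - W k * P k) = (\<Sum>k\<leftarrow>[a, b, c, d]. W k) * log_deriv a b c d / 2"
proof -
  have neg: "W k = - W l" "P k = P l" "R k = - R l" "p dvd k \<longleftrightarrow> p dvd l" if "p dvd k + l" for k l
  proof -
    have "k mod p = (- l) mod p" using that by (simp add: mod_eq_dvd_iff)
    then show "W k = - W l" "P k = P l" "R k = - R l"
      using W_cong P_cong R_cong W_minus P_minus R_minus by metis+
    show "p dvd k \<longleftrightarrow> p dvd l" using that by (metis dvd_add_right_iff dvd_add_left_iff)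
  qed
  \<comment> \<open>Since the four indices sum to 0 modulo \<open>p\<close>, the six pair sums
    reduce to three up to sign.\<close>
  have s: "p dvd (c + d) + (a + b)" "p dvd (b + d) + (a + c)" "p dvd (b + c) + (a + d)"
    using sum by (simp_all add: algebra_simps)
  have q: "(W a + W b - W (a + b))\<^sup>2 = P a + P b + P (a + b)"
    "(W c + W d + W (a + b))\<^sup>2 = P c + P d + P (a + b)"
    "(W a + W c - W (a + c))\<^sup>2 = P a + P c + P (a + c)"
    "(W b + W d + W (a + c))\<^sup>2 = P b + P d + P (a + c)"
    "(W a + W d - W (a + d))\<^sup>2 = P a + P d + P (a + d)"
    "(W b + W c + W (a + d))\<^sup>2 = P b + P c + P (a + d)"
    using W_add[of a b] W_add[of c d] W_add[of a c] W_add[of b d] W_add[of a d] W_add[of b c]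
      nd neg[OF s(1)] neg[OF s(2)] neg[OF s(3)] by simp_all
  have r: "2 * (W a + W b - W (a + b)) * (P a - P (a + b)) = R a + R (a + b)"
    "2 * (W a + W b - W (a + b)) * (P b - P (a + b)) = R b + R (a + b)"
    "2 * (W c + W d + W (a + b)) * (P c - P (a + b)) = R c - R (a + b)"
    "2 * (W c + W d + W (a + b)) * (P d - P (a + b)) = R d - R (a + b)"
    using R_add[of a b] R_add[of b a] R_add[of c d] R_add[of d c] nd neg[OF s(1)]
    by (simp_all add: add.commute)
  define w1 w2 w3 P1 P2 P3 R1 where "w1 = W (a + b)" and "w2 = W (a + c)" and "w3 = W (a + d)"
    and "P1 = P (a + b)" and "P2 = P (a + c)" and "P3 = P (a + d)" and "R1 = R (a + b)"
  \<comment> \<open>A certificate of ideal membership: an identity of polynomials in independent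
    variables that writes the claim as an explicit combination of the six relations \<open>q\<close>
    and the four relations \<open>r\<close>.\<close>
  have "(R a - 2 * W a * P a) + (R b - 2 * W b * P b) + (R c - 2 * W c * P c) + (R d - 2 * W d * P d) - (W a + W b + W c + W d) * (P a + P b + P c + P d - P1 - P2 - P3 - (W a)^2 - (W b)^2 - (W c)^2 - (W d)^2 + w1^2 + w2^2 + w3^2) =
    ((1) * W a + (1) * W b + (2) * W c + (2) * W d + (2) * w1) * ((W a + W b - w1)^2 - (P a + P b + P1))
    + ((2) * W a + (2) * W b + (1) * W c + (1) * W d + (-2) * w1) * ((W c + W d + w1)^2 - (P c + P d + P1))
    + ((-1) * W b + (-1) * W d) * ((W a + W c - w2)^2 - (P a + P c + P2))
    + ((-1) * W a + (-1) * W c) * ((W b + W d + w2)^2 - (P b + P d + P2))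
    + ((-1) * W b + (-1) * W c) * ((W a + W d - w3)^2 - (P a + P d + P3))
    + ((-1) * W a + (-1) * W d) * ((W b + W c + w3)^2 - (P b + P c + P3))
    + (-1) * (2 * (W a + W b - w1) * (P a - P1) - (R a + R1))
    + (-1) * (2 * (W a + W b - w1) * (P b - P1) - (R b + R1))
    + (-1) * (2 * (W c + W d + w1) * (P c - P1) - (R c - R1))
    + (-1) * (2 * (W c + W d + w1) * (P d - P1) - (R d - R1))"
    by Groebner_Basis.algebra
  also have "\<dots> = 0"
    using q r unfolding w1_def[symmetric] w2_def[symmetric] w3_def[symmetric]
      P1_def[symmetric] P2_def[symmetric] P3_def[symmetric] R1_def[symmetric] by simp
  finally have "(R a - 2 * W a * P a) + (R b - 2 * W b * P b) + (R c - 2 * W c * P c) + (R d - 2 * W d * P d)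
      = (W a + W b + W c + W d) * log_deriv a b c d"
    unfolding log_deriv_def w1_def w2_def w3_def P1_def P2_def P3_def by (simp only: right_minus_eq)
  then show ?thesis
    by (simp add: algebra_simps add_divide_distrib[symmetric] diff_divide_distrib[symmetric])
qed

end

text \<open>Modulo the addition theorem \<open>W_add\<close>, each form \<open>calF p\<close> is a multiple of a logarithmic
  derivative. The integer coefficients of the relations below were found by linear algebra.\<close>

lemma (in torsion_values) calF_5:
  assumes p: "p = 5"
    and X: "\<And>m n. m * n mod 5 = 1 \<Longrightarrow> X m = (\<Sum>k\<leftarrow>[1, 1, 1, 2]. W (n * k))"
  shows "calF 5 (\<lambda>k. X (a_const k 5)) = 30 * log_deriv 1 1 1 2"
proof -
  have W: "W 3 = - W 2" "W 6 = W 1"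
    using W_cong[of 3 "-2"] W_cong[of 6 "1"]
    by (simp_all add: p W_minus)
  have P: "P 3 = P 2"
    using P_cong[of 3 "-2"]
    by (simp_all add: p P_minus)
  \<comment> \<open>\<open>X m\<close> plays the part of \<open>calE (a * m) 5\<close>: multiplying
    the character argument by \<open>m\<close> multiplies the torsion point by the inverse
    \<open>n\<close> of \<open>m\<close>, here 3 for \<open>m = 2\<close>. Indices are then reduced
    to \<open>1, ..., (p - 1) / 2\<close> by periodicity and parity.\<close>
  have X: "X 1 = W 1 + W 1 + W 1 + W 2" "X 2 = - W 2 - W 2 - W 2 + W 1"
    using X[of 1 1] X[of 2 3] W
    by simp_all
  have rel: "(W i + W j - W (i + j))\<^sup>2 = P i + P j + P (i + j)"
    if "0 < i" "0 < j" "i + j < 5" for i j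
    using W_add[of i j] that by (simp add: p zdvd_not_zless)
  \<comment> \<open>Up to order and a common sign, (1, 1, -2) and (1, 2, 2) are the only triples of
    nonzero residues modulo 5 with sum 0, so these two instances of the addition theorem are all
    there are.\<close>
  have "calF 5 (\<lambda>k. X (a_const k 5)) - 30 * log_deriv 1 1 1 2 =
    - ((-80) * ((W 1 + W 1 - W 2)\<^sup>2 - (P 1 + P 1 + P 2))
    + 70 * ((W 1 + W 2 + W 2)\<^sup>2 - (P 1 + P 2 + P 2)))"
    unfolding calF_def calF_5_def log_deriv_def
    by (simp add: a_const_def a_list_def X W P) Groebner_Basis.algebra
  also have "\<dots> = 0"
    using rel[of 1 1] rel[of 1 2]
    by (simp add: W P)
  finally show ?thesis by simp
qed

lemma (in torsion_values) calF_7: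
  assumes p: "p = 7"
    and X: "\<And>m n. m * n mod 7 = 1 \<Longrightarrow> X m = (\<Sum>k\<leftarrow>[1, 1, 2, 3]. W (n * k))"
  shows "calF 7 (\<lambda>k. X (a_const k 7)) = 42 * log_deriv 1 1 2 3"
proof -
  have W: "W 4 = - W 3" "W 5 = - W 2" "W 8 = W 1" "W 10 = W 3" "W 12 = - W 2" "W 15 = W 1"
    using W_cong[of 4 "-3"] W_cong[of 5 "-2"] W_cong[of 8 "1"] W_cong[of 10 "3"] W_cong[of 12 "-2"]
      W_cong[of 15 "1"]
    by (simp_all add: p W_minus)
  have P: "P 4 = P 3"
    using P_cong[of 4 "-3"]
    by (simp_all add: p P_minus)
  have X: "X 1 = W 1 + W 1 + W 2 + W 3" "X 2 = - W 3 - W 3 + W 1 - W 2" "X 3 = - W 2 - W 2 + W 3 + W 1"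
    using X[of 1 1] X[of 2 4] X[of 3 5] W
    by simp_all
  have rel: "(W i + W j - W (i + j))\<^sup>2 = P i + P j + P (i + j)"
    if "0 < i" "0 < j" "i + j < 7" for i j
    using W_add[of i j] that by (simp add: p zdvd_not_zless)
  have "calF 7 (\<lambda>k. X (a_const k 7)) - 42 * log_deriv 1 1 2 3 =
    - ((-33) * ((W 1 + W 1 - W 2)\<^sup>2 - (P 1 + P 1 + P 2))
    + (-41) * ((W 1 + W 2 - W 3)\<^sup>2 - (P 1 + P 2 + P 3))
    + 23 * ((W 1 + W 3 + W 3)\<^sup>2 - (P 1 + P 3 + P 3))
    + 37 * ((W 2 + W 2 + W 3)\<^sup>2 - (P 2 + P 2 + P 3)))"
    unfolding calF_def calF_7_def log_deriv_def
    by (simp add: a_const_def a_list_def X W P) Groebner_Basis.algebra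
  also have "\<dots> = 0"
    using rel[of 1 1] rel[of 1 2] rel[of 1 3] rel[of 2 2]
    by (simp add: W P)
  finally show ?thesis by simp
qed

lemma (in torsion_values) calF_11:
  assumes p: "p = 11"
    and X: "\<And>m n. m * n mod 11 = 1 \<Longrightarrow> X m = (\<Sum>k\<leftarrow>[1, 2, 3, 5]. W (n * k))"
  shows "calF 11 (\<lambda>k. X (a_const k 11)) = 66 * log_deriv 1 2 3 5"
proof -
  have W: "W 6 = - W 5" "W 7 = - W 4" "W 8 = - W 3" "W 9 = - W 2" "W 12 = W 1" "W 16 = W 5" "W 18 = - W 4"
    "W 20 = - W 2" "W 24 = W 2" "W 27 = W 5" "W 30 = - W 3" "W 40 = - W 4" "W 45 = W 1"
    using W_cong[of 6 "-5"] W_cong[of 7 "-4"] W_cong[of 8 "-3"] W_cong[of 9 "-2"] W_cong[of 12 "1"]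
      W_cong[of 16 "5"] W_cong[of 18 "-4"] W_cong[of 20 "-2"] W_cong[of 24 "2"] W_cong[of 27 "5"]
      W_cong[of 30 "-3"] W_cong[of 40 "-4"] W_cong[of 45 "1"]
    by (simp_all add: p W_minus)
  have P: "P 6 = P 5" "P 7 = P 4"
    using P_cong[of 6 "-5"] P_cong[of 7 "-4"]
    by (simp_all add: p P_minus)
  have X: "X 1 = W 1 + W 2 + W 3 + W 5" "X 2 = - W 5 + W 1 - W 4 - W 3" "X 3 = W 4 - W 3 + W 1 - W 2"
    "X 5 = - W 2 - W 4 + W 5 + W 1" "X 7 = - W 3 + W 5 + W 2 - W 4"
    using X[of 1 1] X[of 2 6] X[of 3 4] X[of 5 9] X[of 7 8] W
    by simp_all
  have rel: "(W i + W j - W (i + j))\<^sup>2 = P i + P j + P (i + j)"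
    if "0 < i" "0 < j" "i + j < 11" for i j
    using W_add[of i j] that by (simp add: p zdvd_not_zless)
  have "calF 11 (\<lambda>k. X (a_const k 11)) - 66 * log_deriv 1 2 3 5 =
    - ((-40) * ((W 1 + W 1 - W 2)\<^sup>2 - (P 1 + P 1 + P 2))
    + (-28) * ((W 1 + W 2 - W 3)\<^sup>2 - (P 1 + P 2 + P 3))
    + 12 * ((W 1 + W 3 - W 4)\<^sup>2 - (P 1 + P 3 + P 4))
    + 20 * ((W 1 + W 4 - W 5)\<^sup>2 - (P 1 + P 4 + P 5))
    + 10 * ((W 1 + W 5 + W 5)\<^sup>2 - (P 1 + P 5 + P 5))
    + 29 * ((W 2 + W 2 - W 4)\<^sup>2 - (P 2 + P 2 + P 4))
    + (-31) * ((W 2 + W 3 - W 5)\<^sup>2 - (P 2 + P 3 + P 5))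
    + (-25) * ((W 2 + W 4 + W 5)\<^sup>2 - (P 2 + P 4 + P 5))
    + 16 * ((W 3 + W 3 + W 5)\<^sup>2 - (P 3 + P 3 + P 5))
    + 15 * ((W 3 + W 4 + W 4)\<^sup>2 - (P 3 + P 4 + P 4)))"
    unfolding calF_def calF_11_def log_deriv_def
    by (simp add: a_const_def a_list_def X W P) Groebner_Basis.algebra
  also have "\<dots> = 0"
    using rel[of 1 1] rel[of 1 2] rel[of 1 3] rel[of 1 4] rel[of 1 5] rel[of 2 2] rel[of 2 3] rel[of 2 4]
      rel[of 3 3] rel[of 3 4]
    by (simp add: W P)
  finally show ?thesis by simp
qed

lemma (in torsion_values) calF_13:
  assumes p: "p = 13"
    and X: "\<And>m n. m * n mod 13 = 1 \<Longrightarrow> X m = (\<Sum>k\<leftarrow>[1, 3, 4, 5]. W (n * k))"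
  shows "calF 13 (\<lambda>k. X (a_const k 13)) = 78 * log_deriv 1 3 4 5"
proof -
  have W: "W 7 = - W 6" "W 8 = - W 5" "W 9 = - W 4" "W 10 = - W 3" "W 21 = - W 5" "W 24 = - W 2"
    "W 27 = W 1" "W 28 = W 2" "W 30 = W 4" "W 32 = W 6" "W 35 = - W 4" "W 36 = - W 3" "W 40 = W 1"
    "W 45 = W 6" "W 50 = - W 2"
    using W_cong[of 7 "-6"] W_cong[of 8 "-5"] W_cong[of 9 "-4"] W_cong[of 10 "-3"] W_cong[of 21 "-5"]
      W_cong[of 24 "-2"] W_cong[of 27 "1"] W_cong[of 28 "2"] W_cong[of 30 "4"] W_cong[of 32 "6"]
      W_cong[of 35 "-4"] W_cong[of 36 "-3"] W_cong[of 40 "1"] W_cong[of 45 "6"] W_cong[of 50 "-2"]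
    by (simp_all add: p W_minus)
  have P: "P 7 = P 6" "P 8 = P 5"
    using P_cong[of 7 "-6"] P_cong[of 8 "-5"]
    by (simp_all add: p P_minus)
  have X: "X 1 = W 1 + W 3 + W 4 + W 5" "X 2 = - W 6 - W 5 + W 2 - W 4" "X 3 = - W 4 + W 1 - W 3 + W 6"
    "X 4 = - W 3 + W 4 + W 1 - W 2" "X 5 = - W 5 - W 2 + W 6 + W 1" "X 7 = W 2 + W 6 - W 5 - W 3"
    using X[of 1 1] X[of 2 7] X[of 3 9] X[of 4 10] X[of 5 8] X[of 7 2] W
    by simp_all
  have rel: "(W i + W j - W (i + j))\<^sup>2 = P i + P j + P (i + j)"
    if "0 < i" "0 < j" "i + j < 13" for i j
    using W_add[of i j] that by (simp add: p zdvd_not_zless)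
  have "calF 13 (\<lambda>k. X (a_const k 13)) - 78 * log_deriv 1 3 4 5 =
    - ((-11) * ((W 1 + W 1 - W 2)\<^sup>2 - (P 1 + P 1 + P 2))
    + (-31) * ((W 1 + W 2 - W 3)\<^sup>2 - (P 1 + P 2 + P 3))
    + (-32) * ((W 1 + W 3 - W 4)\<^sup>2 - (P 1 + P 3 + P 4))
    + (-19) * ((W 1 + W 4 - W 5)\<^sup>2 - (P 1 + P 4 + P 5))
    + 19 * ((W 1 + W 5 - W 6)\<^sup>2 - (P 1 + P 5 + P 6))
    + 7 * ((W 1 + W 6 + W 6)\<^sup>2 - (P 1 + P 6 + P 6))
    + 11 * ((W 2 + W 2 - W 4)\<^sup>2 - (P 2 + P 2 + P 4))
    + (-21) * ((W 2 + W 3 - W 5)\<^sup>2 - (P 2 + P 3 + P 5))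
    + 33 * ((W 2 + W 4 - W 6)\<^sup>2 - (P 2 + P 4 + P 6))
    + 8 * ((W 2 + W 5 + W 6)\<^sup>2 - (P 2 + P 5 + P 6))
    + (-5) * ((W 3 + W 3 - W 6)\<^sup>2 - (P 3 + P 3 + P 6))
    + 9 * ((W 3 + W 4 + W 6)\<^sup>2 - (P 3 + P 4 + P 6))
    + 7 * ((W 3 + W 5 + W 5)\<^sup>2 - (P 3 + P 5 + P 5))
    + (-1) * ((W 4 + W 4 + W 5)\<^sup>2 - (P 4 + P 4 + P 5)))"
    unfolding calF_def calF_13_def log_deriv_def
    by (simp add: a_const_def a_list_def X W P) Groebner_Basis.algebra
  also have "\<dots> = 0"
    using rel[of 1 1] rel[of 1 2] rel[of 1 3] rel[of 1 4] rel[of 1 5] rel[of 1 6] rel[of 2 2] rel[of 2 3]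
      rel[of 2 4] rel[of 2 5] rel[of 3 3] rel[of 3 4] rel[of 3 5] rel[of 4 4]
    by (simp add: W P)
  finally show ?thesis by simp
qed

lemma (in torsion_values) calF_17:
  assumes p: "p = 17"
    and X: "\<And>m n. m * n mod 17 = 1 \<Longrightarrow> X m = (\<Sum>k\<leftarrow>[2, 3, 5, 7]. W (n * k))"
  shows "calF 17 (\<lambda>k. X (a_const k 17)) = 102 * log_deriv 2 3 5 7"
proof -
  have W: "W 9 = - W 8" "W 10 = - W 7" "W 11 = - W 6" "W 12 = - W 5" "W 14 = - W 3" "W 15 = - W 2"
    "W 18 = W 1" "W 20 = W 3" "W 21 = W 4" "W 25 = W 8" "W 27 = - W 7" "W 28 = - W 6" "W 30 = - W 4"
    "W 35 = W 1" "W 42 = W 8" "W 45 = - W 6" "W 49 = - W 2" "W 63 = - W 5" "W 70 = W 2" "W 75 = W 7"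
    "W 98 = - W 4" "W 105 = W 3"
    using W_cong[of 9 "-8"] W_cong[of 10 "-7"] W_cong[of 11 "-6"] W_cong[of 12 "-5"] W_cong[of 14 "-3"]
      W_cong[of 15 "-2"] W_cong[of 18 "1"] W_cong[of 20 "3"] W_cong[of 21 "4"] W_cong[of 25 "8"]
      W_cong[of 27 "-7"] W_cong[of 28 "-6"] W_cong[of 30 "-4"] W_cong[of 35 "1"] W_cong[of 42 "8"]
      W_cong[of 45 "-6"] W_cong[of 49 "-2"] W_cong[of 63 "-5"] W_cong[of 70 "2"] W_cong[of 75 "7"]
      W_cong[of 98 "-4"] W_cong[of 105 "3"]
    by (simp_all add: p W_minus)
  have P: "P 9 = P 8" "P 10 = P 7" "P 11 = P 6"
    using P_cong[of 9 "-8"] P_cong[of 10 "-7"] P_cong[of 11 "-6"]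
    by (simp_all add: p P_minus)
  have X: "X 1 = W 2 + W 3 + W 5 + W 7" "X 2 = W 1 - W 7 - W 6 - W 5" "X 3 = - W 5 + W 1 - W 4 + W 8"
    "X 5 = - W 3 + W 4 + W 1 - W 2" "X 7 = - W 7 - W 2 + W 8 + W 1" "X 8 = - W 4 - W 6 + W 7 + W 3"
    "X 11 = - W 6 + W 8 + W 2 - W 4" "X 13 = W 8 - W 5 + W 3 - W 6"
    using X[of 1 1] X[of 2 9] X[of 3 6] X[of 5 7] X[of 7 5] X[of 8 15] X[of 11 14] X[of 13 4] W
    by simp_all
  have rel: "(W i + W j - W (i + j))\<^sup>2 = P i + P j + P (i + j)"
    if "0 < i" "0 < j" "i + j < 17" for i j
    using W_add[of i j] that by (simp add: p zdvd_not_zless)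
  have "calF 17 (\<lambda>k. X (a_const k 17)) - 102 * log_deriv 2 3 5 7 =
    - ((-29) * ((W 1 + W 1 - W 2)\<^sup>2 - (P 1 + P 1 + P 2))
    + (-35) * ((W 1 + W 2 - W 3)\<^sup>2 - (P 1 + P 2 + P 3))
    + 5 * ((W 1 + W 3 - W 4)\<^sup>2 - (P 1 + P 3 + P 4))
    + 11 * ((W 1 + W 4 - W 5)\<^sup>2 - (P 1 + P 4 + P 5))
    + 1 * ((W 1 + W 5 - W 6)\<^sup>2 - (P 1 + P 5 + P 6))
    + (-10) * ((W 1 + W 6 - W 7)\<^sup>2 - (P 1 + P 6 + P 7))
    + 46 * ((W 1 + W 7 - W 8)\<^sup>2 - (P 1 + P 7 + P 8))
    + 40 * ((W 1 + W 8 + W 8)\<^sup>2 - (P 1 + P 8 + P 8))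
    + (-5) * ((W 2 + W 2 - W 4)\<^sup>2 - (P 2 + P 2 + P 4))
    + (-28) * ((W 2 + W 3 - W 5)\<^sup>2 - (P 2 + P 3 + P 5))
    + (-5) * ((W 2 + W 4 - W 6)\<^sup>2 - (P 2 + P 4 + P 6))
    + (-2) * ((W 2 + W 5 - W 7)\<^sup>2 - (P 2 + P 5 + P 7))
    + 14 * ((W 2 + W 6 - W 8)\<^sup>2 - (P 2 + P 6 + P 8))
    + (-7) * ((W 2 + W 7 + W 8)\<^sup>2 - (P 2 + P 7 + P 8))
    + 4 * ((W 3 + W 3 - W 6)\<^sup>2 - (P 3 + P 3 + P 6))
    + (-5) * ((W 3 + W 4 - W 7)\<^sup>2 - (P 3 + P 4 + P 7))
    + (-16) * ((W 3 + W 5 - W 8)\<^sup>2 - (P 3 + P 5 + P 8))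
    + (-14) * ((W 3 + W 6 + W 8)\<^sup>2 - (P 3 + P 6 + P 8))
    + (-17) * ((W 3 + W 7 + W 7)\<^sup>2 - (P 3 + P 7 + P 7))
    + 4 * ((W 4 + W 4 - W 8)\<^sup>2 - (P 4 + P 4 + P 8))
    + (-5) * ((W 4 + W 5 + W 8)\<^sup>2 - (P 4 + P 5 + P 8))
    + (-4) * ((W 4 + W 6 + W 7)\<^sup>2 - (P 4 + P 6 + P 7))
    + 16 * ((W 5 + W 5 + W 7)\<^sup>2 - (P 5 + P 5 + P 7))
    + 7 * ((W 5 + W 6 + W 6)\<^sup>2 - (P 5 + P 6 + P 6)))"
    unfolding calF_def calF_17_def log_deriv_def
    by (simp add: a_const_def a_list_def X W P) Groebner_Basis.algebra
  also have "\<dots> = 0"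
    using rel[of 1 1] rel[of 1 2] rel[of 1 3] rel[of 1 4] rel[of 1 5] rel[of 1 6] rel[of 1 7] rel[of 1 8]
      rel[of 2 2] rel[of 2 3] rel[of 2 4] rel[of 2 5] rel[of 2 6] rel[of 2 7] rel[of 3 3] rel[of 3 4]
      rel[of 3 5] rel[of 3 6] rel[of 3 7] rel[of 4 4] rel[of 4 5] rel[of 4 6] rel[of 5 5] rel[of 5 6]
    by (simp add: W P)
  finally show ?thesis by simp
qed

lemma (in torsion_values) calF_19:
  assumes p: "p = 19"
    and X: "\<And>m n. m * n mod 19 = 1 \<Longrightarrow> X m = (\<Sum>k\<leftarrow>[3, 4, 5, 7]. W (n * k))"
  shows "calF 19 (\<lambda>k. X (a_const k 19)) = 114 * log_deriv 3 4 5 7"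
proof -
  have W: "W 10 = - W 9" "W 11 = - W 8" "W 12 = - W 7" "W 15 = - W 4" "W 16 = - W 3" "W 20 = W 1"
    "W 21 = W 2" "W 25 = W 6" "W 28 = W 9" "W 30 = - W 8" "W 33 = - W 5" "W 35 = - W 3" "W 39 = W 1"
    "W 40 = W 2" "W 44 = W 6" "W 49 = - W 8" "W 50 = - W 7" "W 51 = - W 6" "W 52 = - W 5"
    "W 55 = - W 2" "W 65 = W 8" "W 68 = - W 8" "W 70 = - W 6" "W 77 = W 1" "W 85 = W 9"
    "W 91 = - W 4" "W 119 = W 5"
    using W_cong[of 10 "-9"] W_cong[of 11 "-8"] W_cong[of 12 "-7"] W_cong[of 15 "-4"] W_cong[of 16 "-3"]
      W_cong[of 20 "1"] W_cong[of 21 "2"] W_cong[of 25 "6"] W_cong[of 28 "9"] W_cong[of 30 "-8"]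
      W_cong[of 33 "-5"] W_cong[of 35 "-3"] W_cong[of 39 "1"] W_cong[of 40 "2"] W_cong[of 44 "6"]
      W_cong[of 49 "-8"] W_cong[of 50 "-7"] W_cong[of 51 "-6"] W_cong[of 52 "-5"] W_cong[of 55 "-2"]
      W_cong[of 65 "8"] W_cong[of 68 "-8"] W_cong[of 70 "-6"] W_cong[of 77 "1"] W_cong[of 85 "9"]
      W_cong[of 91 "-4"] W_cong[of 119 "5"]
    by (simp_all add: p W_minus)
  have P: "P 10 = P 9" "P 11 = P 8" "P 12 = P 7"
    using P_cong[of 10 "-9"] P_cong[of 11 "-8"] P_cong[of 12 "-7"]
    by (simp_all add: p P_minus)
  have X: "X 1 = W 3 + W 4 + W 5 + W 7" "X 2 = - W 8 + W 2 - W 7 - W 6" "X 3 = W 1 - W 5 + W 8 - W 4"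
    "X 4 = - W 4 + W 1 + W 6 - W 3" "X 5 = - W 7 - W 3 + W 1 + W 9" "X 7 = - W 5 + W 6 - W 2 + W 1"
    "X 9 = - W 6 - W 8 + W 9 + W 5" "X 11 = W 2 + W 9 - W 3 - W 8" "X 13 = W 9 - W 7 - W 4 + W 2"
    using X[of 1 1] X[of 2 10] X[of 3 13] X[of 4 5] X[of 5 4] X[of 7 11] X[of 9 17] X[of 11 7] X[of 13 3] W
    by simp_all
  have rel: "(W i + W j - W (i + j))\<^sup>2 = P i + P j + P (i + j)"
    if "0 < i" "0 < j" "i + j < 19" for i j
    using W_add[of i j] that by (simp add: p zdvd_not_zless)
  \<comment> \<open>Of the 30 triples of nonzero residues modulo 19 with sum 0, up to order and
    sign, only (1, 1, -2) gets the coefficient 0 and is absent.\<close>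
  have "calF 19 (\<lambda>k. X (a_const k 19)) - 114 * log_deriv 3 4 5 7 =
    - ((-37) * ((W 1 + W 2 - W 3)\<^sup>2 - (P 1 + P 2 + P 3))
    + (-37) * ((W 1 + W 3 - W 4)\<^sup>2 - (P 1 + P 3 + P 4))
    + (-11) * ((W 1 + W 4 - W 5)\<^sup>2 - (P 1 + P 4 + P 5))
    + (-1) * ((W 1 + W 5 - W 6)\<^sup>2 - (P 1 + P 5 + P 6))
    + (-13) * ((W 1 + W 6 - W 7)\<^sup>2 - (P 1 + P 6 + P 7))
    + 32 * ((W 1 + W 7 - W 8)\<^sup>2 - (P 1 + P 7 + P 8))
    + 59 * ((W 1 + W 8 - W 9)\<^sup>2 - (P 1 + P 8 + P 9))
    + 8 * ((W 1 + W 9 + W 9)\<^sup>2 - (P 1 + P 9 + P 9))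
    + (-6) * ((W 2 + W 2 - W 4)\<^sup>2 - (P 2 + P 2 + P 4))
    + (-38) * ((W 2 + W 3 - W 5)\<^sup>2 - (P 2 + P 3 + P 5))
    + (-1) * ((W 2 + W 4 - W 6)\<^sup>2 - (P 2 + P 4 + P 6))
    + (-15) * ((W 2 + W 5 - W 7)\<^sup>2 - (P 2 + P 5 + P 7))
    + 49 * ((W 2 + W 6 - W 8)\<^sup>2 - (P 2 + P 6 + P 8))
    + 15 * ((W 2 + W 7 - W 9)\<^sup>2 - (P 2 + P 7 + P 9))
    + 39 * ((W 2 + W 8 + W 9)\<^sup>2 - (P 2 + P 8 + P 9))
    + 2 * ((W 3 + W 3 - W 6)\<^sup>2 - (P 3 + P 3 + P 6))
    + 9 * ((W 3 + W 4 - W 7)\<^sup>2 - (P 3 + P 4 + P 7))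
    + (-13) * ((W 3 + W 5 - W 8)\<^sup>2 - (P 3 + P 5 + P 8))
    + 5 * ((W 3 + W 6 - W 9)\<^sup>2 - (P 3 + P 6 + P 9))
    + 15 * ((W 3 + W 7 + W 9)\<^sup>2 - (P 3 + P 7 + P 9))
    + (-22) * ((W 3 + W 8 + W 8)\<^sup>2 - (P 3 + P 8 + P 8))
    + (-20) * ((W 4 + W 4 - W 8)\<^sup>2 - (P 4 + P 4 + P 8))
    + (-25) * ((W 4 + W 5 - W 9)\<^sup>2 - (P 4 + P 5 + P 9))
    + (-12) * ((W 4 + W 6 + W 9)\<^sup>2 - (P 4 + P 6 + P 9))
    + 9 * ((W 4 + W 7 + W 8)\<^sup>2 - (P 4 + P 7 + P 8))
    + 2 * ((W 5 + W 5 + W 9)\<^sup>2 - (P 5 + P 5 + P 9))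
    + 3 * ((W 5 + W 6 + W 8)\<^sup>2 - (P 5 + P 6 + P 8))
    + (-18) * ((W 5 + W 7 + W 7)\<^sup>2 - (P 5 + P 7 + P 7))
    + (-16) * ((W 6 + W 6 + W 7)\<^sup>2 - (P 6 + P 6 + P 7)))"
    unfolding calF_def calF_19_def log_deriv_def
    by (simp add: a_const_def a_list_def X W P) Groebner_Basis.algebra
  also have "\<dots> = 0"
    using rel[of 1 2] rel[of 1 3] rel[of 1 4] rel[of 1 5] rel[of 1 6] rel[of 1 7] rel[of 1 8] rel[of 1 9]
      rel[of 2 2] rel[of 2 3] rel[of 2 4] rel[of 2 5] rel[of 2 6] rel[of 2 7] rel[of 2 8] rel[of 3 3]
      rel[of 3 4] rel[of 3 5] rel[of 3 6] rel[of 3 7] rel[of 3 8] rel[of 4 4] rel[of 4 5] rel[of 4 6]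
      rel[of 4 7] rel[of 5 5] rel[of 5 6] rel[of 5 7] rel[of 6 6]
    by (simp add: W P)
  finally show ?thesis by simp
qed

section \<open>Torsion values as functions of the nome\<close>

text \<open>This is \<open>\<rho> (q ^ k) - 1/2\<close> for the parameter \<open>q ^ p\<close>. The
  term at \<open>n = 0\<close> is \<open>0 / 0 = 0\<close>.\<close>

definition zeta_series :: "nat \<Rightarrow> nat \<Rightarrow> complex \<Rightarrow> complex" where
  "zeta_series p k q = (\<Sum>n. (q ^ (k * n) - q ^ ((p - k) * n)) / (1 - q ^ (p * n)))"

text \<open>Subtracting \<open>k / p\<close> turns the reflection
  \<open>\<rho> (Q / x) = 1 - \<rho> x\<close> into oddness in \<open>i\<close>. At multiples of
  \<open>p\<close>, where the zeta function has its pole, the value is set to 0.\<close>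

definition zeta_value :: "nat \<Rightarrow> complex \<Rightarrow> int \<Rightarrow> complex" where
  "zeta_value p q i = (let k = nat (i mod int p) in
     if k = 0 then 0 else 1/2 - of_nat k / of_nat p + zeta_series p k q)"

text \<open>The shift by \<open>E2 / 12\<close>, once for each of the three arguments, absorbs the
  constant \<open>E2 / 4\<close> of \<open>\<rho>_add_square\<close>.\<close>

definition wp_value :: "nat \<Rightarrow> complex \<Rightarrow> int \<Rightarrow> complex" where
  "wp_value p q i = (let k = nat (i mod int p) in
     if k = 0 then 0 else lambert.\<rho>1 (q ^ p) (q ^ k) + E2 (q ^ p) / 12)"

definition wp'_value :: "nat \<Rightarrow> complex \<Rightarrow> int \<Rightarrow> complex" where
  "wp'_value p q i = (let k = nat (i mod int p) in
     if k = 0 then 0 else lambert.\<rho>2 (q ^ p) (q ^ k))"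

locale torsion =
  fixes p :: nat and q :: complex
  assumes p_pos: "p > 0" and q_nz: "q \<noteq> 0" and norm_q: "norm q < 1"
begin

sublocale lambert "q ^ p"
  using p_pos q_nz norm_q by unfold_locales (auto simp: norm_power power_less_one_iff)

lemma power_annulus: "0 < k \<Longrightarrow> k < p \<Longrightarrow> q ^ k \<in> annulus"
  using norm_q q_nz by (auto simp: annulus_def norm_power power_less_one_iff power_strict_decreasing_iff)

lemma power_divide: "k \<le> p \<Longrightarrow> q ^ p / q ^ k = q ^ (p - k)"
  using q_nz by (simp add: power_diff)

lemma zeta_series_sums:
  assumes k: "0 < k" "k < p"
  shows "(\<lambda>n. (q ^ (k * n) - q ^ ((p - k) * n)) / (1 - q ^ (p * n))) sums (\<rho> (q ^ k) - 1/2)"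
proof -
  have "(\<lambda>n. of_nat n ^ 0 * lam n * (q ^ k) ^ n - of_nat n ^ 0 * lam n * (q ^ (p - k)) ^ n)
      sums (Lam 0 (q ^ k) - Lam 0 (q ^ (p - k)))"
    by (intro sums_diff weighted_powser_sums[where c = lam, OF norm_lam] annulusD(2) power_annulus)
       (use k in auto)
  also have "Lam 0 (q ^ k) - Lam 0 (q ^ (p - k)) = \<rho> (q ^ k) - 1/2"
    using k by (simp add: \<rho>_def power_divide)
  also have "(\<lambda>n. of_nat n ^ 0 * lam n * (q ^ k) ^ n - of_nat n ^ 0 * lam n * (q ^ (p - k)) ^ n)
      = (\<lambda>n. (q ^ (k * n) - q ^ ((p - k) * n)) / (1 - q ^ (p * n)))"
    by (simp add: lam_def power_mult diff_divide_distrib)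
  finally show ?thesis .
qed

lemma \<rho>_eq: "0 < k \<Longrightarrow> k < p \<Longrightarrow> \<rho> (q ^ k) = 1/2 + zeta_series p k q"
  using zeta_series_sums by (simp add: zeta_series_def sums_iff)

lemma zeta_value_eq: "0 < k \<Longrightarrow> k < p \<Longrightarrow> zeta_value p q (int k) = \<rho> (q ^ k) - of_nat k / of_nat p"
  and wp_value_eq: "0 < k \<Longrightarrow> k < p \<Longrightarrow> wp_value p q (int k) = \<rho>1 (q ^ k) + E2 (q ^ p) / 12"
  and wp'_value_eq: "0 < k \<Longrightarrow> k < p \<Longrightarrow> wp'_value p q (int k) = \<rho>2 (q ^ k)"
  by (simp_all add: zeta_value_def wp_value_def wp'_value_def \<rho>_eq Let_def)

lemma values_mod:
  "zeta_value p q (i mod int p) = zeta_value p q i"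
  "wp_value p q (i mod int p) = wp_value p q i"
  "wp'_value p q (i mod int p) = wp'_value p q i"
  by (simp_all add: zeta_value_def wp_value_def wp'_value_def)

lemma values_complement:
  assumes k: "0 < k" "k < p"
  shows "zeta_value p q (int (p - k)) = - zeta_value p q (int k)"
    "wp_value p q (int (p - k)) = wp_value p q (int k)"
    "wp'_value p q (int (p - k)) = - wp'_value p q (int k)"
proof -
  have pk: "0 < p - k" "p - k < p" using k by auto
  have eq: "q ^ (p - k) = q ^ p / q ^ k" using k by (simp add: power_divide)
  show "zeta_value p q (int (p - k)) = - zeta_value p q (int k)"
    unfolding zeta_value_eq[OF k] zeta_value_eq[OF pk] eq
    using q_nz k by (subst \<rho>_inverse) (auto simp: of_nat_diff field_simps)
  show "wp_value p q (int (p - k)) = wp_value p q (int k)"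
    unfolding wp_value_eq[OF k] wp_value_eq[OF pk] eq using q_nz by (subst \<rho>1_inverse) auto
  show "wp'_value p q (int (p - k)) = - wp'_value p q (int k)"
    unfolding wp'_value_eq[OF k] wp'_value_eq[OF pk] eq using q_nz by (subst \<rho>2_inverse) auto
qed

lemma values_minus:
  "zeta_value p q (- i) = - zeta_value p q i"
  "wp_value p q (- i) = wp_value p q i"
  "wp'_value p q (- i) = - wp'_value p q i"
proof -
  define k where "k = nat (i mod int p)"
  have k: "i mod int p = int k" "k < p"
    using p_pos pos_mod_sign[of "int p" i] pos_mod_bound[of "int p" i] by (auto simp: k_def nat_less_iff)
  have "(- i) mod int p = int (if k = 0 then 0 else p - k)"
    using k p_pos by (auto simp: zmod_zminus1_eq_if of_nat_diff)
  then have "zeta_value p q (- i) = - zeta_value p q i \<and> wp_value p q (- i) = wp_value p q i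
      \<and> wp'_value p q (- i) = - wp'_value p q i"
    using values_complement[of k] k values_mod[of i] values_mod[of "- i"]
    by (cases "k = 0") (simp_all add: zeta_value_def[of p q 0] wp_value_def[of p q 0] wp'_value_def[of p q 0])
  then show "zeta_value p q (- i) = - zeta_value p q i" "wp_value p q (- i) = wp_value p q i"
    "wp'_value p q (- i) = - wp'_value p q i" by auto
qed

text \<open>The relations on the annulus apply when the residues of \<open>i\<close> and
  \<open>j\<close> add up to less than \<open>p\<close>. Otherwise the residues of
  \<open>- i\<close> and \<open>- j\<close> do, and both relations are invariant under a common
  change of sign.\<close>

lemma torsion_values: "torsion_values (int p) (zeta_value p q) (wp_value p q) (wp'_value p q)"
proof
  fix i j
  let ?W = "zeta_value p q" and ?P = "wp_value p q" and ?R = "wp'_value p q"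
  let ?rel = "\<lambda>i j. (?W i + ?W j - ?W (i + j))\<^sup>2 = ?P i + ?P j + ?P (i + j) \<and>
      2 * (?W i + ?W j - ?W (i + j)) * (?P i - ?P (i + j)) = ?R i + ?R (i + j)"
  have small: "?rel (int k) (int l)" if "0 < k" "0 < l" "k + l < p" for k l
  proof -
    have ann: "q ^ k \<in> annulus" "q ^ l \<in> annulus" "q ^ k * q ^ l \<in> annulus"
      using that power_annulus[of k] power_annulus[of l] power_annulus[of "k + l"] by (auto simp: power_add)
    have kl: "0 < k + l" "k + l < p" "0 < k" "k < p" "0 < l" "l < p" using that by auto
    have "?W (int k) + ?W (int l) - ?W (int (k + l)) = \<rho> (q ^ k) + \<rho> (q ^ l) - \<rho> (q ^ k * q ^ l)"
      using kl by (simp add: zeta_value_eq power_add del: of_nat_add) (simp add: add_divide_distrib)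
    moreover have "(\<rho> (q ^ k) + \<rho> (q ^ l) - \<rho> (q ^ k * q ^ l))\<^sup>2 = ?P (int k) + ?P (int l) + ?P (int (k + l))"
      using kl unfolding \<rho>_add_square[OF ann] by (simp add: wp_value_eq power_add del: of_nat_add)
    moreover have "2 * (\<rho> (q ^ k) + \<rho> (q ^ l) - \<rho> (q ^ k * q ^ l)) * (?P (int k) - ?P (int (k + l)))
        = ?R (int k) + ?R (int (k + l))"
      using kl \<rho>_add_derivative[OF ann] by (simp add: wp_value_eq wp'_value_eq power_add del: of_nat_add)
    ultimately show ?thesis by simp
  qed
  have red: "?rel i j \<longleftrightarrow> ?rel (i mod int p) (j mod int p)" for i j
    using values_mod[of i] values_mod[of j] values_mod[of "i + j"] values_mod[of "i mod int p + j mod int p"]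
    by (simp add: mod_add_eq)
  have neg: "?rel i j \<longleftrightarrow> ?rel (- i) (- j)" for i j
  proof -
    have "- i + - j = - (i + j)" by simp
    then show ?thesis
      unfolding values_minus by (simp only: values_minus) (auto simp: power2_eq_square algebra_simps)
  qed
  show "?W (i mod int p) = ?W i" "?P (i mod int p) = ?P i" "?R (i mod int p) = ?R i"
    by (fact values_mod)+
  show "?W (- i) = - ?W i" "?P (- i) = ?P i" "?R (- i) = - ?R i"
    by (fact values_minus)+
  assume nd: "\<not> int p dvd i" "\<not> int p dvd j" "\<not> int p dvd i + j"
  have main: "?rel i j" if "\<not> int p dvd i" "\<not> int p dvd j" "i mod int p + j mod int p < int p" for i j
  proof -
    define k l where "k = nat (i mod int p)" and "l = nat (j mod int p)"
    have pos: "i mod int p \<ge> 0" "j mod int p \<ge> 0" using p_pos by auto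
    have "i mod int p \<noteq> 0" "j mod int p \<noteq> 0" using that by (auto simp: dvd_eq_mod_eq_0)
    with pos have "i mod int p = int k" "j mod int p = int l" "0 < k" "0 < l"
      by (auto simp: k_def l_def)
    with small[of k l] that(3) show ?thesis by (subst red) simp
  qed
  have "?rel i j"
  proof (cases "i mod int p + j mod int p < int p")
    case True
    with main nd show ?thesis by blast
  next
    case False
    have "i mod int p + j mod int p \<noteq> int p"
      using nd(3) by (metis dvd_eq_mod_eq_0 mod_add_eq mod_self)
    moreover have "(- i) mod int p = int p - i mod int p" "(- j) mod int p = int p - j mod int p"
      using nd by (auto simp: zmod_zminus1_eq_if dvd_eq_mod_eq_0)
    ultimately have "(- i) mod int p + (- j) mod int p < int p" using False by simp
    then have "?rel (- i) (- j)" using main[of "- i" "- j"] nd by simp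
    then show ?thesis using neg by blast
  qed
  then show "(?W i + ?W j - ?W (i + j))\<^sup>2 = ?P i + ?P j + ?P (i + j)"
    "2 * (?W i + ?W j - ?W (i + j)) * (?P i - ?P (i + j)) = ?R i + ?R (i + j)" by auto
qed

end

section \<open>Differentiation with respect to the nome\<close>

lemma has_field_derivative_power_divide:
  "(q :: complex) \<noteq> 0 \<Longrightarrow> ((\<lambda>q. q ^ m) has_field_derivative of_nat m * q ^ m / q) (at q)"
  using DERIV_power[OF DERIV_ident, where n = m and x = q and s = UNIV] by (cases m) auto

text \<open>The chain rule for \<open>x = q ^ k\<close> and \<open>Q = q ^ p\<close>, carried out
  term by term: \<open>\<rho>1\<close> is \<open>x d/dx\<close> and \<open>\<kappa>1\<close> is
  \<open>Q d/dQ\<close> of \<open>\<rho>\<close>.\<close>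

lemma has_field_derivative_zeta_series:
  assumes "torsion p q" and k: "0 < k" "k < p"
  shows "(zeta_series p k has_field_derivative
    (of_nat k * lambert.\<rho>1 (q ^ p) (q ^ k) + of_nat p * lambert.\<kappa>1 (q ^ p) (q ^ k)) / q) (at q)"
proof -
  interpret torsion p q by fact
  define S where "S = {z :: complex. z \<noteq> 0 \<and> norm z < 1}"
  define f where "f n z = (z ^ (k * n) - z ^ ((p - k) * n)) / (1 - z ^ (p * n))" for n and z :: complex
  \<comment> \<open>The quotient rule, grouped so that the multiples of \<open>k\<close> and of
    \<open>p\<close> are the n-th terms of \<open>\<rho>1\<close> and
    \<open>\<kappa>1\<close>.\<close>
  define f' where "f' n z = (of_nat k * (of_nat n * (z ^ (k * n) + z ^ ((p - k) * n)) / (1 - z ^ (p * n)))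
      + of_nat p * (of_nat n * (z ^ (p * n) * z ^ (k * n) - z ^ ((p - k) * n)) / (1 - z ^ (p * n))\<^sup>2)) / z"
    for n and z :: complex
  have S: "open S"
    unfolding S_def by (intro open_Collect_conj open_Collect_neq open_Collect_less continuous_intros)
  have "\<exists>g g'. \<forall>x\<in>S. (\<lambda>n. f n x) sums g x \<and> (\<lambda>n. f' n x) sums g' x \<and> (g has_field_derivative g' x) (at x)"
  proof (rule series_and_derivative_comparison_complex[OF S])
    fix n z assume z: "z \<in> S"
    show "(f n has_field_derivative f' n z) (at z)"
    proof (cases "n = 0")
      case False
      have nz: "z \<noteq> 0" "1 - z ^ (p * n) \<noteq> 0"
      proof -
        show "z \<noteq> 0" using z by (simp add: S_def)
        have "norm (z ^ (p * n)) < 1"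
          using z False p_pos by (auto simp: S_def norm_power power_less_one_iff)
        then show "1 - z ^ (p * n) \<noteq> 0" by auto
      qed
      define X Y Z where "X = z ^ (k * n)" and "Y = z ^ ((p - k) * n)" and "Z = z ^ (p * n)"
      have "(f n has_field_derivative ((of_nat (k * n) * X / z - of_nat ((p - k) * n) * Y / z) * (1 - Z)
          - (X - Y) * (0 - of_nat (p * n) * Z / z)) / ((1 - Z) * (1 - Z))) (at z)"
        unfolding f_def[abs_def] X_def Y_def Z_def
        by (rule DERIV_divide DERIV_diff has_field_derivative_power_divide DERIV_const nz)+
      also have "((of_nat (k * n) * X / z - of_nat ((p - k) * n) * Y / z) * (1 - Z)
          - (X - Y) * (0 - of_nat (p * n) * Z / z)) / ((1 - Z) * (1 - Z)) = f' n z"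
      proof -
        define N K M where "N = (of_nat n :: complex)" and "K = (of_nat k :: complex)" and "M = (of_nat p :: complex)"
        have "of_nat ((p - k) * n) = (M - K) * N" using k by (simp add: N_def K_def M_def of_nat_diff)
        moreover have "of_nat (k * n) = K * N" "of_nat (p * n) = M * N" by (simp_all add: N_def K_def M_def)
        moreover have "1 - Z \<noteq> 0" using nz by (simp add: Z_def)
        ultimately show ?thesis
          using nz(1) unfolding f'_def N_def[symmetric] K_def[symmetric] M_def[symmetric]
            X_def[symmetric] Y_def[symmetric] Z_def[symmetric]
          by (simp add: divide_simps power2_eq_square) (simp add: algebra_simps)
      qed
      finally show ?thesis .
    qed (simp add: f_def[abs_def] f'_def)
  next
    fix z assume z: "z \<in> S"
    define r where "r = (1 + norm z) / 2"
    have r: "0 < r" "r < 1" using z by (auto simp: S_def r_def field_simps intro: add_pos_nonneg)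
    let ?h = "\<lambda>n. complex_of_real (2 / (1 - r) * r ^ n)"
    have bd: "norm (f n y) \<le> norm (?h n)" if "y \<in> ball z (1 - r)" for n y
    proof (cases "n = 0")
      case False
      have "norm y \<le> norm z + norm (y - z)" by (rule norm_triangle_sub)
      then have y: "norm y \<le> r" using that by (simp add: dist_norm norm_minus_commute r_def field_simps)
      have pow: "norm (y ^ (m * n)) \<le> r ^ n" if "m > 0" for m
      proof -
        have "norm y ^ (m * n) \<le> r ^ (m * n)" using y by (intro power_mono) auto
        also have "\<dots> \<le> r ^ n" using r that by (intro power_decreasing) auto
        finally show ?thesis by (simp add: norm_power)
      qed
      have "r ^ n \<le> r ^ 1" using r False by (intro power_decreasing) auto
      then have "1 - r \<le> norm (1 - y ^ (p * n))"
        using norm_triangle_ineq2[of 1 "y ^ (p * n)"] pow[OF p_pos] by simp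
      moreover have "norm (y ^ (k * n) - y ^ ((p - k) * n)) \<le> 2 * r ^ n"
        using norm_triangle_ineq4[of "y ^ (k * n)" "y ^ ((p - k) * n)"] pow[of k] pow[of "p - k"] k by simp
      ultimately have "norm (f n y) \<le> 2 * r ^ n / (1 - r)"
        unfolding f_def norm_divide using r by (intro frac_le) auto
      also have "\<dots> = norm (?h n)" unfolding norm_of_real using r by simp
      finally show ?thesis .
    qed (simp add: f_def)
    show "\<exists>d h. 0 < d \<and> summable h \<and> range h \<subseteq> \<real>\<^sub>\<ge>\<^sub>0 \<and>
        (\<forall>\<^sub>F n in sequentially. \<forall>y\<in>ball z d \<inter> S. norm (f n y) \<le> cmod (h n))"
    proof (intro exI[of _ "1 - r"] exI[of _ ?h] conjI)
      show "summable ?h"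
        using r by (intro summable_of_real summable_mult summable_geometric) auto
      show "range ?h \<subseteq> \<real>\<^sub>\<ge>\<^sub>0" using r by (auto simp del: of_real_mult of_real_divide)
      show "0 < 1 - r" using r by simp
    qed (use bd in auto)
  qed
  then obtain g g' where g: "\<And>x. x \<in> S \<Longrightarrow> (\<lambda>n. f n x) sums g x"
      "\<And>x. x \<in> S \<Longrightarrow> (\<lambda>n. f' n x) sums g' x" "\<And>x. x \<in> S \<Longrightarrow> (g has_field_derivative g' x) (at x)"
    by blast
  have q: "q \<in> S" using q_nz norm_q by (simp add: S_def)
  have eq: "g x = zeta_series p k x" if "x \<in> S" for x
    using g(1)[OF that] by (simp add: zeta_series_def f_def sums_iff)
  have "(zeta_series p k has_field_derivative g' q) (at q)"
    by (rule has_field_derivative_transform_within_open[OF g(3)[OF q] S q eq])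
  moreover have "g' q = (of_nat k * \<rho>1 (q ^ k) + of_nat p * \<kappa>1 (q ^ k)) / q"
  proof -
    note D = annulusD[OF power_annulus[OF k]]
    have pk: "q ^ p / q ^ k = q ^ (p - k)" using k by (simp add: power_divide)
    let ?t = "\<lambda>n. (of_nat k * (of_nat n ^ 1 * lam n * (q ^ k) ^ n + of_nat n ^ 1 * lam n * (q ^ p / q ^ k) ^ n)
      + of_nat p * (of_nat n ^ 1 * kap n * (q ^ p * q ^ k) ^ n - of_nat n ^ 1 * kap n * (q ^ p / q ^ k) ^ n)) / q"
    have "?t sums ((of_nat k * (Lam 1 (q ^ k) + Lam 1 (q ^ p / q ^ k))
      + of_nat p * (Kap 1 (q ^ p * q ^ k) - Kap 1 (q ^ p / q ^ k))) / q)"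
      using D by (intro sums_divide sums_add sums_mult sums_diff weighted_powser_sums[where c = lam, OF norm_lam]
        weighted_powser_sums[where c = kap, OF norm_kap])
    also have "?t = (\<lambda>n. f' n q)"
    proof
      fix n
      show "?t n = f' n q"
        unfolding f'_def pk lam_def kap_def power_mult power_mult_distrib
        by (simp add: algebra_simps add_divide_distrib diff_divide_distrib)
    qed
    finally show ?thesis
      using g(2)[OF q] unfolding \<rho>1_def \<kappa>1_def by (metis sums_unique2)
  qed
  ultimately show ?thesis by simp
qed

text \<open>The heat equation turns the derivative in \<open>q\<close>, which moves both the torsion point and the
  lattice, into derivatives along the elliptic curve.\<close>

lemma has_field_derivative_zeta_value:
  assumes "torsion p q"
  shows "((\<lambda>q. zeta_value p q i) has_field_derivative
     of_nat p * (wp'_value p q i / 2 - zeta_value p q i * wp_value p q i + E2 (q ^ p) / 12 * zeta_value p q i) / q) (at q)"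
proof -
  interpret torsion p q by fact
  define k where "k = nat (i mod int p)"
  have k: "i mod int p = int k" "k < p"
    using p_pos pos_mod_sign[of "int p" i] pos_mod_bound[of "int p" i] by (auto simp: k_def nat_less_iff)
  have mod: "zeta_value p q i = zeta_value p q (int k)" "wp_value p q i = wp_value p q (int k)"
    "wp'_value p q i = wp'_value p q (int k)"
    using k values_mod[of i] by simp_all
  show ?thesis
  proof (cases "k = 0")
    case True
    then have "zeta_value p q i = 0" "wp'_value p q i = 0" for q
      by (simp_all add: zeta_value_def wp'_value_def k_def Let_def)
    then show ?thesis by simp
  next
    case False
    then have k0: "0 < k" by simp
    have "(\<lambda>q. zeta_value p q i) = (\<lambda>q. 1/2 - of_nat k / of_nat p + zeta_series p k q)"
      using False unfolding zeta_value_def k_def[symmetric] Let_def by simp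
    moreover have "((\<lambda>q. 1/2 - of_nat k / of_nat p + zeta_series p k q) has_field_derivative
        0 + (of_nat k * \<rho>1 (q ^ k) + of_nat p * \<kappa>1 (q ^ k)) / q) (at q)"
      by (intro DERIV_add DERIV_const has_field_derivative_zeta_series[OF assms k0 k(2)])
    \<comment> \<open>By \<open>\<rho>_heat\<close> the left side is
      \<open>p * (\<rho>2 / 2 - (\<rho> - k / p) * \<rho>1)\<close>: the term \<open>k / p\<close>
      of \<open>zeta_value\<close> accounts exactly for the motion of the torsion point. The last
      summand on the right cancels the \<open>E2 / 12\<close> inside
      \<open>wp_value\<close>.\<close>
    moreover have "of_nat k * \<rho>1 (q ^ k) + of_nat p * \<kappa>1 (q ^ k) =
      of_nat p * (wp'_value p q i / 2 - zeta_value p q i * wp_value p q i + E2 (q ^ p) / 12 * zeta_value p q i)"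
      unfolding mod zeta_value_eq[OF k0 k(2)] wp_value_eq[OF k0 k(2)] wp'_value_eq[OF k0 k(2)]
        \<rho>_heat[OF power_annulus[OF k0 k(2)]]
      using p_pos by (simp add: field_simps)
    ultimately show ?thesis by simp
  qed
qed

lemma torsion_nome:
  assumes "p > 0" "Im \<tau> > 0"
  shows "torsion p (nome \<tau>)"
  using assms by unfold_locales (auto simp: nome_def)

lemma has_field_derivative_nome:
  "(nome has_field_derivative 2 * of_real pi * \<i> * nome \<tau>) (at \<tau>)"
  unfolding nome_def[abs_def] by (auto intro!: derivative_eq_intros)

lemma has_field_derivative_zeta_value_nome:
  assumes "p > 0" "Im \<tau> > 0"
  shows "((\<lambda>\<tau>. zeta_value p (nome \<tau>) i) has_field_derivative
     2 * of_real pi * \<i> * (of_nat p * (wp'_value p (nome \<tau>) i / 2 - zeta_value p (nome \<tau>) i * wp_value p (nome \<tau>) i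
       + E2 (nome \<tau> ^ p) / 12 * zeta_value p (nome \<tau>) i))) (at \<tau>)"
proof -
  interpret torsion p "nome \<tau>" using assms by (rule torsion_nome)
  have "of_nat p * Y / nome \<tau> * (c * nome \<tau>) = c * (of_nat p * Y)" for Y c
    using q_nz by simp
  then show ?thesis
    using DERIV_chain2[OF has_field_derivative_zeta_value[OF torsion_nome[OF assms]] has_field_derivative_nome, of i]
    by (simp only:)
qed

section \<open>Lambert series with periodic coefficients, and their uniqueness\<close>

lemma sums_periodic_power_series:
  fixes c :: "int \<Rightarrow> complex"
  assumes c_mod: "\<And>m. c (m mod int p) = c m" and p: "p > 0" and y: "norm y < 1"
  shows "(\<lambda>m. c (int m) * y ^ m) sums ((\<Sum>j<p. c (int j) * y ^ j) / (1 - y ^ p))"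
proof -
  have bd: "norm (c (int m)) \<le> (\<Sum>j<p. norm (c (int j)))" for m
  proof -
    have "norm (c (int (m mod p))) \<le> (\<Sum>j<p. norm (c (int j)))"
      using p by (intro member_le_sum) auto
    then show ?thesis using c_mod[of "int m"] by (simp add: zmod_int)
  qed
  define s where "s = (\<Sum>m. c (int m) * y ^ m)"
  have sm: "(\<lambda>m. c (int m) * y ^ m) sums s"
    using weighted_powser_sums[of "\<lambda>m. c (int m)", OF bd y, of 0] by (simp add: s_def sums_iff)
  have "(\<lambda>m. c (int (m + p)) * y ^ (m + p)) sums (y ^ p * s)"
  proof -
    have "c (int (m + p)) = c (int m)" for m
      using c_mod[of "int m + int p"] c_mod[of "int m"] by simp
    then show ?thesis using sums_mult[OF sm, of "y ^ p"] by (simp add: power_add algebra_simps)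
  qed
  then have "(\<lambda>m. c (int m) * y ^ m) sums (y ^ p * s + (\<Sum>j<p. c (int j) * y ^ j))"
    by (subst (asm) sums_iff_shift) simp
  with sm have "s = y ^ p * s + (\<Sum>j<p. c (int j) * y ^ j)" by (rule sums_unique2)
  moreover have "norm (y ^ p) < 1"
    using y p by (simp add: norm_power power_less_one_iff)
  then have "1 - y ^ p \<noteq> 0" by auto
  ultimately have "s = (\<Sum>j<p. c (int j) * y ^ j) / (1 - y ^ p)" by (simp add: field_simps)
  with sm show ?thesis by simp
qed

lemma has_sum_nat_from_1:
  fixes f :: "nat \<Rightarrow> complex"
  assumes "(f has_sum s) {1..}"
  shows "(\<lambda>n. f (Suc n)) sums s"
proof -
  have "(f has_sum s) (range Suc)"
    using assms by (rule has_sum_cong_neutral[THEN iffD1, rotated -1]) (auto simp: image_iff Suc_le_eq gr0_conv_Suc)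
  then have "((\<lambda>n. f (Suc n)) has_sum s) UNIV" by (subst (asm) has_sum_reindex) (auto simp: o_def)
  then show ?thesis by (rule has_sum_imp_sums)
qed

text \<open>The double series of \<open>c m * q ^ (m * n)\<close> is summed in both orders. Summing
  over \<open>m\<close> first gives, by periodicity, a polynomial in \<open>q ^ n\<close> over
  \<open>1 - q ^ (p * n)\<close>. Oddness pairs \<open>j\<close> with \<open>p - j\<close>, which
  produces \<open>zeta_series\<close> and the factor one half.\<close>

lemma (in torsion) lambert_series_odd_periodic:
  fixes c :: "int \<Rightarrow> complex"
  assumes c_mod: "\<And>m. c (m mod int p) = c m" and c_odd: "\<And>m. c (- m) = - c m"
  shows "(\<lambda>n. c (int (Suc n)) * q ^ Suc n / (1 - q ^ Suc n)) sums
    ((\<Sum>j\<in>{1..<p}. c (int j) * zeta_series p j q) / 2)"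
proof -
  define C where "C = (\<Sum>j<p. norm (c (int j)))"
  have C: "norm (c (int m)) \<le> C" for m
  proof -
    have "norm (c (int (m mod p))) \<le> C"
      unfolding C_def using p_pos by (intro member_le_sum) auto
    then show ?thesis using c_mod[of "int m"] by (simp add: zmod_int)
  qed
  have c0: "c 0 = 0" using c_odd[of 0] by simp
  have "(\<lambda>(m, n). C * (norm q ^ m) ^ n) summable_on {1..} \<times> {1..}"
  proof (rule summable_on_SigmaI)
    have norm_q': "norm (norm q) < 1" using norm_q by simp
    show "((\<lambda>n. case (m, n) of (m, n) \<Rightarrow> C * (norm q ^ m) ^ n) has_sum (C * (norm q ^ m / (1 - norm q ^ m)))) {1..}"
      if "m \<in> {1..}" for m
      using has_sum_cmult_right[OF has_sum_geometric_from_1[OF norm_power_less_1[OF norm_q' that]], of C] by simp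
    have "(\<lambda>m. norm q ^ m * (1 / (1 - norm q))) summable_on {1..}"
      using has_sum_geometric_from_1[OF norm_q'] by (intro summable_on_cmult_left has_sum_imp_summable)
    then have "(\<lambda>m. norm q ^ m / (1 - norm q ^ m)) summable_on {1..}"
    proof (rule summable_on_comparison_test)
      fix m :: nat assume "m \<in> {1..}"
      then have "norm q ^ m \<le> norm q ^ 1" using norm_q by (intro power_decreasing) auto
      with norm_q show "norm q ^ m / (1 - norm q ^ m) \<le> norm q ^ m * (1 / (1 - norm q))"
        by (simp add: frac_le)
      show "0 \<le> norm q ^ m / (1 - norm q ^ m)"
        using \<open>norm q ^ m \<le> norm q ^ 1\<close> norm_q by simp
    qed
    then show "(\<lambda>m. C * (norm q ^ m / (1 - norm q ^ m))) summable_on {1..}"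
      by (rule summable_on_cmult_right)
  qed (auto simp: C_def sum_nonneg)
  then have "(\<lambda>z. norm (case z of (m, n) \<Rightarrow> c (int m) * (q ^ m) ^ n)) summable_on {1..} \<times> {1..}"
    by (rule summable_on_comparison_test)
       (use C in \<open>auto simp: norm_mult norm_power intro!: mult_right_mono\<close>)
  then have "(\<lambda>(m, n). c (int m) * (q ^ m) ^ n) summable_on {1..} \<times> {1..}"
    by (rule abs_summable_summable)
  then obtain S where S: "((\<lambda>(m, n). c (int m) * (q ^ m) ^ n) has_sum S) ({1..} \<times> {1..})"
    by (auto simp: summable_on_def)
  have "((\<lambda>m. c (int m) * (q ^ m / (1 - q ^ m))) has_sum S) {1..}"
  proof (rule has_sum_SigmaD[OF S])
    fix m :: nat assume "m \<in> {1..}"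
    from has_sum_cmult_right[OF has_sum_geometric_from_1[OF norm_power_less_1[OF norm_q this]]]
    show "((\<lambda>n. case (m, n) of (m, n) \<Rightarrow> c (int m) * (q ^ m) ^ n) has_sum c (int m) * (q ^ m / (1 - q ^ m))) {1..}"
      by simp
  qed
  then have 1: "(\<lambda>n. c (int (Suc n)) * (q ^ Suc n / (1 - q ^ Suc n))) sums S"
    by (rule has_sum_nat_from_1)
  let ?g = "\<lambda>n. (\<Sum>j\<in>{1..<p}. c (int j) * ((q ^ (j * n) - q ^ ((p - j) * n)) / (1 - q ^ (p * n)))) / 2"
  have "(?g has_sum S) {1..}"
  proof (rule has_sum_SigmaD[OF S[THEN has_sum_swap[THEN iffD1]]])
    fix n :: nat assume n: "n \<in> {1..}"
    define y where "y = q ^ n"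
    have y: "norm y < 1" using norm_power_less_1[OF norm_q n] by (simp add: y_def)
    have "summable (\<lambda>m. norm (c (int m) * y ^ m))"
      using summable_norm_weighted_powser[of "\<lambda>m. c (int m)", OF C y, of 0] by simp
    then have "((\<lambda>m. c (int m) * y ^ m) has_sum ((\<Sum>j<p. c (int j) * y ^ j) / (1 - y ^ p))) UNIV"
      using sums_periodic_power_series[where c = c, OF c_mod p_pos y] by (rule norm_summable_imp_has_sum)
    also have "?this \<longleftrightarrow> ((\<lambda>m. c (int m) * y ^ m) has_sum ((\<Sum>j<p. c (int j) * y ^ j) / (1 - y ^ p))) {1..}"
      by (rule has_sum_cong_neutral) (auto simp: not_le c0)
    also have "(\<Sum>j<p. c (int j) * y ^ j) = (\<Sum>j\<in>{1..<p}. c (int j) * y ^ j)"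
      by (rule sum.mono_neutral_right) (auto simp: not_le c0)
    also have "(\<Sum>j\<in>{1..<p}. c (int j) * y ^ j) = (\<Sum>j\<in>{1..<p}. c (int j) * (y ^ j - y ^ (p - j))) / 2"
    proof -
      have "(\<Sum>j\<in>{1..<p}. c (int j) * y ^ (p - j)) = (\<Sum>j\<in>{1..<p}. c (int (p - j)) * y ^ j)"
        by (rule sum.reindex_bij_witness[of _ "\<lambda>j. p - j" "\<lambda>j. p - j"]) auto
      also have "\<dots> = (\<Sum>j\<in>{1..<p}. - (c (int j) * y ^ j))"
      proof (rule sum.cong[OF refl])
        fix j assume "j \<in> {1..<p}"
        then have "c (int (p - j)) = c (- int j)"
          using c_mod[of "int p - int j"] c_mod[of "- int j"] by (simp add: of_nat_diff)
        then show "c (int (p - j)) * y ^ j = - (c (int j) * y ^ j)" using c_odd by simp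
      qed
      finally show ?thesis by (simp add: right_diff_distrib sum_subtractf sum_negf)
    qed
    also have "(\<Sum>j\<in>{1..<p}. c (int j) * (y ^ j - y ^ (p - j))) / 2 / (1 - y ^ p) = ?g n"
      by (simp add: y_def power_mult[symmetric] sum_divide_distrib mult.commute)
    finally show "((\<lambda>m. case (n, m) of (x, y) \<Rightarrow> (case (y, x) of (m, n) \<Rightarrow> c (int m) * (q ^ m) ^ n)) has_sum ?g n) {1..}"
      by (simp add: y_def power_mult[symmetric] mult.commute)
  qed
  then have "(?g has_sum S) UNIV"
    by (rule has_sum_cong_neutral[THEN iffD1, rotated -1]) (auto simp: not_le)
  then have "?g sums S" by (rule has_sum_imp_sums)
  moreover have "?g sums ((\<Sum>j\<in>{1..<p}. c (int j) * zeta_series p j q) / 2)"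
    using zeta_series_sums by (intro sums_divide sums_sum sums_mult) (simp add: \<rho>_eq)
  ultimately have "S = (\<Sum>j\<in>{1..<p}. c (int j) * zeta_series p j q) / 2" by (rule sums_unique2)
  with 1 show ?thesis by (simp only: times_divide_eq_right)
qed

lemma le_0_if_le_linear:
  fixes x K :: real
  assumes "\<And>t. 0 < t \<Longrightarrow> t \<le> 1/2 \<Longrightarrow> x \<le> K * t"
  shows "x \<le> 0"
proof (rule tendsto_lowerbound)
  show "((\<lambda>t. K * t) \<longlongrightarrow> 0) (at_right 0)"
    by (auto intro!: tendsto_eq_intros)
  have "eventually (\<lambda>t. t \<in> {0<..<1/2}) (at_right (0 :: real))"
    by (rule eventually_at_right_real) simp
  then show "eventually (\<lambda>t. x \<le> K * t) (at_right 0)"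
    by eventually_elim (use assms in auto)
qed auto

lemma lambert_series_eq_0_imp:
  fixes c :: "nat \<Rightarrow> complex"
  assumes C: "\<And>n. norm (c n) \<le> C"
    and zero: "\<And>t :: real. 0 < t \<Longrightarrow> t < 1 \<Longrightarrow> (\<lambda>n. c (Suc n) * of_real t ^ Suc n / (1 - of_real t ^ Suc n)) sums A"
  shows "c (Suc m) = 0"
proof (induction m rule: less_induct)
  case (less m)
  define d where "d = Suc m"
  have C0: "C \<ge> 0" using norm_ge_zero C by (rule order_trans)
  have key: "norm (A - c d * of_real t ^ d / (1 - of_real t ^ d)) \<le> 4 * C * t ^ Suc d"
    if t: "0 < t" "t \<le> 1/2" for t :: real
  proof -
    let ?f = "\<lambda>n. c (Suc n) * of_real t ^ Suc n / (1 - of_real t ^ Suc n)"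
    have "(\<lambda>n. ?f (n + d)) sums (A - (\<Sum>n<d. ?f n))"
      using zero[of t] t by (intro sums_split_initial_segment) auto
    also have "(\<Sum>n<d. ?f n) = ?f m"
      using less.IH by (simp add: d_def)
    finally have s: "(\<lambda>n. ?f (n + d)) sums (A - ?f m)" .
    have bd: "norm (?f (n + d)) \<le> 2 * C * t ^ Suc d * (1/2) ^ n" for n
    proof -
      have "t ^ (n + Suc d) = t ^ Suc d * t ^ n" by (simp add: power_add)
      also have "\<dots> \<le> t ^ Suc d * (1/2) ^ n" using t by (intro mult_left_mono power_mono) auto
      finally have a: "t ^ (n + Suc d) \<le> t ^ Suc d * (1/2) ^ n" .
      have "t ^ (n + Suc d) \<le> t ^ 1" using t by (intro power_decreasing) auto
      also have "t ^ 1 \<le> 1/2" using t by simp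
      finally have "1/2 \<le> 1 - t ^ (n + Suc d)" by linarith
      moreover have "norm (1 - of_real t ^ (n + Suc d) :: complex) = \<bar>1 - t ^ (n + Suc d)\<bar>"
        by (metis norm_of_real of_real_1 of_real_diff of_real_power)
      ultimately have b: "1/2 \<le> norm (1 - of_real t ^ (n + Suc d) :: complex)" by simp
      have "norm (?f (n + d)) = norm (c (n + Suc d)) * t ^ (n + Suc d) / norm (1 - of_real t ^ (n + Suc d) :: complex)"
        using t by (simp add: norm_mult norm_divide norm_power)
      also have "\<dots> \<le> C * (t ^ Suc d * (1/2) ^ n) / (1/2)"
        using C C0 a b t by (intro frac_le mult_mono) auto
      finally show ?thesis by simp
    qed
    have "norm (A - ?f m) \<le> (\<Sum>n. 2 * C * t ^ Suc d * (1/2) ^ n)"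
    proof -
      have "summable (\<lambda>n. 2 * C * t ^ Suc d * (1/2) ^ n)"
        by (intro summable_mult summable_geometric) simp
      from norm_suminf_le[OF bd this] s show ?thesis by (simp add: sums_iff)
    qed
    also have "(\<Sum>n. 2 * C * t ^ Suc d * (1/2) ^ n) = 4 * C * t ^ Suc d"
      by (subst suminf_mult) (auto simp: suminf_geometric intro!: summable_geometric)
    finally show ?thesis by (simp add: d_def)
  qed
  have pow: "t ^ d \<le> t" "norm (1 - of_real t ^ d :: complex) = 1 - t ^ d" if "0 < t" "t \<le> 1/2" for t :: real
  proof -
    have "t ^ d \<le> t ^ 1" using that by (intro power_decreasing) (auto simp: d_def)
    then show "t ^ d \<le> t" by simp
    moreover have "norm (1 - of_real t ^ d :: complex) = \<bar>1 - t ^ d\<bar>"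
      by (metis norm_of_real of_real_1 of_real_diff of_real_power)
    ultimately show "norm (1 - of_real t ^ d :: complex) = 1 - t ^ d" using that by simp
  qed
  have "norm A \<le> 0"
  proof (rule le_0_if_le_linear)
    fix t :: real assume t: "0 < t" "t \<le> 1/2"
    have "norm A \<le> norm (c d * of_real t ^ d / (1 - of_real t ^ d)) + 4 * C * t ^ Suc d"
      using key[OF t] norm_triangle_sub[of A "c d * of_real t ^ d / (1 - of_real t ^ d)"] by linarith
    also have "norm (c d * of_real t ^ d / (1 - of_real t ^ d)) = norm (c d) * t ^ d / (1 - t ^ d)"
      unfolding norm_divide norm_mult pow(2)[OF t] using t by (simp add: norm_power)
    also have "\<dots> \<le> C * t / (1/2)"
      using C C0 pow(1)[OF t] t by (intro frac_le mult_mono) auto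
    also have "4 * C * t ^ Suc d \<le> 4 * C * t"
      using C0 power_decreasing[of 1 "Suc d" t] t by (intro mult_left_mono) auto
    finally show "norm A \<le> (6 * C) * t" by (simp add: algebra_simps)
  qed
  then have A: "A = 0" by simp
  have "norm (c d) \<le> 0"
  proof (rule le_0_if_le_linear)
    fix t :: real assume t: "0 < t" "t \<le> 1/2"
    have "norm (c d) * t ^ d * 1 \<le> norm (c d) * t ^ d * (1 / (1 - t ^ d))"
      using t pow(1)[OF t] by (intro mult_left_mono) auto
    also have "\<dots> = norm (c d * of_real t ^ d / (1 - of_real t ^ d))"
      unfolding norm_divide norm_mult pow(2)[OF t] using t by (simp add: norm_power)
    also have "\<dots> \<le> 4 * C * t ^ Suc d" using key[OF t] A by simp
    finally have "norm (c d) * t ^ d \<le> (4 * C * t) * t ^ d" by (simp add: mult_ac)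
    then show "norm (c d) \<le> 4 * C * t" using t by simp
  qed
  then show ?case by (simp add: d_def)
qed

section \<open>Odd characters and Eisenstein series\<close>

text \<open>By \<open>sum_odd_characters\<close> this is the average over the odd characters modulo
  \<open>p\<close>.\<close>

definition odd_delta :: "nat \<Rightarrow> int \<Rightarrow> complex" where
  "odd_delta p m = (if [m = 1] (mod int p) then 1 else if [m = -1] (mod int p) then -1 else 0)"

lemma power_eq_if_cong:
  fixes z :: "'a :: monoid_mult"
  assumes "z ^ n = 1" "[i = j] (mod n)"
  shows "z ^ i = z ^ j"
proof -
  have "z ^ k = z ^ (k mod n)" for k
    using assms(1) by (metis mult_div_mod_eq power_add power_mult power_one mult_1)
  then show ?thesis using assms(2) by (metis cong_def)
qed

text \<open>Multiplication by a primitive \<open>h\<close>-th root of unity permutes the roots of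
  \<open>z ^ h = -1\<close> and scales the sum by a factor different from 1 unless
  \<open>h dvd i\<close>.\<close>

lemma sum_power_nth_roots_minus_1:
  assumes h: "h > 0"
  shows "(\<Sum>z | z ^ h = (-1 :: complex). z ^ i) = (if h dvd i then of_nat h * (-1) ^ (i div h) else 0)"
proof (cases "h dvd i")
  case True
  then have "(\<Sum>z | z ^ h = (-1 :: complex). z ^ i) = (\<Sum>z | z ^ h = (-1 :: complex). (-1) ^ (i div h))"
    by (intro sum.cong) (auto elim!: dvdE simp: power_mult h)
  then show ?thesis using True card_nth_roots[of "-1" h] h by simp
next
  case False
  define \<omega> where "\<omega> = cis (2 * pi / real h)"
  have 1: "\<omega> ^ h = 1" using h by (simp add: \<omega>_def Complex.DeMoivre)
  have i: "\<omega> ^ i \<noteq> 1"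
  proof
    assume "\<omega> ^ i = 1"
    then have "cis (2 * pi * real i / real h) = 1" by (simp add: \<omega>_def Complex.DeMoivre field_simps)
    then have "cos (2 * pi * real i / real h) = 1" by (auto simp: complex_eq_iff)
    then obtain n :: int where "2 * pi * real i / real h = of_int n * 2 * pi"
      using cos_one_2pi_int by blast
    then have "real i = of_int n * real h" using h by (simp add: field_simps)
    then have "int i = n * int h" by (metis of_int_eq_iff of_int_mult of_int_of_nat_eq)
    then have "int h dvd int i" by simp
    with False show False by simp
  qed
  have "(\<Sum>z | z ^ h = (-1 :: complex). z ^ i) = (\<Sum>z | z ^ h = (-1 :: complex). (\<omega> * z) ^ i)"
  proof (rule sum.reindex_bij_witness[of _ "\<lambda>z. \<omega> * z" "\<lambda>z. z / \<omega>"])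
    have "\<omega> \<noteq> 0" by (simp add: \<omega>_def)
    then show "\<omega> * (z / \<omega>) = z" "\<omega> * z / \<omega> = z" "(\<omega> * (z / \<omega>)) ^ i = z ^ i" for z by auto
  qed (use 1 in \<open>auto simp: power_mult_distrib power_divide\<close>)
  also have "\<dots> = \<omega> ^ i * (\<Sum>z | z ^ h = (-1 :: complex). z ^ i)"
    by (simp add: power_mult_distrib sum_distrib_left)
  finally have "(1 - \<omega> ^ i) * (\<Sum>z | z ^ h = (-1 :: complex). z ^ i) = 0" by (simp add: algebra_simps)
  with i False show ?thesis by simp
qed

section \<open>Odd characters modulo a prime through a primitive root\<close>

locale primitive_root =
  fixes p g :: nat
  assumes prime: "prime p" and p_gt_2: "p > 2" and primroot: "residue_primroot p g"
begin

definition half :: nat where "half = (p - 1) div 2"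

lemma half: "p - 1 = 2 * half" "half > 0"
proof -
  have "odd p" using prime p_gt_2 prime_odd_nat by blast
  then show "p - 1 = 2 * half" unfolding half_def by (elim oddE) simp
  with p_gt_2 show "half > 0" by linarith
qed

lemma not_dvd_1: "\<not> int p dvd 1"
  using p_gt_2 by (simp add: zdvd_not_zless)

lemma coprime_iff_not_dvd: "coprime m (int p) \<longleftrightarrow> \<not> int p dvd m"
proof
  assume "coprime m (int p)"
  then show "\<not> int p dvd m" using not_dvd_1 coprime_common_divisor[of m "int p" "int p"] by auto
next
  assume "\<not> int p dvd m"
  with prime have "coprime (int p) m" by (intro prime_imp_coprime) auto
  then show "coprime m (int p)" by (simp add: coprime_commute)
qed

lemma power_cong_iff: "[int g ^ i = int g ^ j] (mod int p) \<longleftrightarrow> [i = j] (mod p - 1)"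
proof -
  have "[g ^ i = g ^ j] (mod p) \<longleftrightarrow> [i = j] (mod ord p g)"
    using primroot by (intro order_divides_expdiff) (simp add: residue_primroot_def)
  also have "ord p g = p - 1" using primroot prime by (simp add: residue_primroot_def totient_prime)
  finally show ?thesis by (metis cong_int_iff of_nat_power)
qed

lemma ex_index:
  assumes "\<not> int p dvd m"
  shows "\<exists>i. [int g ^ i = m] (mod int p)"
proof -
  define r where "r = nat (m mod int p)"
  have p0: "p > 0" using p_gt_2 by simp
  have r: "int r = m mod int p" "r < p" "r > 0"
  proof -
    show *: "int r = m mod int p" using p0 by (simp add: r_def)
    then show "r < p" using p0 pos_mod_bound[of "int p" m] by linarith
    show "r > 0" using * assms by (auto simp: dvd_eq_mod_eq_0 intro: gr0I)
  qed
  then have "r \<in> totatives p" using prime by (simp add: totatives_prime)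
  then obtain i where "r = g ^ i mod p"
    using residue_primroot_is_generator[OF _ primroot] p_gt_2 by (auto simp: bij_betw_def)
  then have "int g ^ i mod int p = m mod int p" using r(1) by (metis of_nat_power zmod_int)
  then show ?thesis unfolding cong_def by blast
qed

definition index :: "int \<Rightarrow> nat" where
  "index m = (SOME i. [int g ^ i = m] (mod int p))"

lemma index: "\<not> int p dvd m \<Longrightarrow> [int g ^ index m = m] (mod int p)"
  unfolding index_def using ex_index by (rule someI_ex)

lemma not_dvd_g: "\<not> int p dvd int g"
  using primroot p_gt_2 by (auto simp: residue_primroot_def coprime_absorb_left)

lemma power_half: "[int g ^ half = -1] (mod int p)"
proof -
  have "[int g ^ (2 * half) = int g ^ 0] (mod int p)"
    unfolding power_cong_iff half(1) by (simp add: cong_def)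
  then have "int p dvd int g ^ (2 * half) - 1" by (simp add: cong_iff_dvd_diff)
  also have "int g ^ (2 * half) - 1 = (int g ^ half - 1) * (int g ^ half + 1)"
    unfolding mult_2 power_add by (simp add: algebra_simps)
  finally have "int p dvd int g ^ half - 1 \<or> int p dvd int g ^ half + 1"
    using prime by (subst (asm) prime_dvd_mult_iff) auto
  moreover have "\<not> int p dvd int g ^ half - 1"
  proof
    assume "int p dvd int g ^ half - 1"
    then have "[int g ^ half = int g ^ 0] (mod int p)" by (simp add: cong_iff_dvd_diff)
    then show False
      unfolding power_cong_iff half(1) using half(2) by (simp add: cong_def)
  qed
  ultimately show ?thesis by (simp add: cong_iff_dvd_diff)
qed

text \<open>An odd character is determined by its value \<open>z\<close> at \<open>g\<close>, and
  oddness means \<open>z ^ half = -1\<close> since \<open>g ^ half\<close> is -1 modulo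
  \<open>p\<close>. For such \<open>z\<close> the power does not depend on the choice of the
  discrete logarithm, which is unique only modulo \<open>p - 1\<close>.\<close>

definition root_char :: "complex \<Rightarrow> int \<Rightarrow> complex" where
  "root_char z m = (if int p dvd m then 0 else z ^ index m)"

lemma power_index_eq:
  assumes z: "z ^ half = (-1 :: complex)" and m: "\<not> int p dvd m" and i: "[int g ^ i = m] (mod int p)"
  shows "z ^ index m = z ^ i"
proof (rule power_eq_if_cong[of _ "p - 1"])
  show "z ^ (p - 1) = 1" unfolding half(1) using z by (simp add: mult_2 power_add)
  show "[index m = i] (mod p - 1)"
    using cong_trans[OF index[OF m] cong_sym[OF i]] by (simp add: power_cong_iff)
qed

lemma root_char_in_odd_characters:
  assumes z: "z ^ half = -1"
  shows "root_char z \<in> odd_characters p"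
proof -
  have prime': "prime (int p)" using prime by simp
  have "root_char z 1 = 1"
    using power_index_eq[OF z not_dvd_1, of 0] not_dvd_1 by (simp add: root_char_def)
  moreover have "root_char z (m * n) = root_char z m * root_char z n" for m n
  proof (cases "int p dvd m \<or> int p dvd n")
    case False
    then have mn: "\<not> int p dvd m * n" using prime' by (simp add: prime_dvd_mult_iff)
    have "[int g ^ (index m + index n) = m * n] (mod int p)"
      unfolding power_add using False by (intro cong_mult index) auto
    from power_index_eq[OF z mn this] show ?thesis
      using False mn by (simp add: root_char_def power_add)
  qed (auto simp: root_char_def)
  moreover have "root_char z (m + int p) = root_char z m" for m
  proof (cases "int p dvd m")
    case False
    have "[int g ^ index m = m + int p] (mod int p)"
      using index[OF False] by (simp add: cong_def)
    from power_index_eq[OF z _ this] show ?thesis using False by (simp add: root_char_def)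
  qed (simp add: root_char_def)
  moreover have "root_char z m = 0 \<longleftrightarrow> \<not> coprime m (int p)" for m
  proof -
    have "z \<noteq> 0" using z half(2) by (auto simp: power_0_left)
    then show ?thesis by (simp add: root_char_def coprime_iff_not_dvd)
  qed
  moreover have "root_char z (-1) = -1"
    using power_index_eq[OF z _ power_half] not_dvd_1 z by (simp add: root_char_def)
  ultimately show ?thesis by (simp add: odd_characters_def dirichlet_character_def)
qed

lemma odd_character_eq_root_char:
  assumes \<psi>: "\<psi> \<in> odd_characters p"
  shows "\<psi> (int g) ^ half = -1" "root_char (\<psi> (int g)) = \<psi>"
proof -
  have chi: "dirichlet_character p \<psi>" and odd: "\<psi> (-1) = -1"
    using \<psi> by (auto simp: odd_characters_def)
  have pow: "\<psi> (int g ^ i) = \<psi> (int g) ^ i" for i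
    using chi by (induction i) (auto simp: dirichlet_character_def)
  have cong: "\<psi> m = \<psi> n" if "[m = n] (mod int p)" for m n
    using dirichlet_character_mod[OF chi] that by (metis cong_def)
  show "\<psi> (int g) ^ half = -1" using cong[OF power_half] odd pow by simp
  show "root_char (\<psi> (int g)) = \<psi>"
  proof
    fix m
    show "root_char (\<psi> (int g)) m = \<psi> m"
    proof (cases "int p dvd m")
      case True
      then show ?thesis using chi by (simp add: root_char_def dirichlet_character_def coprime_iff_not_dvd)
    next
      case False
      then show ?thesis using cong[OF index[OF False]] pow by (simp add: root_char_def)
    qed
  qed
qed

text \<open>Under the bijection \<open>root_char\<close> the sum becomes the power sum of exponent
  \<open>index m\<close> over the roots of \<open>z ^ half = -1\<close>.\<close>

lemma sum_odd_characters: "(\<Sum>\<psi>\<in>odd_characters p. \<psi> m) = of_nat half * odd_delta p m"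
proof -
  have g1: "\<not> int p dvd int g" by (rule not_dvd_g)
  have "(\<Sum>\<psi>\<in>odd_characters p. \<psi> m) = (\<Sum>z | z ^ half = (-1 :: complex). root_char z m)"
  proof (rule sum.reindex_bij_witness[of _ root_char "\<lambda>\<psi>. \<psi> (int g)"])
    fix z :: complex assume z: "z \<in> {z. z ^ half = -1}"
    show "root_char z \<in> odd_characters p" using z root_char_in_odd_characters by simp
    show "root_char z (int g) = z"
      using power_index_eq[of z "int g" 1] z g1 by (simp add: root_char_def)
  qed (use odd_character_eq_root_char in auto)
  also have "\<dots> = of_nat half * odd_delta p m"
  proof (cases "int p dvd m")
    case True
    have "\<not> [m = 1] (mod int p)" "\<not> [m = -1] (mod int p)"
      using True not_dvd_1 by (metis cong_dvd_iff, metis cong_dvd_iff dvd_minus_iff)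
    then show ?thesis using True by (simp add: root_char_def odd_delta_def)
  next
    case False
    define i where "i = index m"
    have i: "[int g ^ i = m] (mod int p)" using index[OF False] by (simp add: i_def)
    have "(\<Sum>z | z ^ half = (-1 :: complex). root_char z m) = (\<Sum>z | z ^ half = (-1 :: complex). z ^ i)"
      using False by (simp add: root_char_def i_def)
    also have "\<dots> = (if half dvd i then of_nat half * (-1) ^ (i div half) else 0)"
      by (rule sum_power_nth_roots_minus_1[OF half(2)])
    also have "\<dots> = of_nat half * odd_delta p m"
    proof (cases "half dvd i")
      case True
      then have "int g ^ i = (int g ^ half) ^ (i div half)" by (simp add: power_mult[symmetric])
      then have "[m = (-1) ^ (i div half)] (mod int p)"
        using cong_trans[OF cong_sym[OF i]] cong_pow[OF power_half] by metis
      moreover have "\<not> [(-1) = 1] (mod int p)"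
        using p_gt_2 by (simp add: cong_iff_dvd_diff zdvd_not_zless)
      ultimately show ?thesis using True
        by (cases "even (i div half)") (auto simp: odd_delta_def dest: cong_sym cong_trans)
    next
      case ni: False
      have "\<not> [m = 1] (mod int p)"
      proof
        assume "[m = 1] (mod int p)"
        then have "[int g ^ i = int g ^ 0] (mod int p)" using cong_trans[OF i] by simp
        then have "p - 1 dvd i" unfolding power_cong_iff by (simp add: cong_0_iff)
        with ni show False unfolding half(1) by (metis dvd_mult_right)
      qed
      moreover have "\<not> [m = -1] (mod int p)"
      proof
        assume "[m = -1] (mod int p)"
        then have "[int g ^ i = int g ^ half] (mod int p)"
          using cong_trans[OF i] cong_sym[OF power_half] cong_trans by blast
        then have "[i = half] (mod 2 * half)" unfolding power_cong_iff half(1) .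
        then have "[i = half] (mod half)" by (rule cong_dvd_modulus_nat) simp
        then have "[i = 0] (mod half)" by (simp add: cong_def)
        with ni show False by (simp add: cong_0_iff)
      qed
      ultimately show ?thesis using ni by (simp add: odd_delta_def)
    qed
    finally show ?thesis .
  qed
  finally show ?thesis .
qed

end

text \<open>Minus the periodic first Bernoulli function at \<open>i / p\<close>, with value 0 at
  integers; it is also the constant term of \<open>zeta_value p q i\<close> as a series in
  \<open>q\<close>.\<close>

definition sawtooth :: "nat \<Rightarrow> int \<Rightarrow> complex" where
  "sawtooth p i = (let k = nat (i mod int p) in if k = 0 then 0 else 1/2 - of_nat k / of_nat p)"

lemma sawtooth_mod: "sawtooth p (i mod int p) = sawtooth p i"
  by (simp add: sawtooth_def)

context primitive_root
begin

lemma odd_delta_cong: "[m = n] (mod int p) \<Longrightarrow> odd_delta p m = odd_delta p n"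
  by (auto simp: odd_delta_def cong_def)

lemma odd_delta_minus: "odd_delta p (- m) = - odd_delta p m"
proof -
  have "\<not> [1 = -1] (mod int p)"
    using p_gt_2 by (simp add: cong_iff_dvd_diff zdvd_not_zless)
  moreover have "[- m = 1] (mod int p) \<longleftrightarrow> [m = -1] (mod int p)" "[- m = -1] (mod int p) \<longleftrightarrow> [m = 1] (mod int p)"
    using cong_minus_minus_iff[of m "-1" "int p"] cong_minus_minus_iff[of m 1 "int p"] by simp_all
  ultimately show ?thesis by (auto simp: odd_delta_def dest: cong_sym cong_trans)
qed

lemma sum_residues_multiply:
  fixes f :: "int \<Rightarrow> complex"
  assumes u: "[u * v = 1] (mod int p)" and f: "\<And>i. f (i mod int p) = f i"
  shows "(\<Sum>j\<in>{1..<int p}. f (u * j)) = (\<Sum>j\<in>{1..<int p}. f j)"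
proof -
  have p0: "int p > 0" using p_gt_2 by simp
  have inv: "(x * ((y * j) mod int p)) mod int p = j" if "[x * y = 1] (mod int p)" "j \<in> {1..<int p}" for x y j
  proof -
    have "[x * y * j = 1 * j] (mod int p)" using that(1) by (rule cong_scalar_right)
    then show ?thesis using that(2) by (simp add: cong_def mod_mult_right_eq mult.assoc)
  qed
  have range: "(y * j) mod int p \<in> {1..<int p}" if "[x * y = 1] (mod int p)" "j \<in> {1..<int p}" for x y j
  proof -
    have "(y * j) mod int p \<noteq> 0" using inv[OF that] that(2) by auto
    moreover have "(y * j) mod int p \<ge> 0" "(y * j) mod int p < int p" using p0 by auto
    ultimately show ?thesis by simp
  qed
  have v: "[v * u = 1] (mod int p)" using u by (simp add: mult.commute)
  show ?thesis
    by (rule sum.reindex_bij_witness[of _ "\<lambda>j. (v * j) mod int p" "\<lambda>j. (u * j) mod int p"])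
       (use inv[OF u] inv[OF v] range[OF u] range[OF v] f in auto)
qed

lemma sum_odd_delta:
  fixes f :: "int \<Rightarrow> complex"
  assumes f: "\<And>i. f (i mod int p) = f i"
  shows "(\<Sum>j\<in>{1..<int p}. odd_delta p j * f j) = f 1 - f (-1)"
proof -
  have "[j = 1] (mod int p) \<longleftrightarrow> j = 1" "[j = -1] (mod int p) \<longleftrightarrow> j = int p - 1" if "j \<in> {1..<int p}" for j
  proof -
    show "[j = 1] (mod int p) \<longleftrightarrow> j = 1" using that p_gt_2 by (simp add: cong_def)
    have "(-1) mod int p = int p - 1" using p_gt_2 by (simp add: zmod_zminus1_eq_if)
    then show "[j = -1] (mod int p) \<longleftrightarrow> j = int p - 1" using that by (simp add: cong_def)
  qed
  then have "(\<Sum>j\<in>{1..<int p}. odd_delta p j * f j)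
      = (\<Sum>j\<in>{1..<int p}. (if j = 1 then f j else 0) - (if j = int p - 1 then f j else 0))"
    using p_gt_2 by (intro sum.cong) (auto simp: odd_delta_def)
  also have "\<dots> = f 1 - f (int p - 1)"
    using p_gt_2 by (simp add: sum_subtractf)
  also have "f (int p - 1) = f (-1)" using f[of "int p - 1"] f[of "-1"] by (simp add: zmod_zminus1_eq_if)
  finally show ?thesis .
qed

lemma sum_int_nat: "(\<Sum>j\<in>{1..<int p}. f j) = (\<Sum>j\<in>{1..<p}. f (int j))"
  by (rule sum.reindex_bij_witness[of _ int nat]) auto

end

locale sawtooth_inversion = primitive_root p g for p g :: nat +
  fixes K :: "int list" and kinv :: "int \<Rightarrow> int"
  assumes kinv_cong: "\<And>k. k \<in> set K \<Longrightarrow> [k * kinv k = 1] (mod int p)"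
    and sawtooth_sum_eq: "\<And>b. (\<Sum>k\<leftarrow>K. sawtooth p (k * b)) = odd_delta p b"
begin

text \<open>\<open>sawtooth_sum_eq\<close> inverts the generalised Bernoulli numbers \<open>B\<^sub>1\<^sub>,\<^sub>\<psi> = - L(0, \<psi>)\<close>.\<close>

lemma inverse_dirichlet_L:
  assumes \<psi>: "\<psi> \<in> odd_characters p"
  shows "2 / dirichlet_L \<psi> 0 = (\<Sum>k\<leftarrow>K. \<psi> (kinv k))"
proof -
  have chi: "dirichlet_character p \<psi>" and odd: "\<psi> (-1) = -1" "\<psi> 1 = 1"
    using \<psi> by (auto simp: odd_characters_def dirichlet_character_def)
  have mult: "\<psi> (m * n) = \<psi> m * \<psi> n" for m n using chi by (simp add: dirichlet_character_def)
  have mod: "\<psi> (m mod int p) = \<psi> m" for m by (rule dirichlet_character_mod[OF chi])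
  have L: "dirichlet_L \<psi> 0 = (\<Sum>j\<in>{1..<int p}. \<psi> j * sawtooth p j)"
    unfolding sum_int_nat dirichlet_L_0[OF \<psi> prime_gt_0_nat[OF prime]]
    by (intro sum.cong) (auto simp: sawtooth_def)
  have "\<psi> (kinv k) * dirichlet_L \<psi> 0 = (\<Sum>b\<in>{1..<int p}. \<psi> b * sawtooth p (k * b))" if k: "k \<in> set K" for k
  proof -
    have inv: "\<psi> (kinv k) * \<psi> k = 1"
      using kinv_cong[OF k] mod odd(2) by (metis cong_def mult mult.commute)
    have "dirichlet_L \<psi> 0 = (\<Sum>b\<in>{1..<int p}. \<psi> (k * b) * sawtooth p (k * b))"
      unfolding L using kinv_cong[OF k] by (rule sum_residues_multiply[symmetric]) (simp add: mod sawtooth_mod)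
    also have "\<psi> (kinv k) * \<dots> = (\<Sum>b\<in>{1..<int p}. (\<psi> (kinv k) * \<psi> k) * \<psi> b * sawtooth p (k * b))"
      unfolding sum_distrib_left by (simp add: mult mult.assoc)
    finally show ?thesis by (simp add: inv)
  qed
  then have "(\<Sum>k\<leftarrow>K. \<psi> (kinv k) * dirichlet_L \<psi> 0) = (\<Sum>k\<leftarrow>K. \<Sum>b\<in>{1..<int p}. \<psi> b * sawtooth p (k * b))"
    by (intro arg_cong[where f = sum_list] map_cong) auto
  also have "\<dots> = (\<Sum>b\<in>{1..<int p}. odd_delta p b * \<psi> b)"
    unfolding sawtooth_sum_eq[symmetric]
    by (induction K) (simp_all add: sum.distrib distrib_right mult.commute[of "\<psi> _"])
  also have "\<dots> = 2" using sum_odd_delta[of \<psi>] mod odd by simp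
  finally have "(\<Sum>k\<leftarrow>K. \<psi> (kinv k)) * dirichlet_L \<psi> 0 = 2" by (simp add: sum_list_mult_const)
  \<comment> \<open>Nonvanishing at 0 comes for free, the product with the finite character sum
    being 2.\<close>
  moreover from this have "dirichlet_L \<psi> 0 \<noteq> 0" by auto
  ultimately show ?thesis by (simp add: field_simps)
qed

text \<open>The Lambert coefficients of \<open>calE b p\<close>: the number of \<open>k\<close> in
  \<open>K\<close> with \<open>b * m\<close> congruent to \<open>k\<close>, minus the number with
  \<open>b * m\<close> congruent to \<open>- k\<close>.\<close>

definition coeff :: "int \<Rightarrow> int \<Rightarrow> complex" where
  "coeff b m = (\<Sum>k\<leftarrow>K. odd_delta p (b * kinv k * m))"

lemma coeff_mod: "coeff b (m mod int p) = coeff b m"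
  unfolding coeff_def
  by (intro arg_cong[where f = sum_list] map_cong odd_delta_cong) (auto simp: cong_def mod_mult_right_eq)

lemma coeff_minus: "coeff b (- m) = - coeff b m"
  unfolding coeff_def by (induction K) (simp_all add: odd_delta_minus)

text \<open>Once \<open>2 / dirichlet_L \<psi> 0\<close> is replaced by the finite sum from
  \<open>inverse_dirichlet_L\<close>, every coefficient is a sum over odd characters, which
  orthogonality evaluates.\<close>

lemma calE_sums:
  assumes \<tau>: "Im \<tau> > 0"
  shows "(\<lambda>n. coeff b (int (Suc n)) * nome \<tau> ^ Suc n / (1 - nome \<tau> ^ Suc n)) sums (calE b p \<tau> - odd_delta p b)"
proof -
  interpret torsion p "nome \<tau>" using p_gt_2 \<tau> by (intro torsion_nome) auto
  define t where "t n = nome \<tau> ^ Suc n / (1 - nome \<tau> ^ Suc n)" for n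
  let ?c = "2 / of_nat (p - 1) :: complex"
  have h: "?c * (of_nat half * x) = x" for x
    using half by simp
  have series: "(\<lambda>n. \<psi> (int (Suc n)) * t n) sums (\<Sum>n. \<psi> (int (Suc n)) * t n)"
    if "\<psi> \<in> odd_characters p" for \<psi>
  proof -
    have chi: "dirichlet_character p \<psi>" "\<psi> (-1) = -1" using that by (auto simp: odd_characters_def)
    have "\<psi> (- m) = - \<psi> m" for m
      using chi by (metis dirichlet_character_def mult_minus1)
    from lambert_series_odd_periodic[where c = \<psi>, OF dirichlet_character_mod[OF chi(1)] this] show ?thesis
      by (simp add: sums_iff t_def)
  qed
  have "(\<lambda>n. ?c * (\<Sum>\<psi>\<in>odd_characters p. \<psi> b * (\<Sum>k\<leftarrow>K. \<psi> (kinv k)) * (\<psi> (int (Suc n)) * t n))) sums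
      (?c * (\<Sum>\<psi>\<in>odd_characters p. \<psi> b * (\<Sum>k\<leftarrow>K. \<psi> (kinv k)) * (\<Sum>n. \<psi> (int (Suc n)) * t n)))"
    using series by (intro sums_mult sums_sum)
  also have "(\<lambda>n. ?c * (\<Sum>\<psi>\<in>odd_characters p. \<psi> b * (\<Sum>k\<leftarrow>K. \<psi> (kinv k)) * (\<psi> (int (Suc n)) * t n)))
      = (\<lambda>n. coeff b (int (Suc n)) * t n)"
  proof
    fix n
    have "(\<Sum>\<psi>\<in>odd_characters p. \<psi> b * (\<Sum>k\<leftarrow>K. \<psi> (kinv k)) * (\<psi> (int (Suc n)) * t n))
        = (\<Sum>\<psi>\<in>odd_characters p. \<Sum>k\<leftarrow>K. \<psi> (b * kinv k * int (Suc n))) * t n"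
      unfolding sum_distrib_right
    proof (intro sum.cong refl)
      fix \<psi> assume "\<psi> \<in> odd_characters p"
      then have "\<psi> (x * y) = \<psi> x * \<psi> y" for x y by (simp add: odd_characters_def dirichlet_character_def)
      then show "\<psi> b * (\<Sum>k\<leftarrow>K. \<psi> (kinv k)) * (\<psi> (int (Suc n)) * t n) = (\<Sum>k\<leftarrow>K. \<psi> (b * kinv k * int (Suc n))) * t n"
        by (simp add: sum_list_mult_const sum_list_const_mult mult_ac del: of_nat_Suc)
    qed
    also have "(\<Sum>\<psi>\<in>odd_characters p. \<Sum>k\<leftarrow>K. \<psi> (b * kinv k * int (Suc n))) = of_nat half * coeff b (int (Suc n))"
      unfolding coeff_def sum_list_const_mult[symmetric] sum_odd_characters[symmetric]
      by (induction K) (simp_all add: sum.distrib)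
    finally show "?c * (\<Sum>\<psi>\<in>odd_characters p. \<psi> b * (\<Sum>k\<leftarrow>K. \<psi> (kinv k)) * (\<psi> (int (Suc n)) * t n))
        = coeff b (int (Suc n)) * t n"
      by (simp only: mult.assoc h)
  qed
  also have "?c * (\<Sum>\<psi>\<in>odd_characters p. \<psi> b * (\<Sum>k\<leftarrow>K. \<psi> (kinv k)) * (\<Sum>n. \<psi> (int (Suc n)) * t n))
      = calE b p \<tau> - odd_delta p b"
  proof -
    have "calE b p \<tau> = ?c * (\<Sum>\<psi>\<in>odd_characters p. \<psi> b + \<psi> b * (\<Sum>k\<leftarrow>K. \<psi> (kinv k)) * (\<Sum>n. \<psi> (int (Suc n)) * t n))"
      unfolding calE_def E1_def t_def
      by (intro arg_cong2[where f = "(*)"] sum.cong refl)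
         (simp add: inverse_dirichlet_L distrib_left mult.assoc)
    also have "\<dots> = ?c * (\<Sum>\<psi>\<in>odd_characters p. \<psi> b)
        + ?c * (\<Sum>\<psi>\<in>odd_characters p. \<psi> b * (\<Sum>k\<leftarrow>K. \<psi> (kinv k)) * (\<Sum>n. \<psi> (int (Suc n)) * t n))"
      by (simp add: sum.distrib distrib_left)
    also have "?c * (\<Sum>\<psi>\<in>odd_characters p. \<psi> b) = odd_delta p b"
      unfolding sum_odd_characters by (rule h)
    finally show ?thesis by simp
  qed
  finally show ?thesis by (simp add: t_def)
qed

text \<open>For the nonconstant parts, each \<open>odd_delta\<close> in \<open>coeff\<close> selects
  the residues \<open>k * b'\<close> and \<open>- k * b'\<close>, which contribute equally by
  oddness and undo the factor one half. The constant terms agree by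
  \<open>sawtooth_sum_eq\<close>.\<close>

lemma calE_eq_sum_zeta_value:
  assumes \<tau>: "Im \<tau> > 0" and b: "[b * b' = 1] (mod int p)"
  shows "calE b p \<tau> = (\<Sum>k\<leftarrow>K. zeta_value p (nome \<tau>) (k * b'))"
proof -
  interpret torsion p "nome \<tau>" using p_gt_2 \<tau> by (intro torsion_nome) auto
  define z where "z i = zeta_value p (nome \<tau>) i - sawtooth p i" for i
  have z: "z (int j) = zeta_series p j (nome \<tau>)" if "j \<in> {1..<p}" for j
    using that by (simp add: z_def zeta_value_def sawtooth_def)
  have z_mod: "z (i mod int p) = z i" for i
    by (simp add: z_def values_mod sawtooth_mod)
  have saw_minus: "sawtooth p (- i) = - sawtooth p i" for i
  proof (cases "i mod int p = 0")
    case False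
    define k where "k = nat (i mod int p)"
    have "i mod int p \<ge> 0" "i mod int p < int p" using p_pos by auto
    with False have k: "i mod int p = int k" "0 < k" "k < p" by (auto simp: k_def)
    then have "nat ((- i) mod int p) = p - k"
      using False by (simp add: zmod_zminus1_eq_if nat_diff_distrib)
    then show ?thesis
      using k by (simp add: sawtooth_def of_nat_diff diff_divide_distrib)
  qed (simp add: sawtooth_def zmod_zminus1_eq_if)
  have z_cong: "z x = z y" if "[x = y] (mod int p)" for x y
    using that z_mod by (metis cong_def)
  have z_minus: "z (- i) = - z i" for i by (simp add: z_def values_minus saw_minus)
  have single: "(\<Sum>j\<in>{1..<int p}. odd_delta p (b * kinv k * j) * z j) = 2 * z (k * b')" if k: "k \<in> set K" for k
  proof -
    have inv: "[(b * kinv k) * (k * b') = 1] (mod int p)"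
      using cong_mult[OF b kinv_cong[OF k]] by (simp add: mult_ac)
    have "(\<Sum>j\<in>{1..<int p}. odd_delta p (b * kinv k * j) * z j)
        = (\<Sum>j\<in>{1..<int p}. odd_delta p (b * kinv k * j) * z ((k * b') * (b * kinv k * j)))"
    proof (intro sum.cong refl arg_cong2[where f = "(*)"])
      fix j
      have "[(b * kinv k) * (k * b') * j = 1 * j] (mod int p)" using inv by (rule cong_scalar_right)
      then have "[(k * b') * (b * kinv k * j) = j] (mod int p)" by (simp add: mult_ac)
      then show "z j = z ((k * b') * (b * kinv k * j))" by (rule z_cong[OF cong_sym])
    qed
    also have "\<dots> = (\<Sum>j\<in>{1..<int p}. odd_delta p j * z ((k * b') * j))"
      using inv
      by (rule sum_residues_multiply[where f = "\<lambda>j. odd_delta p j * z ((k * b') * j)"])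
         (intro arg_cong2[where f = "(*)"] odd_delta_cong z_cong; simp add: cong_def mod_mult_right_eq)
    also have "\<dots> = z (k * b') - z (- (k * b'))"
      by (subst sum_odd_delta) (auto intro!: z_cong simp: cong_def mod_mult_right_eq)
    finally show ?thesis by (simp add: z_minus)
  qed
  have "calE b p \<tau> - odd_delta p b = (\<Sum>j\<in>{1..<p}. coeff b (int j) * zeta_series p j (nome \<tau>)) / 2"
    using calE_sums[OF \<tau>, of b] lambert_series_odd_periodic[where c = "coeff b", OF coeff_mod coeff_minus]
    by (rule sums_unique2)
  also have "(\<Sum>j\<in>{1..<p}. coeff b (int j) * zeta_series p j (nome \<tau>)) = (\<Sum>j\<in>{1..<int p}. coeff b j * z j)"
    unfolding sum_int_nat by (intro sum.cong) (auto simp: z)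
  also have "\<dots> = (\<Sum>k\<leftarrow>K. \<Sum>j\<in>{1..<int p}. odd_delta p (b * kinv k * j) * z j)"
    unfolding coeff_def by (induction K) (simp_all add: sum.distrib distrib_right)
  also have "\<dots> = (\<Sum>k\<leftarrow>K. 2 * z (k * b'))"
    by (intro arg_cong[where f = sum_list] map_cong) (auto simp: single)
  also have "\<dots> / 2 = (\<Sum>k\<leftarrow>K. zeta_value p (nome \<tau>) (k * b')) - (\<Sum>k\<leftarrow>K. sawtooth p (k * b'))"
    unfolding sum_list_const_mult by (simp add: z_def sum_list_subtractf)
  \<comment> \<open>\<open>odd_delta\<close> takes the same value at \<open>b\<close> and at its
    inverse, because 1 and -1 are their own inverses.\<close>
  also have "(\<Sum>k\<leftarrow>K. sawtooth p (k * b')) = odd_delta p b"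
  proof -
    have "[b = s] (mod int p) \<longleftrightarrow> [b' = s] (mod int p)" if "s = 1 \<or> s = -1" for s
    proof -
      have *: "[y = s] (mod int p)" if "[x = s] (mod int p)" "[x * y = 1] (mod int p)" for x y
      proof -
        have 1: "[x * (s * y) = s * (s * y)] (mod int p)" using that(1) by (rule cong_scalar_right)
        have 2: "[s * (x * y) = s * 1] (mod int p)" using that(2) by (rule cong_scalar_left)
        have "s * (s * y) = y" "x * (s * y) = s * (x * y)" using \<open>s = 1 \<or> s = -1\<close> by auto
        with cong_trans[OF cong_sym[OF 1]] 2 show ?thesis by simp
      qed
      have "[b' * b = 1] (mod int p)" using b by (simp add: mult.commute)
      then show ?thesis using * b by blast
    qed
    from this[of 1] this[of "-1"] show ?thesis
      unfolding sawtooth_sum_eq by (simp add: odd_delta_def)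
  qed
  finally show ?thesis by simp
qed

lemma calE_not_identically_0:
  assumes k: "m > 0" "coeff b (int m) \<noteq> 0"
  shows "\<exists>\<tau>. Im \<tau> > 0 \<and> calE b p \<tau> \<noteq> 0"
proof (rule ccontr)
  assume "\<not> ?thesis"
  then have 0: "calE b p \<tau> = 0" if "Im \<tau> > 0" for \<tau> using that by blast
  define C where "C = (\<Sum>j<p. norm (coeff b (int j)))"
  have C: "norm (coeff b (int n)) \<le> C" for n
  proof -
    have "norm (coeff b (int (n mod p))) \<le> C"
      unfolding C_def using p_gt_2 by (intro member_le_sum) auto
    then show ?thesis using coeff_mod[of b "int n"] by (simp add: zmod_int)
  qed
  have "coeff b (int (Suc (m - 1))) = 0"
  proof (rule lambert_series_eq_0_imp[where c = "\<lambda>n. coeff b (int n)" and A = "- odd_delta p b", OF C])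
    fix t :: real assume t: "0 < t" "t < 1"
    \<comment> \<open>The point of the imaginary half-axis whose nome is \<open>t\<close>.\<close>
    define \<tau> where "\<tau> = - \<i> * of_real (ln t / (2 * pi))"
    have "Im \<tau> > 0" using t by (simp add: \<tau>_def divide_neg_pos)
    moreover have "nome \<tau> = of_real t"
    proof -
      have "2 * of_real pi * \<i> * \<tau> = of_real (ln t)"
        by (simp add: \<tau>_def field_simps)
      then show ?thesis using t by (simp add: nome_def exp_of_real)
    qed
    ultimately show "(\<lambda>n. coeff b (int (Suc n)) * of_real t ^ Suc n / (1 - of_real t ^ Suc n)) sums - odd_delta p b"
      using calE_sums[of \<tau> b] 0[of \<tau>] by simp
  qed
  with k show False by simp
qed

end

section \<open>The differential equation\<close>

lemma holomorphic_E2: "E2 holomorphic_on ball 0 1"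
proof -
  let ?f = "\<lambda>n q :: complex. of_nat (Suc n) * q ^ Suc n / (1 - q ^ Suc n)"
  have "\<exists>g. \<forall>q\<in>ball 0 1. (\<lambda>n. ?f n q) sums g q \<and> g field_differentiable at q"
  proof (rule series_differentiable_comparison_complex[of "ball 0 1" ?f])
    fix n and q :: complex assume q: "q \<in> ball 0 1"
    have "norm (q ^ Suc n) < 1" using q by (simp add: norm_power power_less_one_iff del: power_Suc)
    then have "1 - q ^ Suc n \<noteq> 0" by auto
    then show "?f n field_differentiable at q"
      unfolding field_differentiable_def by (intro exI) (rule derivative_eq_intros refl | assumption)+
  next
    fix z :: complex assume z: "z \<in> ball 0 1"
    define r where "r = (1 + norm z) / 2"
    have r: "0 < r" "r < 1" using z by (auto simp: r_def field_simps intro: add_pos_nonneg)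
    let ?h = "\<lambda>n. complex_of_real (1 / (1 - r) * (real (Suc n) ^ 1 * r ^ Suc n))"
    have bd: "norm (?f n y) \<le> norm (?h n)" if "y \<in> ball z (1 - r)" for n y
    proof -
      have "norm y \<le> norm z + norm (y - z)" by (rule norm_triangle_sub)
      then have y: "norm y \<le> r" using that by (simp add: dist_norm norm_minus_commute r_def field_simps)
      have pow: "norm (y ^ Suc n) \<le> r ^ Suc n" unfolding norm_power using y by (intro power_mono) auto
      have "r ^ Suc n \<le> r ^ 1" using r by (intro power_decreasing) auto
      then have "1 - r \<le> norm (1 - y ^ Suc n)"
        using norm_triangle_ineq2[of 1 "y ^ Suc n"] pow by simp
      then have "norm (?f n y) \<le> real (Suc n) * r ^ Suc n / (1 - r)"
        unfolding norm_divide norm_mult norm_of_nat using r pow by (intro frac_le mult_mono) auto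
      also have "\<dots> = norm (?h n)" unfolding norm_of_real using r by simp
      finally show ?thesis .
    qed
    show "\<exists>d h. 0 < d \<and> summable h \<and> range h \<subseteq> \<real>\<^sub>\<ge>\<^sub>0 \<and>
        (\<forall>\<^sub>F n in sequentially. \<forall>y\<in>ball z d \<inter> ball 0 1. norm (?f n y) \<le> cmod (h n))"
    proof (intro exI[of _ "1 - r"] exI[of _ ?h] conjI)
      have "summable (\<lambda>n. real n ^ 1 * r ^ n)" using r by (intro summable_power_times_geometric) auto
      then have "summable (\<lambda>n. real (Suc n) ^ 1 * r ^ Suc n)" by (subst summable_Suc_iff)
      then show "summable ?h" by (intro summable_of_real summable_mult)
      show "range ?h \<subseteq> \<real>\<^sub>\<ge>\<^sub>0"
        using r by (auto simp del: of_real_mult of_real_divide of_nat_Suc power_Suc)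
      show "0 < 1 - r" using r by simp
    qed (use bd in auto)
  qed auto
  then obtain g where g: "\<And>q. q \<in> ball 0 1 \<Longrightarrow> (\<lambda>n. ?f n q) sums g q"
      "\<And>q. q \<in> ball 0 1 \<Longrightarrow> g field_differentiable at q" by blast
  have "(\<lambda>q. 1 - 24 * g q) holomorphic_on ball 0 1"
    using g(2) by (intro holomorphic_intros) (simp add: holomorphic_on_def field_differentiable_at_within)
  then show ?thesis
    by (rule holomorphic_transform) (use g(1) in \<open>auto simp: E2_def sums_iff\<close>)
qed

lemma holomorphic_calF:
  assumes "\<And>k. f k holomorphic_on S"
  shows "(\<lambda>t. calF p (\<lambda>k. f k t)) holomorphic_on S"
proof -
  have "(\<lambda>t. calF_5 (\<lambda>k. f k t)) holomorphic_on S" "(\<lambda>t. calF_7 (\<lambda>k. f k t)) holomorphic_on S"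
    "(\<lambda>t. calF_11 (\<lambda>k. f k t)) holomorphic_on S" "(\<lambda>t. calF_13 (\<lambda>k. f k t)) holomorphic_on S"
    "(\<lambda>t. calF_17 (\<lambda>k. f k t)) holomorphic_on S" "(\<lambda>t. calF_19 (\<lambda>k. f k t)) holomorphic_on S"
    unfolding calF_5_def calF_7_def calF_11_def calF_13_def calF_17_def calF_19_def
    by (intro holomorphic_intros assms)+
  then show ?thesis
    by (cases "p = 5"; cases "p = 7"; cases "p = 11"; cases "p = 13"; cases "p = 17"; cases "p = 19";
        simp add: calF_def)
qed

text \<open>A solution of \<open>f' = g f\<close> is a constant multiple of the exponential of a primitive of \<open>g\<close>.\<close>

lemma linear_ode_nonzero:
  fixes f g :: "complex \<Rightarrow> complex"
  assumes S: "convex S" "open S" and g: "g holomorphic_on S"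
    and f: "\<And>t. t \<in> S \<Longrightarrow> (f has_field_derivative g t * f t) (at t)"
    and t: "t \<in> S" "f t \<noteq> 0" and s: "s \<in> S"
  shows "f s \<noteq> 0"
proof -
  obtain G where G: "\<And>x. x \<in> S \<Longrightarrow> (G has_field_derivative g x) (at x within S)"
    using holomorphic_convex_primitive'[OF S g] by blast
  have "\<exists>c. \<forall>x\<in>S. f x * exp (- G x) = c"
  proof (rule has_field_derivative_zero_constant[OF S(1)])
    fix x assume x: "x \<in> S"
    have "((\<lambda>x. f x * exp (- G x)) has_field_derivative
        f x * (exp (- G x) * - g x) + g x * f x * exp (- G x)) (at x within S)"
      using G[OF x] has_field_derivative_at_within[OF f[OF x]]
      by (auto intro!: derivative_eq_intros)
    then show "((\<lambda>x. f x * exp (- G x)) has_field_derivative 0) (at x within S)"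
      by (simp add: algebra_simps)
  qed
  then have "f s * exp (- G s) = f t * exp (- G t)" using s t by metis
  with t show ?thesis by auto
qed

text \<open>The integers \<open>k1, k2, k3, k4\<close> are chosen such that \<open>calE 1 p\<close> is the sum of the zeta values at
  these multiples of the torsion point; their sum is \<open>p\<close>.\<close>

locale calE_data = primitive_root p g for p g :: nat +
  fixes k1 k2 k3 k4 :: int
  assumes sawtooth_sum: "\<And>b. (\<Sum>k\<leftarrow>[k1, k2, k3, k4]. sawtooth p (k * b)) = odd_delta p b"
    and dvd_sum: "int p dvd k1 + k2 + k3 + k4"
    and not_dvd: "\<And>k. k \<in> {k1, k2, k3, k4, k1 + k1, k1 + k2, k1 + k3, k1 + k4} \<Longrightarrow> \<not> int p dvd k"
    and calF: "\<And>W P R X. \<lbrakk>torsion_values (int p) W P R;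
        \<And>m n. m * n mod int p = 1 \<Longrightarrow> X m = (\<Sum>k\<leftarrow>[k1, k2, k3, k4]. W (n * k))\<rbrakk> \<Longrightarrow>
      calF p (\<lambda>k. X (a_const k p)) = of_nat (6 * p) * torsion_values.log_deriv W P k1 k2 k3 k4"
begin

abbreviation "H \<equiv> {\<tau>. Im \<tau> > 0}"

lemma ex_inverse:
  assumes "\<not> int p dvd k"
  obtains k' where "[k * k' = 1] (mod int p)"
proof -
  have "coprime k (int p)" using assms by (simp add: coprime_iff_not_dvd)
  from cong_solve_coprime_int[OF this] that show ?thesis by blast
qed

definition kinv :: "int \<Rightarrow> int" where "kinv k = (SOME k'. [k * k' = 1] (mod int p))"

lemma kinv:
  assumes "k \<in> set [k1, k2, k3, k4]"
  shows "[k * kinv k = 1] (mod int p)"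
proof -
  have "\<not> int p dvd k" using assms not_dvd[of k] by auto
  then obtain k' where "[k * k' = 1] (mod int p)" by (rule ex_inverse)
  then show ?thesis unfolding kinv_def by (rule someI)
qed

sublocale sawtooth_inversion p g "[k1, k2, k3, k4]" kinv
  by unfold_locales (fact kinv sawtooth_sum)+

text \<open>Read off from the Lambert series, not from the zeta values, so that \<open>b\<close>
  need not be invertible modulo \<open>p\<close>: \<open>holomorphic_calF\<close> asks for every
  index \<open>k\<close>, including those for which \<open>a_const k p\<close> is an unspecified
  list entry.\<close>

lemma calE_holomorphic: "calE b p holomorphic_on H"
proof -
  let ?c = "coeff b"
  have eq: "odd_delta p b + (\<Sum>j\<in>{1..<p}. ?c (int j) * zeta_series p j (nome \<tau>)) / 2 = calE b p \<tau>"
    if "\<tau> \<in> H" for \<tau>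
  proof -
    interpret torsion p "nome \<tau>" using that p_gt_2 by (intro torsion_nome) auto
    have "calE b p \<tau> - odd_delta p b = (\<Sum>j\<in>{1..<p}. ?c (int j) * zeta_series p j (nome \<tau>)) / 2"
      by (rule sums_unique2[OF calE_sums lambert_series_odd_periodic[where c = ?c]])
         (use that coeff_mod coeff_minus in auto)
    then have "calE b p \<tau> = (\<Sum>j\<in>{1..<p}. ?c (int j) * zeta_series p j (nome \<tau>)) / 2 + odd_delta p b"
      by (simp only: diff_eq_eq)
    then show ?thesis by (simp only: add.commute)
  qed
  have "(\<lambda>\<tau>. zeta_series p j (nome \<tau>)) holomorphic_on H" if "j \<in> {1..<p}" for j
  proof -
    have "\<exists>D. ((\<lambda>\<tau>. zeta_series p j (nome \<tau>)) has_field_derivative D) (at \<tau>)" if "\<tau> \<in> H" for \<tau>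
      using DERIV_chain2[OF has_field_derivative_zeta_series[OF torsion_nome] has_field_derivative_nome, of p \<tau> j]
        that \<open>j \<in> {1..<p}\<close> by auto
    then show ?thesis by (subst holomorphic_on_open[OF open_halfspace_Im_gt]) blast
  qed
  then have "(\<lambda>\<tau>. odd_delta p b + (\<Sum>j\<in>{1..<p}. ?c (int j) * zeta_series p j (nome \<tau>)) / 2) holomorphic_on H"
    by (intro holomorphic_intros) auto
  then show ?thesis using eq by (rule holomorphic_transform)
qed

context
  fixes a :: int
  assumes a: "\<not> int p dvd a"
begin

definition rhs :: "complex \<Rightarrow> complex" where
  "rhs \<tau> = calF p (\<lambda>k. calE (a * a_const k p) p \<tau>) + of_nat p * E2 (nome \<tau> ^ p)"

text \<open>Stated in the form \<open>f' = g f\<close>, without division, because the nonvanishing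
  of \<open>calE\<close> is deduced from it.\<close>

lemma calE_derivative:
  assumes \<tau>: "Im \<tau> > 0"
  shows "(calE a p has_field_derivative (2 * of_real pi * \<i> / 12 * rhs \<tau>) * calE a p \<tau>) (at \<tau>)"
proof -
  interpret T: torsion p "nome \<tau>" using p_gt_2 \<tau> by (intro torsion_nome) auto
  obtain a' where a': "[a * a' = 1] (mod int p)" using a by (rule ex_inverse)
  have "\<not> int p dvd a'"
    using a' not_dvd_1 by (metis cong_dvd_iff dvd_mult)
  then have "coprime a' (int p)" by (simp add: coprime_iff_not_dvd)
  define W P R where "W i = zeta_value p (nome \<tau>) (a' * i)" and "P i = wp_value p (nome \<tau>) (a' * i)"
    and "R i = wp'_value p (nome \<tau>) (a' * i)" for i
  interpret V: torsion_values "int p" W P R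
    unfolding W_def P_def R_def by (rule torsion_values.multiply[OF T.torsion_values]) fact
  let ?K = "[k1, k2, k3, k4]"
  have "calE (a * m) p \<tau> = (\<Sum>k\<leftarrow>?K. W (n * k))" if "m * n mod int p = 1" for m n
  proof -
    have "[m * n = 1] (mod int p)" using that p_gt_2 by (simp add: cong_def)
    from cong_mult[OF a' this] have "[(a * m) * (a' * n) = 1] (mod int p)" by (simp add: mult_ac)
    from calE_eq_sum_zeta_value[OF \<tau> this] show ?thesis by (simp add: W_def mult_ac)
  qed
  note X = this
  have F: "calF p (\<lambda>k. calE (a * a_const k p) p \<tau>) = of_nat (6 * p) * V.log_deriv k1 k2 k3 k4"
    by (rule calF[OF V.torsion_values_axioms X])
  have E: "calE a p \<tau> = (\<Sum>k\<leftarrow>?K. W k)"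
    using X[of 1 1] p_gt_2 by simp
  have L: "(\<Sum>k\<leftarrow>?K. R k / 2 - W k * P k) = calE a p \<tau> * V.log_deriv k1 k2 k3 k4 / 2"
    unfolding E by (rule V.log_deriv_eq) (use dvd_sum not_dvd in auto)
  define D where "D k = 2 * of_real pi * \<i> * (of_nat p * (R k / 2 - W k * P k + E2 (nome \<tau> ^ p) / 12 * W k))" for k
  have D: "((\<lambda>\<tau>. zeta_value p (nome \<tau>) (k * a')) has_field_derivative D k) (at \<tau>)" for k
    using has_field_derivative_zeta_value_nome[of p \<tau> "k * a'"] p_gt_2 \<tau>
    by (simp add: D_def W_def P_def R_def mult.commute[of a'])
  have "((\<lambda>\<tau>. zeta_value p (nome \<tau>) (k1 * a') + zeta_value p (nome \<tau>) (k2 * a')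
        + zeta_value p (nome \<tau>) (k3 * a') + zeta_value p (nome \<tau>) (k4 * a'))
      has_field_derivative D k1 + D k2 + D k3 + D k4) (at \<tau>)"
    by (intro DERIV_add D)
  \<comment> \<open>The logarithmic derivative under \<open>q d/dq\<close> is
    \<open>p * log_deriv / 2 + p * E2 / 12\<close>. Multiplied by 12 it becomes
    \<open>6 * p * log_deriv + p * E2\<close>, whence the factor \<open>6 * p\<close> in the locale
    and the term \<open>p * E2\<close> in the theorem.\<close>
  moreover have "D k1 + D k2 + D k3 + D k4 = 2 * of_real pi * \<i> / 12 * rhs \<tau> * calE a p \<tau>"
  proof -
    have "D k1 + D k2 + D k3 + D k4 = 2 * of_real pi * \<i> * of_nat p *
        ((\<Sum>k\<leftarrow>?K. R k / 2 - W k * P k) + E2 (nome \<tau> ^ p) / 12 * (\<Sum>k\<leftarrow>?K. W k))"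
      by (simp add: D_def algebra_simps)
    also have "\<dots> = 2 * of_real pi * \<i> / 12 * rhs \<tau> * calE a p \<tau>"
      unfolding L E[symmetric] rhs_def F by (simp add: field_simps)
    finally show ?thesis .
  qed
  ultimately have "((\<lambda>\<tau>. zeta_value p (nome \<tau>) (k1 * a') + zeta_value p (nome \<tau>) (k2 * a')
        + zeta_value p (nome \<tau>) (k3 * a') + zeta_value p (nome \<tau>) (k4 * a'))
      has_field_derivative 2 * of_real pi * \<i> / 12 * rhs \<tau> * calE a p \<tau>) (at \<tau>)" by simp
  then show ?thesis
  proof (rule has_field_derivative_transform_within_open[OF _ open_halfspace_Im_gt[of 0]])
    show "\<tau> \<in> {z. 0 < Im z}" using \<tau> by simp
    fix z assume "z \<in> {z. 0 < Im z}"
    then show "zeta_value p (nome z) (k1 * a') + zeta_value p (nome z) (k2 * a')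
        + zeta_value p (nome z) (k3 * a') + zeta_value p (nome z) (k4 * a') = calE a p z"
      using calE_eq_sum_zeta_value[OF _ a', of z] by simp
  qed
qed

lemma calE_neq_0:
  assumes \<tau>: "Im \<tau> > 0"
  shows "calE a p \<tau> \<noteq> 0"
proof -
  have "rhs holomorphic_on H"
  proof -
    have "(\<lambda>\<tau>. E2 (nome \<tau> ^ p)) holomorphic_on H"
    proof (rule holomorphic_on_compose_gen[OF _ holomorphic_E2, unfolded o_def])
      show "(\<lambda>\<tau>. nome \<tau> ^ p) holomorphic_on H" unfolding nome_def by (intro holomorphic_intros)
      show "(\<lambda>\<tau>. nome \<tau> ^ p) ` H \<subseteq> ball 0 1"
      proof safe
        fix \<tau> :: complex assume "Im \<tau> > 0"
        then interpret torsion p "nome \<tau>" using p_gt_2 by (intro torsion_nome) auto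
        show "nome \<tau> ^ p \<in> ball 0 1" using norm_Q by simp
      qed
    qed
    then show ?thesis
      unfolding rhs_def[abs_def] by (intro holomorphic_intros holomorphic_calF calE_holomorphic)
  qed
  then have hol: "(\<lambda>\<tau>. 2 * of_real pi * \<i> / 12 * rhs \<tau>) holomorphic_on H"
    by (intro holomorphic_intros)
  obtain a' where a': "[a * a' = 1] (mod int p)" using a by (rule ex_inverse)
  define m where "m = nat ((k1 * a') mod int p)"
  have m: "int m = (k1 * a') mod int p" using p_gt_2 by (simp add: m_def)
  have am: "[a * int m = k1] (mod int p)"
  proof -
    have "[a * int m = a * (k1 * a')] (mod int p)" unfolding m by (simp add: cong_def mod_mult_right_eq)
    also have "[a * (k1 * a') = k1 * 1] (mod int p)" using cong_scalar_left[OF a', of k1] by (simp add: mult_ac)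
    finally show ?thesis by simp
  qed
  have "m > 0"
  proof (rule ccontr)
    assume "\<not> m > 0"
    then have "[k1 = 0] (mod int p)" using am by (simp add: cong_sym)
    then show False using not_dvd[of k1] by (simp add: cong_0_iff)
  qed
  have "coeff a (int m) \<noteq> 0"
  proof -
    have cong: "[k * (a * kinv k * int m) = k1] (mod int p)" if "k \<in> {k1, k2, k3, k4}" for k
      using cong_mult[OF kinv[of k] am] that by (simp add: mult_ac)
    \<comment> \<open>The value -1 would make \<open>k1 + k\<close> divisible by \<open>p\<close>,
      which \<open>not_dvd\<close> excludes for all four \<open>k\<close>, including
      \<open>k = k1\<close>. As \<open>m\<close> satisfies \<open>a * m = k1\<close> modulo
      \<open>p\<close>, the index \<open>k1\<close> contributes 1 to \<open>coeff a m\<close>, and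
      nothing can cancel it.\<close>
    have "odd_delta p (a * kinv k * int m) \<in> {0, 1}" if k: "k \<in> {k1, k2, k3, k4}" for k
    proof -
      have "\<not> [a * kinv k * int m = -1] (mod int p)"
      proof
        assume "[a * kinv k * int m = -1] (mod int p)"
        then have "[k * (a * kinv k * int m) = k * -1] (mod int p)" by (rule cong_scalar_left)
        with cong[OF k] have "[k1 = k * -1] (mod int p)" using cong_sym cong_trans by blast
        then have "int p dvd k1 + k" by (simp add: cong_iff_dvd_diff)
        with k not_dvd show False by auto
      qed
      then show ?thesis by (simp add: odd_delta_def)
    qed
    then have "odd_delta p (a * kinv k2 * int m) \<in> {0, 1}" "odd_delta p (a * kinv k3 * int m) \<in> {0, 1}"
      "odd_delta p (a * kinv k4 * int m) \<in> {0, 1}" by auto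
    moreover have "odd_delta p (a * kinv k1 * int m) = 1"
    proof -
      have "[a * kinv k1 * int m = kinv k1 * k1] (mod int p)"
        using cong_scalar_left[OF am, of "kinv k1"] by (simp add: mult_ac)
      also have "[kinv k1 * k1 = 1] (mod int p)" using kinv[of k1] by (simp add: mult.commute)
      finally show ?thesis by (simp add: odd_delta_def)
    qed
    ultimately show ?thesis
      unfolding coeff_def by auto
  qed
  from calE_not_identically_0[OF \<open>m > 0\<close> this] obtain t where t: "Im t > 0" "calE a p t \<noteq> 0" by auto
  show ?thesis
    by (rule linear_ode_nonzero[OF convex_halfspace_Im_gt open_halfspace_Im_gt hol calE_derivative])
       (use t \<tau> in auto)
qed

lemma log_derivative:
  assumes \<tau>: "Im \<tau> > 0"
  shows "12 / calE a p \<tau> * q_ddq (calE a p) \<tau> = rhs \<tau>"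
proof -
  have "12 / e * ((c / 12 * r * e) / c) = r" if "e \<noteq> 0" "c \<noteq> 0" for c r e :: complex
    using that by simp
  then show ?thesis
    unfolding q_ddq_def DERIV_imp_deriv[OF calE_derivative[OF \<tau>]]
    using calE_neq_0[OF \<tau>] by simp
qed

end

end

section \<open>The six primes\<close>

lemma sawtooth_sum_by_residues:
  assumes "p > 0" and "list_all (\<lambda>r. (\<Sum>k\<leftarrow>K. sawtooth p (k * r)) = odd_delta p r) [0..int p - 1]"
  shows "(\<Sum>k\<leftarrow>K. sawtooth p (k * b)) = odd_delta p b"
proof -
  have "sawtooth p (k * b) = sawtooth p (k * (b mod int p))" for k
    by (metis mod_mult_right_eq sawtooth_mod)
  moreover have "odd_delta p b = odd_delta p (b mod int p)"
    by (simp add: odd_delta_def cong_def)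
  moreover have "b mod int p \<in> set [0..int p - 1]" using assms(1) by auto
  ultimately show ?thesis using assms(2) by (simp add: list_all_iff)
qed

text \<open>A finite check. In terms of fractional parts of \<open>k * b / p\<close>, the four must
  add up to 1 for \<open>b = 1\<close>, to 3 for \<open>b = -1\<close>, and to 2 for every other
  nonzero residue. The case \<open>b = 1\<close> says that the four indices sum to
  \<open>p\<close>.\<close>

lemma sawtooth_sums:
  "(\<Sum>k\<leftarrow>[1, 1, 1, 2]. sawtooth 5 (k * b)) = odd_delta 5 b"
  "(\<Sum>k\<leftarrow>[1, 1, 2, 3]. sawtooth 7 (k * b)) = odd_delta 7 b"
  "(\<Sum>k\<leftarrow>[1, 2, 3, 5]. sawtooth 11 (k * b)) = odd_delta 11 b"
  "(\<Sum>k\<leftarrow>[1, 3, 4, 5]. sawtooth 13 (k * b)) = odd_delta 13 b"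
  "(\<Sum>k\<leftarrow>[2, 3, 5, 7]. sawtooth 17 (k * b)) = odd_delta 17 b"
  "(\<Sum>k\<leftarrow>[3, 4, 5, 7]. sawtooth 19 (k * b)) = odd_delta 19 b"
  by (rule sawtooth_sum_by_residues;
      (unfold odd_delta_def Cong.cong_def)?; simp add: sawtooth_def upto.simps)+

lemma calE_data_intros:
  "primitive_root 5 g \<Longrightarrow> calE_data 5 g 1 1 1 2"
  "primitive_root 7 g \<Longrightarrow> calE_data 7 g 1 1 2 3"
  "primitive_root 11 g \<Longrightarrow> calE_data 11 g 1 2 3 5"
  "primitive_root 13 g \<Longrightarrow> calE_data 13 g 1 3 4 5"
  "primitive_root 17 g \<Longrightarrow> calE_data 17 g 2 3 5 7"
  "primitive_root 19 g \<Longrightarrow> calE_data 19 g 3 4 5 7"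
  by (intro calE_data.intro calE_data_axioms.intro; (rule sawtooth_sums)?;
      auto simp: torsion_values.calF_5 torsion_values.calF_7 torsion_values.calF_11
        torsion_values.calF_13 torsion_values.calF_17 torsion_values.calF_19)+

theorem theorem4p5:
  fixes p :: nat and a :: int and \<tau> :: complex
  assumes "prime p" and "5 \<le> p" and "p \<le> 19"
    and "coprime a (int p)"
    and "Im \<tau> > 0"
  shows "12 / calE a p \<tau> * q_ddq (calE a p) \<tau> =
           calF p (\<lambda>k. calE (a * a_const k p) p \<tau>) + of_nat p * E2 (nome \<tau> ^ p)"
proof -
  obtain g where g: "residue_primroot p g"
    using prime_primitive_root_exists[of p] assms(1) prime_gt_1_nat by blast
  then interpret primitive_root p g using assms by unfold_locales auto
  have data: "\<exists>k1 k2 k3 k4. calE_data p g k1 k2 k3 k4"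
  proof -
    have "p = 5 \<or> p = 6 \<or> p = 7 \<or> p = 8 \<or> p = 9 \<or> p = 10 \<or> p = 11 \<or> p = 12 \<or>
        p = 13 \<or> p = 14 \<or> p = 15 \<or> p = 16 \<or> p = 17 \<or> p = 18 \<or> p = 19"
      using assms by presburger
    then have "p \<in> {5, 7, 11, 13, 17, 19}"
      using assms(1) by (auto simp: prime_nat_numeral_eq)
    then show ?thesis using calE_data_intros[of g] primitive_root_axioms by auto
  qed
  then obtain k1 k2 k3 k4 where "calE_data p g k1 k2 k3 k4" by blast
  then interpret calE_data p g k1 k2 k3 k4 .
  show ?thesis
    using log_derivative[of a \<tau>] assms(4,5) by (simp add: coprime_iff_not_dvd rhs_def)
qed

end
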